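(* Let $p$ be a prime, $n,m\ge1$ integers, $\mathbb{F}=\operatorname{GF}(p^n)$ and $G=U(p^n-1)/\langle p\rangle$. The total number, up to isomorphism, of near-vector spaces $\mathbb{F}^{\oplus m}$ over the finite field $\mathbb{F}$ is exactly $$\sum_{N=1}^{\min(m,|G|)}T(N),$$ where, for each $N$, $$T(N)=\frac{t_N}{N}+\frac1N\sum_{i=1}^{l}(d_i-1)\sum_{j=1}^{k_i}|\overline{S}(H_{ij})| .$$ Here $t_N=\binom{|G|-1}{N-1}\binom{m-1}{N-1}$; $1<d_1<\cdots<d_l$ are all the divisors greater than $1$ of $\gcd(m,N,|G|)$; for each $i$, $H_{i1},\dots,H_{ik_i}$ are the distinct subgroups of $G$ of order $d_i$; and the numbers $|\overline{S}(H_{ij})|$ are given recursively as follows, with $t(N,d)=\binom{|G|/d-1}{N/d-1}\binom{m/d-1}{N/d-1}$ and $C_s(H)$ denoting the set of all subgroups of $G$ of order $d_s$ containing $H$: $$|\overline{S}(H_{lj})|=t(N,d_l)\quad(1\le j\le k_l),$$ $$|\overline{S}(H_{(l-1)j})|=t(N,d_{l-1})-|C_l(H_{(l-1)j})|\,t(N,d_l)\quad(1\le j\le k_{l-1}),$$ and for $2\le v<l$, $1\le j\le k_{l-v}$, $$|\overline{S}(H_{(l-v)j})|=t(N,d_{l-v})-\left[\sum_{s=l-v+1}^{l-1}\ \sum_{H\in C_s(H_{(l-v)j})}|\overline{S}(H)|\right]-|C_l(H_{(l-v)j})|\,t(N,d_l).$$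
   Context: $U(p^n-1)=\{1\le q\le p^n-1 : \gcd(q,p^n-1)=1\}$ is the multiplicative group modulo $p^n-1$, $\langle p\rangle=\{1,p,\dots,p^{n-1}\}$ (modulo $p^n-1$) is the subgroup generated by $p$, and $G=U(p^n-1)/\langle p\rangle$. Each element of $G$ (a coset) is represented by its smallest element in $\{1,\dots,p^n-1\}$; thus $G$ is regarded as a set of integers, with product $q_iq_j$ being the smallest representative of the coset of $q_iq_j \bmod (p^n-1)$. A near-vector space is a pair $(V,A)$ where $(V,+)$ is a group and $A$ is a set of endomorphisms of $V$ containing $0,\mathrm{id},-\mathrm{id}$, such that $A^\ast=A\setminus\{0\}$ is a subgroup of $\operatorname{Aut}(V)$, $A$ acts fixed point freely ($x\alpha=x\beta$ with $x\in V$, $\alpha,\beta\in A$ implies $x=0$ or $\alpha=\beta$), and the quasi-kernel $Q(V)=\{x\in V:\forall \alpha,\beta\in A\ \exists\gamma\in A,\ x\alpha+x\beta=x\gamma\}$ generates $V$ as a group. Two near-vector spaces $(V_1,A_1)$, $(V_2,A_2)$ are isomorphic if there are group isomorphisms $\theta:(V_1,+)\to(V_2,+)$ and $\eta:(A_1^\ast,\cdot)\to(A_2^\ast,\cdot)$ such that $\theta(x\alpha)=\theta(x)\eta(\alpha)$ for all $x\in V_1$, $\alpha\in A_1^\ast$. A near-vector space $\mathbb{F}^{\oplus m}$ over the finite field $\mathbb{F}$ is a near-vector space $(\mathbb{F}^{\oplus m},A)$ with $A=\{s_\alpha:\alpha\in\mathbb{F}\}$ and $(x_1,\dots,x_m)s_\alpha=(x_1\psi_1(\alpha),\dots,x_m\psi_m(\alpha))$,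 where each $\psi_i$ is an automorphism of the multiplicative semigroup $(\mathbb{F},\cdot)$; equivalently $\psi_i(0)=0$ and $\psi_i(\alpha)=\alpha^{q_i}$ on $\mathbb{F}^\ast$ for some $q_i\in U(p^n-1)$. It is said to be determined by the sequence $(q_1,\dots,q_m)$. A suitable sequence of length $m$ on $G$ is a non-decreasing sequence $(S)=(q_1,\dots,q_m)$ of integers in $U(p^n-1)$ such that each $q_i$ is the smallest element of its coset $q_i\langle p\rangle$; $S$ denotes its set of distinct entries. $St(1,m,N)$ is the set of suitable sequences $(S)$ of length $m$ with $1$ in the first position and $|S|=N$. For such sequences, $(S_1)\sim(S_2)$ means that the near-vector spaces determined by them are isomorphic; $[(S)]$ is the $\sim$-class of $(S)$; and $T(N)$ is the number of $\sim$-classes in $St(1,m,N)$. For a subgroup $H\le G$ with $|H|$ dividing $\gcd(m,N,|G|)$, $St(H,m,N)$ is the set of suitable sequences $(S)$ of length $m$ with $|S|=N$ such that $H\subseteq S$, $S$ is a disjoint union of cosets of $H$ in $G$, and entries of $(S)$ lying in the same coset of $H$ occur the same number of times in $(S)$. For $|H|=d_i$, $\overline{S}(H)=\{(S)\in St(H,m,N): |[(S)]|=N/d_i\}$. Empty sums are $0$ (so $T(N)=t_N/N$ when $\gcd(m,N,|G|)=1$). *)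

theory Defs
  imports "HOL-Algebra.Algebra" "HOL-Number_Theory.Totient"
begin

section \<open>The group of units modulo p^n - 1, modulo the powers of p\<close>

text \<open>Residues are taken in {1..M} rather than {0..<M}. This only matters for M = 1 (the field
  with two elements), where the unit group is {1} and not {0}.\<close>

definition residue :: "nat \<Rightarrow> nat \<Rightarrow> nat" where
  "residue M a = (if M dvd a then M else a mod M)"

definition unit_group :: "nat \<Rightarrow> nat monoid" where
  "unit_group M = \<lparr>carrier = totatives M, monoid.mult = (\<lambda>a b. residue M (a * b)), one = 1\<rparr>"

definition p_powers :: "nat \<Rightarrow> nat \<Rightarrow> nat set" where
  "p_powers p n = (\<lambda>k. residue (p ^ n - 1) (p ^ k)) ` {..<n}"

text \<open>The constant \<^const>\<open>flatten\<close> transports the group structure along an injective map. Here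
  this map sends a coset to its smallest element, so the elements of \<open>coset_group p n\<close> are
  integers and the product of \<open>a\<close> and \<open>b\<close> is the smallest element of the coset of \<open>a * b\<close>.\<close>

definition coset_group :: "nat \<Rightarrow> nat \<Rightarrow> nat monoid" where
  "coset_group p n = flatten (unit_group (p ^ n - 1) Mod p_powers p n) Min"

definition subgroups_of_order :: "('g, 'x) monoid_scheme \<Rightarrow> nat \<Rightarrow> 'g set set" where
  "subgroups_of_order G d = {H. subgroup H G \<and> card H = d}"


section \<open>Near-vector spaces\<close>

text \<open>The group V is written multiplicatively, as always in HOL-Algebra, and endomorphisms are
  extensional functions, as in \<^const>\<open>AutoGroup\<close>. The element \<open>x\<alpha>\<close> is written \<open>\<alpha> x\<close>. The product
  of \<^const>\<open>AutoGroup\<close> is therefore opposite to that of maps acting on the right; this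
  affects neither which sets are subgroups nor which maps are isomorphisms between them.\<close>

definition zero_end :: "('v, 'x) monoid_scheme \<Rightarrow> 'v \<Rightarrow> 'v" where
  "zero_end V = (\<lambda>x\<in>carrier V. \<one>\<^bsub>V\<^esub>)"

definition id_end :: "('v, 'x) monoid_scheme \<Rightarrow> 'v \<Rightarrow> 'v" where
  "id_end V = (\<lambda>x\<in>carrier V. x)"

definition neg_id_end :: "('v, 'x) monoid_scheme \<Rightarrow> 'v \<Rightarrow> 'v" where
  "neg_id_end V = (\<lambda>x\<in>carrier V. inv\<^bsub>V\<^esub> x)"

definition quasi_kernel :: "('v, 'x) monoid_scheme \<Rightarrow> ('v \<Rightarrow> 'v) set \<Rightarrow> 'v set" where
  "quasi_kernel V A =
    {x \<in> carrier V. \<forall>\<alpha>\<in>A. \<forall>\<beta>\<in>A. \<exists>\<gamma>\<in>A. \<alpha> x \<otimes>\<^bsub>V\<^esub> \<beta> x = \<gamma> x}"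

definition near_vector_space :: "('v, 'x) monoid_scheme \<Rightarrow> ('v \<Rightarrow> 'v) set \<Rightarrow> bool" where
  "near_vector_space V A \<longleftrightarrow>
    group V \<and>
    A \<subseteq> hom V V \<inter> extensional (carrier V) \<and>
    zero_end V \<in> A \<and> id_end V \<in> A \<and> neg_id_end V \<in> A \<and>
    subgroup (A - {zero_end V}) (AutoGroup V) \<and>
    (\<forall>x\<in>carrier V. \<forall>\<alpha>\<in>A. \<forall>\<beta>\<in>A. \<alpha> x = \<beta> x \<longrightarrow> x = \<one>\<^bsub>V\<^esub> \<or> \<alpha> = \<beta>) \<and>
    generate V (quasi_kernel V A) = carrier V"

definition scalar_group :: "('v, 'x) monoid_scheme \<Rightarrow> ('v \<Rightarrow> 'v) set \<Rightarrow> ('v \<Rightarrow> 'v) monoid" where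
  "scalar_group V A = (AutoGroup V)\<lparr>carrier := A - {zero_end V}\<rparr>"

definition nvs_isomorphic ::
  "('v, 'x) monoid_scheme \<Rightarrow> ('v \<Rightarrow> 'v) set \<Rightarrow> ('w, 'y) monoid_scheme \<Rightarrow> ('w \<Rightarrow> 'w) set \<Rightarrow> bool"
where
  "nvs_isomorphic V\<^sub>1 A\<^sub>1 V\<^sub>2 A\<^sub>2 \<longleftrightarrow>
    (\<exists>\<theta>\<in>iso V\<^sub>1 V\<^sub>2. \<exists>\<eta>\<in>iso (scalar_group V\<^sub>1 A\<^sub>1) (scalar_group V\<^sub>2 A\<^sub>2).
      \<forall>x\<in>carrier V\<^sub>1. \<forall>\<alpha>\<in>A\<^sub>1 - {zero_end V\<^sub>1}. \<theta> (\<alpha> x) = \<eta> \<alpha> (\<theta> x))"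


section \<open>Near-vector spaces over a finite field\<close>

definition power_space :: "('a, 'b) ring_scheme \<Rightarrow> nat \<Rightarrow> (nat \<Rightarrow> 'a) monoid" where
  "power_space F m = product_group {..<m} (\<lambda>_. add_monoid F)"

definition scalars :: "('a, 'b) ring_scheme \<Rightarrow> nat \<Rightarrow> (nat \<Rightarrow> 'a \<Rightarrow> 'a) \<Rightarrow> ((nat \<Rightarrow> 'a) \<Rightarrow> nat \<Rightarrow> 'a) set" where
  "scalars F m \<psi> =
    (\<lambda>\<alpha>. \<lambda>x\<in>carrier (power_space F m). \<lambda>i\<in>{..<m}. x i \<otimes>\<^bsub>F\<^esub> \<psi> i \<alpha>) ` carrier F"

text \<open>All the spaces considered here have the same underlying group \<open>power_space F m\<close>, so
  they are given by their sets of scalars. Since \<^const>\<open>iso\<close> only refers to the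
  multiplication, \<open>iso F F\<close> consists of the automorphisms of the multiplicative semigroup of F.\<close>

definition nvs_over :: "('a, 'b) ring_scheme \<Rightarrow> nat \<Rightarrow> ((nat \<Rightarrow> 'a) \<Rightarrow> nat \<Rightarrow> 'a) set set" where
  "nvs_over F m =
    {A. near_vector_space (power_space F m) A \<and> (\<exists>\<psi>. (\<forall>i<m. \<psi> i \<in> iso F F) \<and> A = scalars F m \<psi>)}"

definition nvs_over_rel ::
  "('a, 'b) ring_scheme \<Rightarrow> nat \<Rightarrow>
    (((nat \<Rightarrow> 'a) \<Rightarrow> nat \<Rightarrow> 'a) set \<times> ((nat \<Rightarrow> 'a) \<Rightarrow> nat \<Rightarrow> 'a) set) set"
where
  "nvs_over_rel F m =
    {(A, B) \<in> nvs_over F m \<times> nvs_over F m.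
      nvs_isomorphic (power_space F m) A (power_space F m) B}"

definition seq_scalars :: "('a, 'b) ring_scheme \<Rightarrow> nat list \<Rightarrow> ((nat \<Rightarrow> 'a) \<Rightarrow> nat \<Rightarrow> 'a) set" where
  "seq_scalars F qs =
    scalars F (length qs) (\<lambda>i \<alpha>. if \<alpha> = \<zero>\<^bsub>F\<^esub> then \<zero>\<^bsub>F\<^esub> else \<alpha> [^]\<^bsub>F\<^esub> (qs ! i))"


section \<open>Suitable sequences\<close>

definition suitable :: "nat \<Rightarrow> nat \<Rightarrow> nat \<Rightarrow> nat list \<Rightarrow> bool" where
  "suitable p n m qs \<longleftrightarrow>
    length qs = m \<and> sorted qs \<and> set qs \<subseteq> totatives (p ^ n - 1) \<and>
    (\<forall>q\<in>set qs. q = Min (p_powers p n #>\<^bsub>unit_group (p ^ n - 1)\<^esub> q))"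

definition St1 :: "nat \<Rightarrow> nat \<Rightarrow> nat \<Rightarrow> nat \<Rightarrow> nat list set" where
  "St1 p n m N = {qs. suitable p n m qs \<and> hd qs = 1 \<and> card (set qs) = N}"

definition seq_rel ::
  "('a, 'b) ring_scheme \<Rightarrow> nat \<Rightarrow> nat \<Rightarrow> nat \<Rightarrow> nat \<Rightarrow> (nat list \<times> nat list) set" where
  "seq_rel F p n m N =
    {(qs, rs) \<in> St1 p n m N \<times> St1 p n m N.
      nvs_isomorphic (power_space F m) (seq_scalars F qs) (power_space F m) (seq_scalars F rs)}"

definition T :: "('a, 'b) ring_scheme \<Rightarrow> nat \<Rightarrow> nat \<Rightarrow> nat \<Rightarrow> nat \<Rightarrow> nat" where
  "T F p n m N = card (St1 p n m N // seq_rel F p n m N)"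

definition StH :: "nat \<Rightarrow> nat \<Rightarrow> nat set \<Rightarrow> nat \<Rightarrow> nat \<Rightarrow> nat list set" where
  "StH p n H m N =
    {qs. suitable p n m qs \<and> card (set qs) = N \<and> H \<subseteq> set qs \<and>
      (\<exists>\<C> \<subseteq> rcosets\<^bsub>coset_group p n\<^esub> H. disjoint \<C> \<and> set qs = \<Union>\<C>) \<and>
      (\<forall>C\<in>rcosets\<^bsub>coset_group p n\<^esub> H. \<forall>a\<in>set qs \<inter> C. \<forall>b\<in>set qs \<inter> C.
        count_list qs a = count_list qs b)}"

text \<open>Every sequence in \<open>StH p n H m N\<close> starts with 1, because H contains 1. Its class
  is therefore taken in \<open>St1 p n m N\<close>.\<close>

definition Sbar :: "('a, 'b) ring_scheme \<Rightarrow> nat \<Rightarrow> nat \<Rightarrow> nat \<Rightarrow> nat \<Rightarrow> nat set \<Rightarrow> nat list set" where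
  "Sbar F p n m N H =
    {qs \<in> StH p n H m N. card (seq_rel F p n m N `` {qs}) = N div card H}"


section \<open>Numerical data\<close>

definition common_divisors :: "nat \<Rightarrow> nat \<Rightarrow> nat \<Rightarrow> nat \<Rightarrow> nat list" where
  "common_divisors p n m N =
    sorted_list_of_set {d. 1 < d \<and> d dvd gcd m (gcd N (order (coset_group p n)))}"

text \<open>The divisors are numbered from 1.\<close>

definition divisor :: "nat \<Rightarrow> nat \<Rightarrow> nat \<Rightarrow> nat \<Rightarrow> nat \<Rightarrow> nat" where
  "divisor p n m N i = common_divisors p n m N ! (i - 1)"

definition t_init :: "nat \<Rightarrow> nat \<Rightarrow> nat \<Rightarrow> nat \<Rightarrow> nat" where
  "t_init p n m N = ((order (coset_group p n) - 1) choose (N - 1)) * ((m - 1) choose (N - 1))"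

definition t_div :: "nat \<Rightarrow> nat \<Rightarrow> nat \<Rightarrow> nat \<Rightarrow> nat \<Rightarrow> nat" where
  "t_div p n m N d =
    ((order (coset_group p n) div d - 1) choose (N div d - 1)) * ((m div d - 1) choose (N div d - 1))"

definition overgroups :: "nat \<Rightarrow> nat \<Rightarrow> nat \<Rightarrow> nat set \<Rightarrow> nat set set" where
  "overgroups p n d H = {K \<in> subgroups_of_order (coset_group p n) d. H \<subseteq> K}"

end

theory Submission
  imports Defs
begin

text \<open>The power map \<open>x \<mapsto> x^u\<close> on GF(p^n) is additive iff \<open>u\<close> is a power of \<open>p\<close> modulo \<open>p^n - 1\<close>. Hence
  the scalars act in the same way, up to a field automorphism, on two coordinates iff their
  exponents lie in the same coset of the powers of \<open>p\<close>, so a near-vector space with a fixed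
  parametrization of its scalars is determined by the multiset of these cosets. Changing the
  parametrization by an automorphism \<open>a \<mapsto> a^r\<close> of the multiplicative group translates the
  multiset by the coset of \<open>r\<close>. The isomorphism classes are therefore the orbits of \<open>G\<close> on the
  multisets of size \<open>m\<close> on \<open>G\<close>.

  Every orbit meets the multisets \<open>S\<close> that contain 1. If \<open>S\<close> has support of size \<open>N\<close> and
  stabilizer \<open>H\<close>, its orbit has \<open>N / |H|\<close> such members, so that \<open>N T(N)\<close> is the sum of the orders
  of the stabilizers. The multisets whose stabilizer contains \<open>H\<close> come from arbitrary multisets on
  the cosets of \<open>H\<close>, and sorting them by their exact stabilizer gives the recursion.\<close>

section \<open>Counting multisets\<close>

text \<open>An isomorphism is only an additive bijection and may mix all coordinates whose exponents
  share a coset, so exponents cannot be compared coordinate by coordinate. The comparison goes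
  through relations \<open>a^q + b^q = c^q\<close> between scalars, which can be tested on vectors
  and are carried along by any additive bijection commuting with the action.

  Translation does not preserve the normalization that a multiset contains 1. The normalized members
  of an orbit correspond to the cosets of the stabilizer that make up the support, which is why
  \<open>N\<close>, and not the order of \<open>G\<close>, appears in the denominator.

  Since \<open>G\<close> acts freely on itself, an invariant multiset is constant on whole cosets of
  its stabilizer, so the order of the stabilizer divides \<open>m\<close>, \<open>N\<close> and the
  order of \<open>G\<close>. A subgroup of the largest order allowed by this has no larger
  stabilizer above it. Its count is therefore a plain product of binomial coefficients, and the
  recursion runs downwards from there.\<close>

lemma card_multisets_of_size:
  assumes "finite A"
  shows "card (multisets_of_size A n) = (card A + n - 1) choose n"
  using assms
proof (induction arbitrary: n rule: finite_induct)
  case empty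
  \<comment> \<open>With truncated subtraction, \<open>(0 + n - 1) choose n\<close> is 1 for
    \<open>n = 0\<close> and 0 otherwise, as it must be on the empty set.\<close>
  then show ?case by (cases n) auto
next
  case (insert a A)
  have "card (multisets_of_size (insert a A) n)
      = card (SIGMA k:{0..n}. multisets_of_size A (n - k))"
    using bij_betw_multisets_of_size_insert[OF insert(2)] by (metis bij_betw_same_card)
  also have "\<dots> = (\<Sum>k\<in>{0..n}. (card A + (n - k) - 1) choose (n - k))"
    using insert by (simp add: finite_multisets_of_size)
  also have "\<dots> = (\<Sum>k\<le>n. (card A + k - 1) choose k)"
    by (simp add: atLeast0AtMost) (rule sum.reindex_bij_witness[of _ "\<lambda>k. n - k" "\<lambda>k. n - k"], auto)
  \<comment> \<open>Hockey-stick identity. The empty \<open>A\<close> is treated apart because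
    \<open>card A + k - 1\<close> is truncated at \<open>k = 0\<close>.\<close>
  also have "\<dots> = (card A + n) choose n"
  proof (cases "card A")
    case 0
    have "(\<Sum>k\<le>n. (card A + k - 1) choose k) = (\<Sum>k\<le>n. if k = 0 then 1 else 0)"
      by (rule sum.cong) (auto simp: 0)
    then show ?thesis using 0 by simp
  next
    case (Suc r)
    then show ?thesis using sum_choose_lower[of r n] by simp
  qed
  finally show ?case using insert by simp
qed

lemma card_set_mset_le_size: "card (set_mset U) \<le> size U"
  by (metis finite_set_mset mset_set_set_mset_msubset size_mset_mono size_mset_set)

text \<open>Removing one copy of each point of \<open>B\<close> leaves an arbitrary multiset of size
  \<open>m - card B\<close> on \<open>B\<close>.\<close>

lemma card_multisets_with_support:
  assumes "finite B" "B \<noteq> {}" "m > 0"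
  shows "card {U. set_mset U = B \<and> size U = m} = (m - 1) choose (card B - 1)"
proof (cases "card B \<le> m")
  case True
  have pos: "card B > 0" using assms by (simp add: card_gt_0_iff)
  have "bij_betw (\<lambda>Y. Y + mset_set B) (multisets_of_size B (m - card B))
     {U. set_mset U = B \<and> size U = m}"
  proof (rule bij_betwI[where g = "\<lambda>U. U - mset_set B"], goal_cases)
    case 1
    then show ?case using assms True by (auto simp: multisets_of_size_def)
  next
    case 2
    show ?case
    proof
      fix U assume U: "U \<in> {U. set_mset U = B \<and> size U = m}"
      then have "mset_set B \<subseteq># U" using mset_set_set_mset_msubset by blast
      then show "U - mset_set B \<in> multisets_of_size B (m - card B)"
        using U by (auto simp: multisets_of_size_def size_Diff_submset dest: in_diffD)
    qed
  next
    case (3 U)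
    then show ?case by simp
  next
    case (4 U)
    then show ?case using mset_set_set_mset_msubset[of U] by auto
  qed
  then have "card {U. set_mset U = B \<and> size U = m} = (card B + (m - card B) - 1) choose (m - card B)"
    using card_multisets_of_size[OF assms(1)] by (metis bij_betw_same_card)
  also have "\<dots> = (m - 1) choose (card B - 1)"
    using True pos binomial_symmetric[of "card B - 1" "m - 1"] by simp
  finally show ?thesis .
next
  case False
  then have "{U. set_mset U = B \<and> size U = m} = {}"
    using card_set_mset_le_size by fastforce
  then have "card {U. set_mset U = B \<and> size U = m} = 0" by (simp only: card.empty)
  \<comment> \<open>\<open>m > 0\<close> turns \<open>m < card B\<close> into
    \<open>m - 1 < card B - 1\<close>, so that the binomial coefficient vanishes.\<close>
  then show ?thesis using False assms(3) by (simp add: binomial_eq_0)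
qed

text \<open>The support consists of \<open>a\<close> and \<open>N - 1\<close> of the other points,
  and every such support carries equally many multisets. Applied to the group this gives
  \<open>t_init\<close>, applied to the cosets of a subgroup it gives \<open>t_div\<close>.\<close>

lemma card_multisets_of_size_support_card:
  assumes "finite A" "a \<in> A" "N > 0" "m > 0"
  shows "card {U \<in> multisets_of_size A m. a \<in># U \<and> card (set_mset U) = N}
       = ((card A - 1) choose (N - 1)) * ((m - 1) choose (N - 1))"
proof -
  define \<B> where "\<B> = insert a ` {B. B \<subseteq> A - {a} \<and> card B = N - 1}"
  have fin: "finite B" if "B \<in> \<B>" for B
    using that assms finite_subset unfolding \<B>_def by blast
  have cardB: "card B = N" if "B \<in> \<B>" for B
  proof -
    obtain C where C: "B = insert a C" "C \<subseteq> A - {a}" "card C = N - 1"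
      using \<open>B \<in> \<B>\<close> by (auto simp: \<B>_def)
    then have "finite C" "a \<notin> C" using assms(1) finite_subset by blast+
    then show ?thesis using C assms(3) by simp
  qed
  have inj: "inj_on (insert a) {B. B \<subseteq> A - {a} \<and> card B = N - 1}"
    by (rule inj_onI) (metis (mono_tags, lifting) Diff_insert_absorb mem_Collect_eq subset_Diff_insert)
  have eq: "{U \<in> multisets_of_size A m. a \<in># U \<and> card (set_mset U) = N}
      = (\<Union>B\<in>\<B>. {U. set_mset U = B \<and> size U = m})" (is "?L = ?R")
  proof
    show "?L \<subseteq> ?R"
    proof
      fix U assume U: "U \<in> ?L"
      then have "set_mset U = insert a (set_mset U - {a})" by auto
      moreover have "set_mset U - {a} \<in> {B. B \<subseteq> A - {a} \<and> card B = N - 1}"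
        using U by (auto simp: multisets_of_size_def)
      ultimately have "set_mset U \<in> \<B>" unfolding \<B>_def by blast
      then show "U \<in> ?R" using U by (auto simp: multisets_of_size_def)
    qed
    show "?R \<subseteq> ?L"
    proof
      fix U assume "U \<in> ?R"
      then have "set_mset U \<in> \<B>" "size U = m" by auto
      moreover from this have "card (set_mset U) = N" by (simp add: cardB)
      ultimately show "U \<in> ?L" using assms unfolding \<B>_def by (auto simp: multisets_of_size_def)
    qed
  qed
  have "card ?R = (\<Sum>B\<in>\<B>. card {U. set_mset U = B \<and> size U = m})"
  proof (rule card_UN_disjoint)
    show "finite \<B>" using assms by (simp add: \<B>_def)
    show "\<forall>B\<in>\<B>. finite {U. set_mset U = B \<and> size U = m}"
    proof
      fix B assume "B \<in> \<B>"
      then have "finite (multisets_of_size B m)" by (intro finite_multisets_of_size fin)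
      then show "finite {U. set_mset U = B \<and> size U = m}"
        by (rule rev_finite_subset) (auto simp: multisets_of_size_def)
    qed
  qed auto
  also have "\<dots> = (\<Sum>B\<in>\<B>. (m - 1) choose (N - 1))"
  proof (rule sum.cong)
    fix B assume B: "B \<in> \<B>"
    then have "B \<noteq> {}" by (auto simp: \<B>_def)
    then show "card {U. set_mset U = B \<and> size U = m} = (m - 1) choose (N - 1)"
      using card_multisets_with_support[OF fin[OF B]] cardB[OF B] assms(4) by simp
  qed simp
  also have "\<dots> = card \<B> * ((m - 1) choose (N - 1))" by simp
  also have "card \<B> = (card A - 1) choose (N - 1)"
    unfolding \<B>_def using card_image[OF inj] n_subsets[of "A - {a}" "N - 1"] assms by simp
  finally show ?thesis using eq by simp
qed


section \<open>Translates of multisets on a group\<close>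

definition translate :: "('g, 'x) monoid_scheme \<Rightarrow> 'g \<Rightarrow> 'g multiset \<Rightarrow> 'g multiset" where
  "translate G g U = image_mset (\<lambda>x. g \<otimes>\<^bsub>G\<^esub> x) U"

definition stabilizer_mset :: "('g, 'x) monoid_scheme \<Rightarrow> 'g multiset \<Rightarrow> 'g set" where
  "stabilizer_mset G U = {g \<in> carrier G. translate G g U = U}"

text \<open>Both arguments are confined to \<open>\<U>\<close>, because the multisets that contain
  the neutral element are not closed under translation.\<close>

definition translate_rel :: "('g, 'x) monoid_scheme \<Rightarrow> 'g multiset set \<Rightarrow> ('g multiset \<times> 'g multiset) set" where
  "translate_rel G \<U> = {(U, Y) \<in> \<U> \<times> \<U>. \<exists>g\<in>carrier G. Y = translate G g U}"

context group
begin

lemma translate_one: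
  assumes "set_mset U \<subseteq> carrier G"
  shows "translate G \<one> U = U"
proof -
  have "translate G \<one> U = image_mset (\<lambda>x. x) U"
    unfolding translate_def by (rule image_mset_cong) (use assms in auto)
  then show ?thesis by simp
qed

lemma translate_translate:
  assumes "set_mset U \<subseteq> carrier G" "g \<in> carrier G" "h \<in> carrier G"
  shows "translate G g (translate G h U) = translate G (g \<otimes> h) U"
  unfolding translate_def multiset.map_comp comp_def
  by (rule image_mset_cong) (use assms in \<open>auto simp: m_assoc\<close>)

lemma translate_carrier:
  assumes "set_mset U \<subseteq> carrier G" "g \<in> carrier G"
  shows "set_mset (translate G g U) \<subseteq> carrier G"
  using assms by (auto simp: translate_def)

lemma size_translate [simp]: "size (translate G g U) = size U"
  by (simp add: translate_def)

lemma card_set_mset_translate: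
  assumes "set_mset U \<subseteq> carrier G" "g \<in> carrier G"
  shows "card (set_mset (translate G g U)) = card (set_mset U)"
proof -
  have "inj_on (\<lambda>x. g \<otimes> x) (set_mset U)"
    by (rule inj_onI) (use assms l_cancel in blast)
  then show ?thesis by (simp add: translate_def card_image)
qed

lemma translate_inv_eq:
  assumes "set_mset U \<subseteq> carrier G" "g \<in> carrier G" "Y = translate G g U"
  shows "U = translate G (inv g) Y"
  using assms by (simp add: translate_translate translate_one)

lemma equiv_translate_rel:
  assumes "\<And>U. U \<in> \<U> \<Longrightarrow> set_mset U \<subseteq> carrier G"
  shows "equiv \<U> (translate_rel G \<U>)"
proof (rule equivI)
  show "refl_on \<U> (translate_rel G \<U>)"
  proof (rule refl_onI)
    fix U assume "U \<in> \<U>"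
    then show "(U, U) \<in> translate_rel G \<U>"
      using translate_one[OF assms, of U] one_closed by (auto simp: translate_rel_def intro: bexI[of _ \<one>])
  qed
  show "sym (translate_rel G \<U>)"
  proof (rule symI)
    fix U V assume "(U, V) \<in> translate_rel G \<U>"
    then show "(V, U) \<in> translate_rel G \<U>"
      using translate_inv_eq[OF assms, of U] inv_closed unfolding translate_rel_def by blast
  qed
  show "trans (translate_rel G \<U>)"
  proof (rule transI)
    fix U V W assume "(U, V) \<in> translate_rel G \<U>" "(V, W) \<in> translate_rel G \<U>"
    then obtain g h where "U \<in> \<U>" "W \<in> \<U>" "g \<in> carrier G" "h \<in> carrier G"
      "V = translate G g U" "W = translate G h V" unfolding translate_rel_def by blast
    then show "(U, W) \<in> translate_rel G \<U>"
      using translate_translate[OF assms, of U h g] m_closed[of h g] unfolding translate_rel_def by auto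
  qed
qed (auto simp: translate_rel_def)

lemma subgroup_stabilizer_mset:
  assumes "set_mset U \<subseteq> carrier G"
  shows "subgroup (stabilizer_mset G U) G"
proof (rule subgroupI)
  show "stabilizer_mset G U \<noteq> {}" using translate_one[OF assms] by (auto simp: stabilizer_mset_def)
next
  fix g assume "g \<in> stabilizer_mset G U"
  then show "inv g \<in> stabilizer_mset G U"
    using translate_inv_eq[OF assms, of g U] by (auto simp: stabilizer_mset_def)
next
  fix g h assume "g \<in> stabilizer_mset G U" "h \<in> stabilizer_mset G U"
  then show "g \<otimes> h \<in> stabilizer_mset G U"
    using translate_translate[OF assms, of g h] by (auto simp: stabilizer_mset_def)
qed (auto simp: stabilizer_mset_def)

text \<open>The translates of \<open>U\<close> that contain the neutral element are the \<open>inv s \<cdot> U\<close> with \<open>s\<close> in the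
  support of \<open>U\<close>, and \<open>s\<close>, \<open>t\<close> give the same translate iff they lie in the same coset of the
  stabilizer.\<close>

lemma card_translates_containing_one:
  assumes U: "set_mset U \<subseteq> carrier G"
  shows "card {Y. \<one> \<in># Y \<and> (\<exists>g\<in>carrier G. Y = translate G g U)} * card (stabilizer_mset G U)
       = card (set_mset U)"
proof -
  define f where "f = (\<lambda>s. translate G (inv s) U)"
  have img: "{Y. \<one> \<in># Y \<and> (\<exists>g\<in>carrier G. Y = translate G g U)} = f ` set_mset U"
  proof (intro equalityI subsetI)
    fix Y assume "Y \<in> {Y. \<one> \<in># Y \<and> (\<exists>g\<in>carrier G. Y = translate G g U)}"
    then obtain g s where g: "g \<in> carrier G" "Y = translate G g U" "s \<in># U" "\<one> = g \<otimes> s"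
      by (auto simp: translate_def)
    then have "g = inv s" using U inv_equality[of g s] by auto
    then show "Y \<in> f ` set_mset U" using g by (auto simp: f_def)
  next
    fix Y assume "Y \<in> f ` set_mset U"
    then obtain s where s: "s \<in># U" "Y = translate G (inv s) U" by (auto simp: f_def)
    then have sG: "s \<in> carrier G" using U by auto
    have "inv s \<otimes> s \<in># Y" using s by (auto simp: translate_def)
    then show "Y \<in> {Y. \<one> \<in># Y \<and> (\<exists>g\<in>carrier G. Y = translate G g U)}"
      using s sG by auto
  qed
  have fibre: "card {t \<in> set_mset U. f t = f s} = card (stabilizer_mset G U)" if s: "s \<in># U" for s
  proof -
    have sG: "s \<in> carrier G" using s U by auto
    have "bij_betw (\<lambda>h. h \<otimes> s) (stabilizer_mset G U) {t \<in> set_mset U. f t = f s}"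
    proof (rule bij_betwI[where g = "\<lambda>t. t \<otimes> inv s"], goal_cases)
      case 1
      show ?case
      proof
        fix h assume h: "h \<in> stabilizer_mset G U"
        then have hG: "h \<in> carrier G" and hX: "translate G h U = U" by (auto simp: stabilizer_mset_def)
        have "h \<otimes> s \<in># translate G h U" using s by (simp add: translate_def)
        moreover have "translate G (inv h) U = U" using translate_inv_eq[OF U hG hX[symmetric]] by simp
        then have "f (h \<otimes> s) = f s"
          using translate_translate[OF U, of "inv s" "inv h"] hG sG by (simp add: f_def inv_mult_group)
        ultimately show "h \<otimes> s \<in> {t \<in> set_mset U. f t = f s}" using hX by simp
      qed
    next
      case 2
      show ?case
      proof
        fix t assume t: "t \<in> {t \<in> set_mset U. f t = f s}"
        then have tG: "t \<in> carrier G" using U by auto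
        have "U = translate G t (f t)" using translate_inv_eq[OF U, of "inv t" "f t"] tG by (simp add: f_def)
        also have "\<dots> = translate G (t \<otimes> inv s) U"
          using t translate_translate[OF U, of t "inv s"] tG sG by (simp add: f_def)
        finally show "t \<otimes> inv s \<in> stabilizer_mset G U" using tG sG by (simp add: stabilizer_mset_def)
      qed
    next
      case (3 h)
      then show ?case using sG by (auto simp: stabilizer_mset_def m_assoc)
    next
      case (4 t)
      then have "t \<in> carrier G" using U by auto
      then show ?case using sG by (auto simp: m_assoc)
    qed
    then show ?thesis by (metis bij_betw_same_card)
  qed
  have "card (set_mset U) = (\<Sum>s\<in>set_mset U. 1)" by simp
  also have "\<dots> = (\<Sum>Y\<in>f ` set_mset U. \<Sum>s\<in>{s \<in> set_mset U. f s = Y}. 1)"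
    by (rule sum.image_gen) simp
  also have "\<dots> = (\<Sum>Y\<in>f ` set_mset U. card (stabilizer_mset G U))"
    by (rule sum.cong) (use fibre in auto)
  finally show ?thesis using img by simp
qed

end

section \<open>Counting equivalence classes\<close>

lemma card_quotient_weighted:
  assumes r: "equiv A r" and fin: "finite A"
    and w: "\<And>x. x \<in> A \<Longrightarrow> card (r `` {x}) * w x = N"
  shows "N * card (A // r) = (\<Sum>x\<in>A. w x)"
proof -
  have finC: "finite C" if "C \<in> A // r" for C
    using that fin r by (meson finite_equiv_class equiv_type)
  have "(\<Sum>x\<in>A. w x) = (\<Sum>x\<in>\<Union>(A // r). w x)" using Union_quotient[OF r] by simp
  also have "\<dots> = (\<Sum>C\<in>A // r. \<Sum>x\<in>C. w x)"
    using sum.Union_disjoint[of "A // r" w] finC quotient_disj[OF r] by fastforce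
  also have "\<dots> = (\<Sum>C\<in>A // r. N)"
  proof (rule sum.cong)
    fix C assume C: "C \<in> A // r"
    \<comment> \<open>The weight is constant on a class, so the class contributes its cardinality
      times that value, which is \<open>N\<close> again.\<close>
    have "w x = N div card C" if "x \<in> C" for x
    proof -
      have "x \<in> A" "r `` {x} = C"
        using that C r by (metis Union_quotient UnionI, metis Image_singleton_iff equiv_class_eq quotientE)
      then have "card C * w x = N" using w by blast
      moreover have "card C > 0" using that finC[OF C] by (auto simp: card_gt_0_iff)
      ultimately show ?thesis by auto
    qed
    moreover obtain x where x: "x \<in> A" "C = r `` {x}" using C by (auto elim: quotientE)
    moreover have "x \<in> C" using x equiv_class_self[OF r] by simp
    ultimately have "(\<Sum>x\<in>C. w x) = card C * w x" by simp
    then show "(\<Sum>x\<in>C. w x) = N" using w x by simp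
  qed simp
  finally show ?thesis by simp
qed

text \<open>To count classes it is enough to have a map that preserves and reflects the relation and
  meets every class. This allows normalized objects, such as multisets containing the neutral
  element, to stand for all others.\<close>

lemma card_quotient_eqI:
  assumes R: "equiv A R" and S: "equiv B S" and f: "\<And>b. b \<in> B \<Longrightarrow> f b \<in> A"
    and rel: "\<And>b c. b \<in> B \<Longrightarrow> c \<in> B \<Longrightarrow> (b, c) \<in> S \<longleftrightarrow> (f b, f c) \<in> R"
    and meet: "\<And>a. a \<in> A \<Longrightarrow> \<exists>b\<in>B. (f b, a) \<in> R"
  shows "card (A // R) = card (B // S)"
proof -
  \<comment> \<open>The image of a class under \<open>f\<close> may be only a part of a class of
    \<open>R\<close>, so it is saturated.\<close>
  define g where "g = (\<lambda>C. R `` (f ` C))"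
  have g: "g (S `` {b}) = R `` {f b}" if "b \<in> B" for b
  proof -
    have "R `` {f c} = R `` {f b}" if "(b, c) \<in> S" for c
      using that \<open>b \<in> B\<close> S rel equiv_class_eq[OF R] by (metis equiv_class_eq_iff)
    moreover have "(b, b) \<in> S" using that S by (meson equivE refl_onD)
    ultimately show ?thesis unfolding g_def by blast
  qed
  have "bij_betw g (B // S) (A // R)"
    unfolding bij_betw_def
  proof
    show "inj_on g (B // S)"
    proof (rule inj_onI)
      fix C D assume "C \<in> B // S" "D \<in> B // S" and eq: "g C = g D"
      then obtain b c where bc: "b \<in> B" "c \<in> B" "C = S `` {b}" "D = S `` {c}" by (meson quotientE)
      then have "R `` {f b} = R `` {f c}" using eq g by simp
      then have "(f b, f c) \<in> R" using R f bc by (simp add: eq_equiv_class_iff)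
      then show "C = D" using rel bc S by (simp add: eq_equiv_class_iff)
    qed
    show "g ` (B // S) = A // R"
    proof (intro equalityI subsetI)
      fix D assume "D \<in> g ` (B // S)"
      then obtain b where "b \<in> B" "D = g (S `` {b})" by (auto elim: quotientE)
      then show "D \<in> A // R" using g f by (auto intro: quotientI)
    next
      fix D assume "D \<in> A // R"
      then obtain a where a: "a \<in> A" "D = R `` {a}" by (meson quotientE)
      then obtain b where b: "b \<in> B" "(f b, a) \<in> R" using meet by blast
      then have "D = g (S `` {b})" using g a equiv_class_eq[OF R] by simp
      then show "D \<in> g ` (B // S)" using b by (auto intro: quotientI)
    qed
  qed
  then show ?thesis by (metis bij_betw_same_card)
qed

text \<open>The elements of the coset group are positive integers, so a sorted sequence of them
  starts with 1 iff it contains 1. For that group, these multisets stand for the sequences of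
  \<open>St1\<close>.\<close>

definition pointed_multisets :: "('g, 'x) monoid_scheme \<Rightarrow> nat \<Rightarrow> nat \<Rightarrow> 'g multiset set" where
  "pointed_multisets G m N =
    {U \<in> multisets_of_size (carrier G) m. \<one>\<^bsub>G\<^esub> \<in># U \<and> card (set_mset U) = N}"

text \<open>Spreading a multiset of cosets of \<open>H\<close> over their elements gives exactly the multisets
  stabilized by \<open>H\<close>. This reduces their number to that of all multisets on a set with
  \<open>order G div card H\<close> elements.\<close>

definition spread :: "'g set multiset \<Rightarrow> 'g multiset" where
  "spread Q = (\<Sum>C\<in>#Q. mset_set C)"

lemma (in group) mem_rcoset_self_iff:
  assumes "subgroup H G" "C \<in> rcosets H" "a \<in> carrier G"
  shows "a \<in> C \<longleftrightarrow> H #> a = C"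
proof
  assume "a \<in> C"
  then show "H #> a = C"
    using assms repr_independence[of a H] unfolding RCOSETS_def by blast
next
  assume "H #> a = C"
  then show "a \<in> C" using rcos_self[OF assms(3,1)] by simp
qed

section \<open>Multisets invariant under a subgroup\<close>

context group
begin

text \<open>Distinct cosets are disjoint, so only the copies of \<open>H #> a\<close> contribute.
  Finiteness matters because \<open>mset_set\<close> of an infinite set is empty.\<close>

lemma count_spread:
  assumes "finite (carrier G)" "subgroup H G" "set_mset Q \<subseteq> rcosets H" "a \<in> carrier G"
  shows "count (spread Q) a = count Q (H #> a)"
  using assms(3)
proof (induction Q)
  case (add C Q)
  then have C: "C \<in> rcosets H" by simp
  then have "finite C"
    using assms(1,2) subgroup.rcosets_carrier[OF assms(2) is_group C] finite_subset by blast
  then show ?case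
    using add mem_rcoset_self_iff[OF assms(2) C assms(4)] by (simp add: spread_def count_mset_set')
qed (simp add: spread_def)

lemma set_mset_spread:
  assumes "finite (carrier G)" "subgroup H G" "set_mset Q \<subseteq> rcosets H"
  shows "set_mset (spread Q) = \<Union>(set_mset Q)"
  using assms(3)
proof (induction Q)
  case (add C Q)
  then have "finite C"
    using assms(1,2) subgroup.rcosets_carrier[OF assms(2) is_group, of C] finite_subset by auto
  then show ?case using add by (simp add: spread_def)
qed (simp add: spread_def)

lemma size_spread:
  assumes "subgroup H G" "set_mset Q \<subseteq> rcosets H"
  shows "size (spread Q) = card H * size Q"
  using assms(2)
proof (induction Q)
  case (add C Q)
  then have "card C = card H"
    using card_rcosets_equal[OF _ subgroup.subset[OF assms(1)], of C] by simp
  then show ?case using add by (simp add: spread_def)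
qed (simp add: spread_def)

lemma card_set_mset_spread:
  assumes "finite (carrier G)" "subgroup H G" "set_mset Q \<subseteq> rcosets H"
  shows "card (set_mset (spread Q)) = card H * card (set_mset Q)"
proof -
  have "card H * card (set_mset Q) = card (\<Union>(set_mset Q))"
  proof (rule card_partition)
    show "card C = card H" if "C \<in> set_mset Q" for C
      using that card_rcosets_equal[OF _ subgroup.subset[OF assms(2)], of C] assms(3) by auto
    show "C \<inter> D = {}" if "C \<in> set_mset Q" "D \<in> set_mset Q" "C \<noteq> D" for C D
      using that rcos_disjoint[OF assms(2)] assms(3) by (auto simp: pairwise_def disjnt_def)
    have "\<Union>(set_mset Q) \<subseteq> carrier G"
      using assms(3) subgroup.rcosets_carrier[OF assms(2) is_group] by blast
    then show "finite (\<Union>(set_mset Q))" using assms(1) finite_subset by blast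
  qed simp
  then show ?thesis using set_mset_spread[OF assms] by simp
qed

lemma count_translate:
  assumes "set_mset U \<subseteq> carrier G" "g \<in> carrier G" "x \<in> carrier G"
  shows "count (translate G g U) (g \<otimes> x) = count U x"
proof -
  have "{y \<in> set_mset U. g \<otimes> x = g \<otimes> y} = (if x \<in># U then {x} else {})"
    using assms by auto
  then show ?thesis by (auto simp: translate_def count_image_mset' not_in_iff)
qed

text \<open>Multiplicities vanish outside the carrier, so invariance becomes a pointwise condition
  on it.\<close>

lemma stabilizer_mset_iff:
  assumes U: "set_mset U \<subseteq> carrier G" and g: "g \<in> carrier G"
  shows "g \<in> stabilizer_mset G U \<longleftrightarrow> (\<forall>x\<in>carrier G. count U (g \<otimes> x) = count U x)"
proof
  assume "g \<in> stabilizer_mset G U"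
  then show "\<forall>x\<in>carrier G. count U (g \<otimes> x) = count U x"
    using count_translate[OF U g] by (simp add: stabilizer_mset_def)
next
  assume *: "\<forall>x\<in>carrier G. count U (g \<otimes> x) = count U x"
  have "translate G g U = U"
  proof (rule multiset_eqI)
    fix y
    show "count (translate G g U) y = count U y"
    proof (cases "y \<in> carrier G")
      case True
      then have "g \<otimes> (inv g \<otimes> y) = y" using g by (simp flip: m_assoc)
      moreover have z: "inv g \<otimes> y \<in> carrier G" using g True by simp
      ultimately show ?thesis using count_translate[OF U g z] bspec[OF * z] by simp
    next
      case False
      then have "y \<notin># U" "y \<notin># translate G g U" using U translate_carrier[OF U g] by auto
      then show ?thesis by (simp add: not_in_iff)
    qed
  qed
  then show "g \<in> stabilizer_mset G U" using g by (simp add: stabilizer_mset_def)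
qed

text \<open>The right coset \<open>H #> x\<close> is the orbit of \<open>x\<close> under left
  multiplication by \<open>H\<close>. Hence invariance under translation by \<open>H\<close> means
  that the multiplicity is constant on right cosets.\<close>

lemma subset_stabilizer_mset_iff:
  assumes U: "set_mset U \<subseteq> carrier G" and H: "subgroup H G"
  shows "H \<subseteq> stabilizer_mset G U \<longleftrightarrow> (\<forall>C\<in>rcosets H. \<forall>a\<in>C. \<forall>b\<in>C. count U a = count U b)"
proof
  assume L: "H \<subseteq> stabilizer_mset G U"
  show "\<forall>C\<in>rcosets H. \<forall>a\<in>C. \<forall>b\<in>C. count U a = count U b"
  proof
    fix C assume "C \<in> rcosets H"
    then obtain x where x: "x \<in> carrier G" "C = H #> x" by (auto simp: RCOSETS_def)
    have "count U a = count U x" if "a \<in> C" for a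
    proof -
      obtain h where h: "h \<in> H" "a = h \<otimes> x"
        using \<open>a \<in> C\<close> x(2) by (auto simp: r_coset_def)
      then have "h \<in> carrier G" using H subgroup.subset by blast
      then show ?thesis using h L stabilizer_mset_iff[OF U, of h] x by auto
    qed
    then show "\<forall>a\<in>C. \<forall>b\<in>C. count U a = count U b" by simp
  qed
next
  assume R: "\<forall>C\<in>rcosets H. \<forall>a\<in>C. \<forall>b\<in>C. count U a = count U b"
  show "H \<subseteq> stabilizer_mset G U"
  proof
    fix h assume h: "h \<in> H"
    then have hG: "h \<in> carrier G" using H subgroup.subset by blast
    have "count U (h \<otimes> x) = count U x" if x: "x \<in> carrier G" for x
    proof -
      have "h \<otimes> x \<in> H #> x" "x \<in> H #> x" "H #> x \<in> rcosets H"
        using h x rcos_self[OF x H] by (auto simp: r_coset_def RCOSETS_def)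
      then show ?thesis using R by blast
    qed
    then show "h \<in> stabilizer_mset G U" using stabilizer_mset_iff[OF U hG] by simp
  qed
qed

lemma set_mset_spread_carrier:
  assumes "finite (carrier G)" "subgroup H G" "set_mset Q \<subseteq> rcosets H"
  shows "set_mset (spread Q) \<subseteq> carrier G"
  using assms subgroup.rcosets_carrier[OF assms(2) is_group] by (auto simp: set_mset_spread)

lemma bij_betw_spread:
  assumes fin: "finite (carrier G)" and H: "subgroup H G"
  shows "bij_betw spread {Q. set_mset Q \<subseteq> rcosets H}
    {U. set_mset U \<subseteq> carrier G \<and> H \<subseteq> stabilizer_mset G U}"
  unfolding bij_betw_def
proof
  show "inj_on spread {Q. set_mset Q \<subseteq> rcosets H}"
  proof (rule inj_onI)
    fix Q R assume Q: "Q \<in> {Q. set_mset Q \<subseteq> rcosets H}" and R: "R \<in> {Q. set_mset Q \<subseteq> rcosets H}"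
      and eq: "spread Q = spread R"
    show "Q = R"
    proof (rule multiset_eqI)
      fix C
      show "count Q C = count R C"
      proof (cases "C \<in> rcosets H")
        case True
        then obtain a where "a \<in> carrier G" "C = H #> a" by (auto simp: RCOSETS_def)
        then show ?thesis using count_spread[OF fin H, of Q a] count_spread[OF fin H, of R a] Q R eq by simp
      next
        case False
        then have "C \<notin># Q" "C \<notin># R" using Q R by auto
        then show ?thesis by (simp add: not_in_iff)
      qed
    qed
  qed
  show "spread ` {Q. set_mset Q \<subseteq> rcosets H} = {U. set_mset U \<subseteq> carrier G \<and> H \<subseteq> stabilizer_mset G U}"
  proof (intro equalityI subsetI)
    fix U assume "U \<in> spread ` {Q. set_mset Q \<subseteq> rcosets H}"
    then obtain Q where Q: "set_mset Q \<subseteq> rcosets H" "U = spread Q" by blast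
    have U: "set_mset U \<subseteq> carrier G" using set_mset_spread_carrier[OF fin H] Q by simp
    moreover have "\<forall>C\<in>rcosets H. \<forall>a\<in>C. \<forall>b\<in>C. count U a = count U b"
    proof (intro ballI)
      fix C a b assume C: "C \<in> rcosets H" and ab: "a \<in> C" "b \<in> C"
      then have "a \<in> carrier G" "b \<in> carrier G"
        using subgroup.rcosets_carrier[OF H is_group] by blast+
      then show "count U a = count U b"
        using ab count_spread[OF fin H Q(1)] Q(2) mem_rcoset_self_iff[OF H C, of a]
          mem_rcoset_self_iff[OF H C, of b] by simp
    qed
    ultimately show "U \<in> {U. set_mset U \<subseteq> carrier G \<and> H \<subseteq> stabilizer_mset G U}"
      using subset_stabilizer_mset_iff[OF U H] by blast
  next
    fix U assume "U \<in> {U. set_mset U \<subseteq> carrier G \<and> H \<subseteq> stabilizer_mset G U}"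
    then have U: "set_mset U \<subseteq> carrier G" and st: "H \<subseteq> stabilizer_mset G U" by auto
    have finR: "finite (rcosets H)" using fin by (simp add: RCOSETS_def)
    \<comment> \<open>By invariance every element of a coset has the same multiplicity, so the
      element picked by \<open>SOME\<close> does not influence \<open>Q\<close>.\<close>
    define Q where "Q = (\<Sum>C\<in>rcosets H. replicate_mset (count U (SOME a. a \<in> C)) C)"
    have cQ: "count Q C = (if C \<in> rcosets H then count U (SOME a. a \<in> C) else 0)" for C
      using finR by (simp add: Q_def count_sum sum.delta)
    have Q: "set_mset Q \<subseteq> rcosets H"
    proof
      fix C assume "C \<in># Q"
      then have "count Q C \<noteq> 0" by simp
      then show "C \<in> rcosets H" using cQ[of C] by (simp split: if_splits)
    qed
    have "U = spread Q"
    proof (rule multiset_eqI)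
      fix a
      show "count U a = count (spread Q) a"
      proof (cases "a \<in> carrier G")
        case True
        have C: "H #> a \<in> rcosets H" using True by (auto simp: RCOSETS_def)
        have a: "a \<in> H #> a" using rcos_self[OF True H] .
        then have "(SOME b. b \<in> H #> a) \<in> H #> a" by (rule someI)
        then show ?thesis
          using count_spread[OF fin H Q True] cQ[of "H #> a"] C a
            iffD1[OF subset_stabilizer_mset_iff[OF U H] st, rule_format, OF C a] by simp
      next
        case False
        then have "a \<notin># U" "a \<notin># spread Q" using U set_mset_spread_carrier[OF fin H Q] by auto
        then show ?thesis by (simp add: not_in_iff)
      qed
    qed
    then show "U \<in> spread ` {Q. set_mset Q \<subseteq> rcosets H}" using Q by blast
  qed
qed

text \<open>Spreading multiplies size and support size by \<open>card H\<close>, and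
  \<open>\<one>\<close> lies in the result exactly when the coset \<open>H\<close> itself occurs.
  What remains is to count multisets on \<open>order G div card H\<close> points whose support
  contains one prescribed point.\<close>

lemma card_stable_pointed_multisets:
  assumes fin: "finite (carrier G)" and H: "subgroup H G"
    and dvd: "card H dvd m" "card H dvd N" and pos: "m > 0" "N > 0"
  shows "card {U \<in> pointed_multisets G m N. H \<subseteq> stabilizer_mset G U}
       = ((order G div card H - 1) choose (N div card H - 1)) *
         ((m div card H - 1) choose (N div card H - 1))"
proof -
  let ?d = "card H"
  have d: "?d > 0"
    using finite_subset[OF subgroup.subset[OF H] fin] subgroup.one_closed[OF H] by (auto simp: card_gt_0_iff)
  have HH: "H \<in> rcosets H" using subgroup.subgroup_in_rcosets[OF H is_group] .
  have one: "\<one> \<in> \<Union>(set_mset Q) \<longleftrightarrow> H \<in># Q" if Q: "set_mset Q \<subseteq> rcosets H" for Q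
  proof
    assume "\<one> \<in> \<Union>(set_mset Q)"
    then obtain C where C: "C \<in># Q" "\<one> \<in> C" by blast
    then have "H #> \<one> = C" using mem_rcoset_self_iff[OF H, of C \<one>] Q by auto
    moreover have "H #> \<one> = H" using coset_mult_one[of H] subgroup.subset[OF H] by simp
    ultimately show "H \<in># Q" using C by simp
  next
    assume "H \<in># Q"
    then show "\<one> \<in> \<Union>(set_mset Q)" using subgroup.one_closed[OF H] by blast
  qed
  have mem: "spread Q \<in> pointed_multisets G m N \<longleftrightarrow>
      Q \<in> multisets_of_size (rcosets H) (m div ?d) \<and> H \<in># Q \<and> card (set_mset Q) = N div ?d"
    if Q: "set_mset Q \<subseteq> rcosets H" for Q
  proof -
    have "?d * size Q = m \<longleftrightarrow> size Q = m div ?d" "?d * card (set_mset Q) = N \<longleftrightarrow> card (set_mset Q) = N div ?d"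
      using dvd d by auto
    then show ?thesis
      using Q one[OF Q] size_spread[OF H Q] card_set_mset_spread[OF fin H Q] set_mset_spread[OF fin H Q]
        set_mset_spread_carrier[OF fin H Q]
      by (auto simp: pointed_multisets_def multisets_of_size_def)
  qed
  have "bij_betw spread
     {Q \<in> multisets_of_size (rcosets H) (m div ?d). H \<in># Q \<and> card (set_mset Q) = N div ?d}
     {U \<in> pointed_multisets G m N. H \<subseteq> stabilizer_mset G U}"
  proof (rule bij_betw_subset[OF bij_betw_spread[OF fin H]])
    show "spread ` {Q \<in> multisets_of_size (rcosets H) (m div ?d). H \<in># Q \<and> card (set_mset Q) = N div ?d}
        = {U \<in> pointed_multisets G m N. H \<subseteq> stabilizer_mset G U}" (is "spread ` ?A = ?B")
    proof (intro equalityI subsetI)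
      fix U assume "U \<in> spread ` ?A"
      then obtain Q where Q: "Q \<in> ?A" "U = spread Q" by blast
      then have "set_mset Q \<subseteq> rcosets H" by (simp add: multisets_of_size_def)
      then show "U \<in> ?B" using mem Q bij_betw_spread[OF fin H] unfolding bij_betw_def by blast
    next
      fix U assume U: "U \<in> ?B"
      then have "U \<in> {U. set_mset U \<subseteq> carrier G \<and> H \<subseteq> stabilizer_mset G U}"
        by (auto simp: pointed_multisets_def multisets_of_size_def)
      then obtain Q where "set_mset Q \<subseteq> rcosets H" "U = spread Q"
        using bij_betw_spread[OF fin H] unfolding bij_betw_def by blast
      then show "U \<in> spread ` ?A" using mem U by blast
    qed
  qed (auto simp: multisets_of_size_def)
  then have "card {U \<in> pointed_multisets G m N. H \<subseteq> stabilizer_mset G U}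
      = card {Q \<in> multisets_of_size (rcosets H) (m div ?d). H \<in># Q \<and> card (set_mset Q) = N div ?d}"
    by (rule bij_betw_same_card[symmetric])
  also have "\<dots> = ((card (rcosets H) - 1) choose (N div ?d - 1)) * ((m div ?d - 1) choose (N div ?d - 1))"
    by (rule card_multisets_of_size_support_card[OF _ HH])
       (use fin dvd pos d in \<open>auto simp: RCOSETS_def div_greater_zero_iff dvd_imp_le\<close>)
  also have "card (rcosets H) = order G div ?d"
    using lagrange_finite[OF fin H] d by (simp flip: lagrange_finite[OF fin H])
  finally show ?thesis .
qed

text \<open>A multiset is spread from a multiset of cosets of its own stabilizer, which gives
  divisibility of \<open>m\<close> and \<open>N\<close>; Lagrange gives that of
  \<open>order G\<close>.\<close>

lemma card_stabilizer_mset_dvd: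
  assumes fin: "finite (carrier G)" and U: "U \<in> pointed_multisets G m N"
  shows "card (stabilizer_mset G U) dvd gcd m (gcd N (order G))"
proof -
  let ?H = "stabilizer_mset G U"
  have c: "set_mset U \<subseteq> carrier G" using U by (simp add: pointed_multisets_def multisets_of_size_def)
  have H: "subgroup ?H G" by (rule subgroup_stabilizer_mset[OF c])
  obtain Q where Q: "set_mset Q \<subseteq> rcosets ?H" "U = spread Q"
    using bij_betw_spread[OF fin H] c unfolding bij_betw_def by blast
  have "m = size U" "N = card (set_mset U)"
    using U by (auto simp: pointed_multisets_def multisets_of_size_def)
  then have "m = card ?H * size Q" "N = card ?H * card (set_mset Q)"
    using size_spread[OF H Q(1)] card_set_mset_spread[OF fin H Q(1)] Q(2) by simp_all
  then have "card ?H dvd m" "card ?H dvd N" by (metis dvd_triv_left)+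
  moreover have "card ?H dvd order G" using lagrange_finite[OF fin H] by (metis dvd_triv_right)
  ultimately show ?thesis by simp
qed

lemma finite_pointed_multisets:
  assumes "finite (carrier G)"
  shows "finite (pointed_multisets G m N)"
  using finite_multisets_of_size[OF assms, of m]
  by (rule rev_finite_subset) (auto simp: pointed_multisets_def)

lemma stabilizer_mset_pointed:
  assumes "finite (carrier G)" "U \<in> pointed_multisets G m N"
  shows "card (stabilizer_mset G U) > 0" "subgroup (stabilizer_mset G U) G"
proof -
  show H: "subgroup (stabilizer_mset G U) G"
    using assms by (auto simp: pointed_multisets_def multisets_of_size_def intro: subgroup_stabilizer_mset)
  show "card (stabilizer_mset G U) > 0"
    using finite_subset[OF subgroup.subset[OF H] assms(1)] subgroup.one_closed[OF H]
    by (auto simp: card_gt_0_iff)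
qed

text \<open>A stabilizer containing \<open>H\<close> is either \<open>H\<close> or a subgroup of
  larger order, and its order divides the gcd. Since only larger orders occur on the right, the
  identities form a triangular system that can be solved from the largest order downwards.\<close>

lemma card_stable_eq_sum:
  assumes fin: "finite (carrier G)" and H: "H \<in> subgroups_of_order G d" and d: "d > 0" and m: "m > 0"
  shows "card {U \<in> pointed_multisets G m N. H \<subseteq> stabilizer_mset G U}
       = card {U \<in> pointed_multisets G m N. stabilizer_mset G U = H}
       + (\<Sum>e | d < e \<and> e dvd gcd m (gcd N (order G)).
            \<Sum>K\<in>{K \<in> subgroups_of_order G e. H \<subseteq> K}.
              card {U \<in> pointed_multisets G m N. stabilizer_mset G U = K})"
proof -
  let ?D = "{e. d < e \<and> e dvd gcd m (gcd N (order G))}"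
  let ?S = "\<lambda>K. {U \<in> pointed_multisets G m N. stabilizer_mset G U = K}"
  let ?\<K> = "\<lambda>e. {K \<in> subgroups_of_order G e. H \<subseteq> K}"
  have finP: "finite (pointed_multisets G m N)" by (rule finite_pointed_multisets[OF fin])
  have finD: "finite ?D"
    using m by (intro finite_subset[OF _ finite_atMost[of m]]) (auto dest: dvd_imp_le)
  have finK: "finite (?\<K> e)" for e
    by (rule finite_subset[of _ "Pow (carrier G)"])
       (use fin in \<open>auto simp: subgroups_of_order_def dest: subgroup.subset\<close>)
  have "{U \<in> pointed_multisets G m N. H \<subseteq> stabilizer_mset G U} = ?S H \<union> (\<Union>e\<in>?D. \<Union>K\<in>?\<K> e. ?S K)"
    (is "?L = ?S H \<union> ?R")
  proof (intro equalityI subsetI)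
    fix U assume U: "U \<in> ?L"
    let ?K = "stabilizer_mset G U"
    have K: "subgroup ?K G" "card ?K dvd gcd m (gcd N (order G))" "finite ?K"
      using U stabilizer_mset_pointed[OF fin, of U m N] card_stabilizer_mset_dvd[OF fin, of U m N]
      by (auto intro: card_ge_0_finite)
    show "U \<in> ?S H \<union> ?R"
    proof (cases "?K = H")
      case False
      then have "d < card ?K" using U H K psubset_card_mono[of ?K H] by (auto simp: subgroups_of_order_def)
      then have "card ?K \<in> ?D" "?K \<in> ?\<K> (card ?K)" using K U by (auto simp: subgroups_of_order_def)
      then show ?thesis using U by blast
    qed (use U in simp)
  qed auto
  moreover have "card (?S H \<union> ?R) = card (?S H) + card ?R"
  proof (rule card_Un_disjoint)
    show "finite (?S H)" using finP by simp
    show "finite ?R" by (rule finite_subset[OF _ finP]) auto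
    show "?S H \<inter> ?R = {}" using H by (auto simp: subgroups_of_order_def)
  qed
  moreover have "card ?R = (\<Sum>e\<in>?D. card (\<Union>K\<in>?\<K> e. ?S K))"
  proof (rule card_UN_disjoint[OF finD])
    show "\<forall>e\<in>?D. finite (\<Union>K\<in>?\<K> e. ?S K)" using finK finP by auto
    show "\<forall>e\<in>?D. \<forall>e'\<in>?D. e \<noteq> e' \<longrightarrow> (\<Union>K\<in>?\<K> e. ?S K) \<inter> (\<Union>K\<in>?\<K> e'. ?S K) = {}"
      by (auto simp: subgroups_of_order_def)
  qed
  moreover have "card (\<Union>K\<in>?\<K> e. ?S K) = (\<Sum>K\<in>?\<K> e. card (?S K))" for e
    by (rule card_UN_disjoint[OF finK]) (use finP in auto)
  ultimately show ?thesis by simp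
qed

text \<open>Each order is split as \<open>1 + (d - 1)\<close>. The ones count the multisets, and the
  rest vanishes for trivial stabilizers. This is the origin of the factor \<open>d - 1\<close> and
  of the restriction to divisors above 1.\<close>

lemma sum_card_stabilizer_mset:
  assumes fin: "finite (carrier G)" and m: "m > 0"
  shows "(\<Sum>U\<in>pointed_multisets G m N. card (stabilizer_mset G U))
       = card (pointed_multisets G m N)
       + (\<Sum>d | 1 < d \<and> d dvd gcd m (gcd N (order G)).
            (d - 1) * (\<Sum>H\<in>subgroups_of_order G d.
               card {U \<in> pointed_multisets G m N. stabilizer_mset G U = H}))"
proof -
  let ?P = "pointed_multisets G m N"
  let ?D = "{d. 1 < d \<and> d dvd gcd m (gcd N (order G))}"
  let ?S = "\<lambda>K. {U \<in> ?P. stabilizer_mset G U = K}"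
  have finP: "finite ?P" by (rule finite_pointed_multisets[OF fin])
  have finD: "finite ?D"
    using m by (intro finite_subset[OF _ finite_atMost[of m]]) (auto dest: dvd_imp_le)
  have finH: "finite (subgroups_of_order G d)" for d
    by (rule finite_subset[of _ "Pow (carrier G)"])
       (use fin in \<open>auto simp: subgroups_of_order_def dest: subgroup.subset\<close>)
  have layer: "(\<Sum>H\<in>subgroups_of_order G d. card (?S H)) = card {U \<in> ?P. card (stabilizer_mset G U) = d}" for d
  proof -
    have "{U \<in> ?P. card (stabilizer_mset G U) = d} = (\<Union>H\<in>subgroups_of_order G d. ?S H)"
      using stabilizer_mset_pointed(2)[OF fin] by (auto simp: subgroups_of_order_def)
    moreover have "card (\<Union>H\<in>subgroups_of_order G d. ?S H) = (\<Sum>H\<in>subgroups_of_order G d. card (?S H))"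
      by (rule card_UN_disjoint[OF finH]) (use finP in auto)
    ultimately show ?thesis by simp
  qed
  have "(\<Sum>U\<in>?P. card (stabilizer_mset G U)) = (\<Sum>U\<in>?P. 1 + (card (stabilizer_mset G U) - 1))"
    by (rule sum.cong) (use stabilizer_mset_pointed(1)[OF fin] in \<open>auto simp: Suc_le_eq\<close>)
  also have "\<dots> = card ?P + (\<Sum>U\<in>?P. card (stabilizer_mset G U) - 1)" by (simp only: sum.distrib) simp
  also have "(\<Sum>U\<in>?P. card (stabilizer_mset G U) - 1)
      = (\<Sum>U\<in>{U \<in> ?P. card (stabilizer_mset G U) \<in> ?D}. card (stabilizer_mset G U) - 1)"
  proof (rule sum.mono_neutral_right[OF finP])
    show "\<forall>U\<in>?P - {U \<in> ?P. card (stabilizer_mset G U) \<in> ?D}. card (stabilizer_mset G U) - 1 = 0"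
      using card_stabilizer_mset_dvd[OF fin] by fastforce
  qed auto
  also have "\<dots> = (\<Sum>d\<in>?D. \<Sum>U\<in>{U \<in> {U \<in> ?P. card (stabilizer_mset G U) \<in> ?D}. card (stabilizer_mset G U) = d}.
      card (stabilizer_mset G U) - 1)"
    by (rule sum.group[symmetric]) (use finP finD in auto)
  also have "\<dots> = (\<Sum>d\<in>?D. (d - 1) * card {U \<in> ?P. card (stabilizer_mset G U) = d})"
  proof (rule sum.cong)
    fix d assume "d \<in> ?D"
    then have "{U \<in> {U \<in> ?P. card (stabilizer_mset G U) \<in> ?D}. card (stabilizer_mset G U) = d}
       = {U \<in> ?P. card (stabilizer_mset G U) = d}" by auto
    then show "(\<Sum>U\<in>{U \<in> {U \<in> ?P. card (stabilizer_mset G U) \<in> ?D}. card (stabilizer_mset G U) = d}.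
      card (stabilizer_mset G U) - 1) = (d - 1) * card {U \<in> ?P. card (stabilizer_mset G U) = d}"
      by simp
  qed simp
  finally show ?thesis by (simp only: layer)
qed

end

section \<open>The group of cosets of the powers of p\<close>

lemma residue_pos: "M > 0 \<Longrightarrow> residue M a > 0"
  by (auto simp: residue_def dvd_eq_mod_eq_0)

lemma residue_le: "M > 0 \<Longrightarrow> residue M a \<le> M"
  by (auto simp: residue_def intro: less_imp_le)

lemma cong_residue: "[residue M a = a] (mod M)"
  by (auto simp: residue_def cong_def)

lemma residue_eq_iff: "residue M a = residue M b \<longleftrightarrow> [a = b] (mod M)"
proof
  assume "residue M a = residue M b"
  then show "[a = b] (mod M)" using cong_residue[of M a] cong_residue[of M b] by (metis cong_sym cong_trans)
next
  assume "[a = b] (mod M)"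
  then show "residue M a = residue M b" by (auto simp: residue_def cong_def dvd_eq_mod_eq_0)
qed

lemma residue_eq_self: "0 < a \<Longrightarrow> a \<le> M \<Longrightarrow> residue M a = a"
  using nat_dvd_not_less[of a M] by (cases "a = M") (auto simp: residue_def)

lemma residue_in_totatives:
  assumes "M > 0" "coprime a M"
  shows "residue M a \<in> totatives M"
  using assms residue_pos residue_le cong_residue[of M a] cong_imp_coprime[of a "residue M a" M]
  by (auto simp: totatives_def cong_sym)

lemma residue_totatives: "a \<in> totatives M \<Longrightarrow> residue M a = a"
  by (auto simp: totatives_def intro: residue_eq_self)

lemma residue_mult_residue:
  "residue M (residue M a * b) = residue M (a * b)" "residue M (a * residue M b) = residue M (a * b)"
  unfolding residue_eq_iff by (auto intro: cong_mult cong_residue)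

lemma unit_group_simps:
  "carrier (unit_group M) = totatives M" "\<one>\<^bsub>unit_group M\<^esub> = 1"
  "a \<otimes>\<^bsub>unit_group M\<^esub> b = residue M (a * b)"
  by (simp_all add: unit_group_def)

lemma comm_group_unit_group:
  assumes "M > 0"
  shows "comm_group (unit_group M)"
proof (rule comm_groupI; unfold unit_group_simps)
  fix a b c assume a: "a \<in> totatives M" "b \<in> totatives M"
  show "residue M (a * b) \<in> totatives M"
    using a assms by (intro residue_in_totatives) (auto simp: totatives_def)
  show "residue M (residue M (a * b) * c) = residue M (a * residue M (b * c))"
    by (simp add: residue_mult_residue mult.assoc)
  show "residue M (a * b) = residue M (b * a)" by (simp add: mult.commute)
next
  show "1 \<in> totatives M" using assms by (auto simp: totatives_def)
next
  fix a assume a: "a \<in> totatives M"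
  then show "residue M (1 * a) = a" by (simp add: residue_totatives)
  obtain b where b: "[a * b = 1] (mod M)"
    using a cong_solve_coprime_nat[of a M] by (auto simp: totatives_def)
  then have "coprime b M"
    by (metis One_nat_def cong_imp_coprime cong_sym coprime_1_left coprime_mult_left_iff)
  then have "residue M b \<in> totatives M" by (rule residue_in_totatives[OF assms])
  moreover have "residue M (residue M b * a) = residue M 1"
    unfolding residue_mult_residue residue_eq_iff using b by (simp add: mult.commute)
  then have "residue M (residue M b * a) = 1" using residue_eq_self[of 1 M] assms by simp
  ultimately show "\<exists>y\<in>totatives M. residue M (y * a) = 1" by blast
qed

text \<open>The argument is reduced first, so that products of exponents can be inserted
  unreduced.\<close>

definition coset_rep :: "nat \<Rightarrow> nat \<Rightarrow> nat \<Rightarrow> nat" where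
  "coset_rep p n a = Min (p_powers p n #>\<^bsub>unit_group (p ^ n - 1)\<^esub> residue (p ^ n - 1) a)"

locale prime_power =
  fixes p n M :: nat
  assumes prime: "Factorial_Ring.prime p" and n: "n \<ge> 1"
  defines "M \<equiv> p ^ n - 1"
begin

lemma M_pos: "M > 0"
proof -
  have "p ^ 1 \<le> p ^ n" using n prime_gt_0_nat[OF prime] by (intro power_increasing) auto
  then show ?thesis using prime_ge_2_nat[OF prime] unfolding M_def by simp
qed

lemma power_n_eq: "p ^ n = M + 1"
  using prime_gt_0_nat[OF prime] by (simp add: M_def)

lemma coprime_power: "coprime (p ^ k) M"
proof -
  have "coprime (p ^ n) M" using power_n_eq by simp
  then show ?thesis using n by (simp add: coprime_power_left_iff)
qed

lemma power_mod_exponent_cong: "[p ^ k = p ^ (k mod n)] (mod M)"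
proof -
  have "[(p ^ n) ^ (k div n) * p ^ (k mod n) = 1 ^ (k div n) * p ^ (k mod n)] (mod M)"
    unfolding power_n_eq by (intro cong_mult cong_pow cong_refl) (simp add: cong_def mod_add_self1[of M 1, simplified] del: One_nat_def)
  moreover have "(p ^ n) ^ (k div n) * p ^ (k mod n) = p ^ k"
    by (simp flip: power_mult power_add)
  ultimately show ?thesis by simp
qed

text \<open>\<open>p ^ n\<close> is congruent to 1 modulo \<open>M\<close>, so exponents only matter
  modulo \<open>n\<close>. Without the bound on \<open>k\<close>, closure under products is plain
  addition of exponents.\<close>

lemma p_powers_eq: "p_powers p n = range (\<lambda>k. residue M (p ^ k))"
proof (intro equalityI subsetI)
  fix x assume "x \<in> range (\<lambda>k. residue M (p ^ k))"
  then obtain k where "x = residue M (p ^ (k mod n))"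
    using power_mod_exponent_cong by (auto simp: residue_eq_iff[symmetric])
  moreover have "k mod n < n" using n by simp
  ultimately show "x \<in> p_powers p n" by (auto simp: p_powers_def M_def)
qed (auto simp: p_powers_def M_def)

sublocale U: comm_group "unit_group M"
  by (rule comm_group_unit_group[OF M_pos])

lemma subgroup_p_powers: "subgroup (p_powers p n) (unit_group M)"
proof (rule U.subgroupI)
  show "p_powers p n \<subseteq> carrier (unit_group M)"
    using residue_in_totatives[OF M_pos coprime_power] by (auto simp: p_powers_eq unit_group_simps)
  show "p_powers p n \<noteq> {}" by (auto simp: p_powers_eq)
next
  fix a assume "a \<in> p_powers p n"
  then obtain k where k: "a = residue M (p ^ k)" by (auto simp: p_powers_eq)
  \<comment> \<open>The exponent \<open>k * (n - 1)\<close> complements \<open>k\<close> to the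
    multiple \<open>k * n\<close>, which yields the inverse without negative exponents.\<close>
  have "[p ^ (k * (n - 1)) * p ^ k = p ^ ((k * (n - 1) + k) mod n)] (mod M)"
    using power_mod_exponent_cong by (simp flip: power_add)
  moreover have "k * (n - 1) + k = k * n" using n by (simp add: algebra_simps diff_mult_distrib2)
  ultimately have "residue M (residue M (p ^ (k * (n - 1))) * a) = residue M 1"
    unfolding k residue_mult_residue residue_eq_iff by simp
  then have "residue M (residue M (p ^ (k * (n - 1))) * a) = 1"
    using residue_eq_self[of 1 M] M_pos by simp
  then have "inv\<^bsub>unit_group M\<^esub> a = residue M (p ^ (k * (n - 1)))"
    by (intro U.inv_equality)
       (use k residue_in_totatives[OF M_pos coprime_power] in \<open>auto simp: unit_group_simps\<close>)
  then show "inv\<^bsub>unit_group M\<^esub> a \<in> p_powers p n" by (auto simp: p_powers_eq)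
next
  fix a b assume "a \<in> p_powers p n" "b \<in> p_powers p n"
  then show "a \<otimes>\<^bsub>unit_group M\<^esub> b \<in> p_powers p n"
    by (auto simp: p_powers_eq unit_group_simps residue_mult_residue simp flip: power_add)
qed

lemma normal_p_powers: "p_powers p n \<lhd> unit_group M"
  using subgroup_p_powers by (simp add: U.normal_iff_subgroup)

lemma rcoset_p_powers:
  "p_powers p n #>\<^bsub>unit_group M\<^esub> residue M a = range (\<lambda>k. residue M (p ^ k * a))"
  by (auto simp: r_coset_def p_powers_eq unit_group_simps residue_mult_residue)

lemma finite_rcoset: "finite (p_powers p n #>\<^bsub>unit_group M\<^esub> a)"
proof -
  have "finite (p_powers p n)" by (simp add: p_powers_def)
  then show ?thesis by (simp add: r_coset_def)
qed

lemma coset_rep_eq: "coset_rep p n a = Min (p_powers p n #>\<^bsub>unit_group M\<^esub> residue M a)"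
  unfolding coset_rep_def M_def ..

lemma coset_rep_mem: "coset_rep p n a \<in> range (\<lambda>k. residue M (p ^ k * a))"
  unfolding coset_rep_eq using Min_in[OF finite_rcoset, of "residue M a"]
  by (simp add: rcoset_p_powers)

lemma coset_rep_eq_iff:
  assumes "coprime a M" "coprime b M"
  shows "coset_rep p n a = coset_rep p n b \<longleftrightarrow> (\<exists>k. [b = a * p ^ k] (mod M))"
proof
  assume "\<exists>k. [b = a * p ^ k] (mod M)"
  then obtain k where "residue M b = residue M (p ^ k) \<otimes>\<^bsub>unit_group M\<^esub> residue M a"
    by (auto simp: unit_group_simps residue_mult_residue residue_eq_iff mult.commute)
  then have "residue M b \<in> p_powers p n #>\<^bsub>unit_group M\<^esub> residue M a"
    by (auto simp: r_coset_def p_powers_eq)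
  then show "coset_rep p n a = coset_rep p n b"
    using U.repr_independence[OF _ _ subgroup_p_powers, of "residue M b" "residue M a"]
      residue_in_totatives[OF M_pos assms(1)]
    by (simp add: coset_rep_eq unit_group_simps)
next
  assume eq: "coset_rep p n a = coset_rep p n b"
  obtain j k where "coset_rep p n a = residue M (p ^ j * a)" "coset_rep p n b = residue M (p ^ k * b)"
    using coset_rep_mem[of a] coset_rep_mem[of b] by blast
  with eq have "residue M (p ^ j * a) = residue M (p ^ k * b)" by simp
  then have jk: "[p ^ j * a = p ^ k * b] (mod M)" by (simp add: residue_eq_iff)
  \<comment> \<open>Multiplication by \<open>p ^ ?i\<close> cancels \<open>p ^ k\<close>, because
    \<open>?i + k\<close> is a multiple of \<open>n\<close>.\<close>
  let ?i = "k * (n - 1)"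
  have "[p ^ (?i + k) = p ^ ((?i + k) mod n)] (mod M)" by (rule power_mod_exponent_cong)
  moreover have "?i + k = k * n" using n by (simp add: algebra_simps diff_mult_distrib2)
  ultimately have "[p ^ (?i + k) * b = 1 * b] (mod M)" by (intro cong_mult cong_refl) simp
  moreover have "[p ^ ?i * (p ^ j * a) = p ^ ?i * (p ^ k * b)] (mod M)"
    by (intro cong_mult cong_refl jk)
  ultimately have "[b = a * p ^ (?i + j)] (mod M)"
    by (simp add: power_add ac_simps) (metis cong_sym cong_trans)
  then show "\<exists>k. [b = a * p ^ k] (mod M)" by blast
qed

text \<open>The minimum of a finite coset lies in it, and distinct cosets are disjoint. This
  injectivity is the condition under which \<open>flatten\<close> transports the group
  structure.\<close>

lemma inj_on_Min: "inj_on Min (carrier (unit_group M Mod p_powers p n))"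
proof (rule inj_onI)
  fix C D assume "C \<in> carrier (unit_group M Mod p_powers p n)"
    "D \<in> carrier (unit_group M Mod p_powers p n)" and eq: "Min C = Min D"
  then obtain a b where ab: "a \<in> totatives M" "b \<in> totatives M"
    "C = p_powers p n #>\<^bsub>unit_group M\<^esub> a" "D = p_powers p n #>\<^bsub>unit_group M\<^esub> b"
    by (auto simp: carrier_FactGroup unit_group_simps)
  have "a \<in> C" "b \<in> D" using ab U.rcos_self[OF _ subgroup_p_powers] by (auto simp: unit_group_simps)
  then have "Min C \<in> C" "Min D \<in> D" using ab finite_rcoset by (metis Min_in empty_iff)+
  then show "C = D"
    using eq ab U.repr_independence[OF _ _ subgroup_p_powers] by (metis unit_group_simps(1))
qed

lemma coset_rep_totatives:
  "a \<in> totatives M \<Longrightarrow> coset_rep p n a = Min (p_powers p n #>\<^bsub>unit_group M\<^esub> a)"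
  by (simp add: coset_rep_eq residue_totatives)

lemma carrier_coset_group: "carrier (coset_group p n) = coset_rep p n ` totatives M"
  unfolding coset_group_def flatten_def M_def[symmetric]
  by (auto simp: carrier_FactGroup unit_group_simps coset_rep_totatives)

lemma coset_rep_residue: "coset_rep p n (residue M a) = coset_rep p n a"
  using cong_residue[of M a] by (simp add: coset_rep_eq flip: residue_eq_iff)

lemma coset_rep_in_carrier:
  assumes "coprime a M"
  shows "coset_rep p n a \<in> carrier (coset_group p n)"
  using residue_in_totatives[OF M_pos assms] coset_rep_residue[of a]
  by (auto simp: carrier_coset_group intro: rev_image_eqI)

text \<open>\<open>Min\<close> is a homomorphism on the quotient by construction of the flattened
  group, so \<open>coset_rep\<close> is multiplicative on all integers prime to
  \<open>M\<close>.\<close>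

lemma mult_coset_group:
  assumes "coprime a M" "coprime b M"
  shows "coset_rep p n a \<otimes>\<^bsub>coset_group p n\<^esub> coset_rep p n b = coset_rep p n (a * b)"
proof -
  let ?U = "unit_group M" and ?P = "p_powers p n"
  interpret N: normal ?P ?U by (rule normal_p_powers)
  have r: "residue M a \<in> carrier ?U" "residue M b \<in> carrier ?U"
    using residue_in_totatives[OF M_pos] assms by (auto simp: unit_group_simps)
  have c: "?P #>\<^bsub>?U\<^esub> residue M a \<in> carrier (?U Mod ?P)" "?P #>\<^bsub>?U\<^esub> residue M b \<in> carrier (?U Mod ?P)"
    using r by (auto simp: carrier_FactGroup)
  have "Min \<in> hom (?U Mod ?P) (coset_group p n)"
    unfolding coset_group_def M_def[symmetric]
    by (rule flatten_set_group_hom[OF N.factorgroup_is_group inj_on_Min])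
  from hom_mult[OF this c]
  have "coset_rep p n a \<otimes>\<^bsub>coset_group p n\<^esub> coset_rep p n b
      = Min ((?P #>\<^bsub>?U\<^esub> residue M a) <#>\<^bsub>?U\<^esub> (?P #>\<^bsub>?U\<^esub> residue M b))"
    by (simp add: coset_rep_eq)
  also have "\<dots> = Min (?P #>\<^bsub>?U\<^esub> residue M (a * b))"
    using N.rcos_sum[OF r] by (simp add: unit_group_simps residue_mult_residue)
  finally show ?thesis by (simp add: coset_rep_eq)
qed

lemma coset_rep_one: "coset_rep p n 1 = 1"
proof -
  have "p_powers p n #>\<^bsub>unit_group M\<^esub> residue M 1 = range (\<lambda>k. residue M (p ^ k))"
    using rcoset_p_powers[of 1] by simp
  moreover have "1 \<in> range (\<lambda>k. residue M (p ^ k))"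
    using residue_eq_self[of 1 M] M_pos by (auto intro!: image_eqI[of _ _ 0])
  moreover have "x \<ge> 1" if "x \<in> range (\<lambda>k. residue M (p ^ k))" for x
    using that residue_pos[OF M_pos] by (auto simp: Suc_le_eq)
  ultimately show ?thesis
    unfolding coset_rep_eq using finite_rcoset[of "residue M 1"]
    by (intro Min_eqI) auto
qed

lemma one_coset_group: "\<one>\<^bsub>coset_group p n\<^esub> = 1"
proof -
  have "p_powers p n #>\<^bsub>unit_group M\<^esub> 1 = p_powers p n"
    using U.coset_mult_one[OF subgroup.subset[OF subgroup_p_powers]] by (simp add: unit_group_simps)
  moreover have "1 \<in> totatives M" using M_pos by (auto simp: totatives_def)
  ultimately have "Min (p_powers p n) = 1"
    using coset_rep_totatives[of 1] coset_rep_one by simp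
  then show ?thesis by (simp add: coset_group_def flatten_def)
qed

lemma coset_rep_coset_rep:
  assumes "coprime a M"
  shows "coprime (coset_rep p n a) M" "coset_rep p n a \<in> totatives M"
    "coset_rep p n (coset_rep p n a) = coset_rep p n a"
proof -
  obtain k where k: "coset_rep p n a = residue M (p ^ k * a)" using coset_rep_mem by blast
  then show t: "coset_rep p n a \<in> totatives M"
    using assms coprime_power by (auto intro: residue_in_totatives[OF M_pos])
  then show c: "coprime (coset_rep p n a) M" by (simp add: totatives_def)
  have "[coset_rep p n a = a * p ^ k] (mod M)"
    unfolding k by (metis cong_residue mult.commute)
  then show "coset_rep p n (coset_rep p n a) = coset_rep p n a"
    using coset_rep_eq_iff[OF assms c] by metis
qed

lemma carrier_coset_group_eq:
  "carrier (coset_group p n)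
     = {q \<in> totatives M. q = Min (p_powers p n #>\<^bsub>unit_group M\<^esub> q)}"
proof (intro equalityI subsetI)
  fix q assume "q \<in> carrier (coset_group p n)"
  then obtain a where "a \<in> totatives M" "q = coset_rep p n a" by (auto simp: carrier_coset_group)
  moreover from this have "coprime a M" by (simp add: totatives_def)
  ultimately show "q \<in> {q \<in> totatives M. q = Min (p_powers p n #>\<^bsub>unit_group M\<^esub> q)}"
    using coset_rep_coset_rep[of a] coset_rep_totatives[of q] by simp
qed (use coset_rep_totatives in \<open>auto simp: carrier_coset_group\<close>)

lemma coset_rep_carrier: "q \<in> carrier (coset_group p n) \<Longrightarrow> coset_rep p n q = q"
  by (auto simp: carrier_coset_group_eq coset_rep_totatives)

lemma carrier_coset_groupD:
  "q \<in> carrier (coset_group p n) \<Longrightarrow> q \<in> totatives M"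
  "q \<in> carrier (coset_group p n) \<Longrightarrow> coprime q M"
  by (auto simp: carrier_coset_group_eq totatives_def)

lemma finite_carrier_coset_group: "finite (carrier (coset_group p n))"
  by (simp add: carrier_coset_group)

lemma group_coset_group: "group (coset_group p n)"
  unfolding coset_group_def M_def[symmetric]
  by (rule flatten_set_group[OF normal.factorgroup_is_group[OF normal_p_powers] inj_on_Min])

lemma suitable_iff:
  "suitable p n m qs \<longleftrightarrow> length qs = m \<and> sorted qs \<and> set qs \<subseteq> carrier (coset_group p n)"
  unfolding suitable_def carrier_coset_group_eq M_def[symmetric] by blast

end

section \<open>Power maps on a finite field\<close>

text \<open>The binomial theorem is used with second summand \<open>\<one>\<close>: in a field, a
  sum \<open>a \<oplus> b\<close> with nonzero \<open>b\<close> is \<open>b\<close> times a sum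
  \<open>c \<oplus> \<one>\<close>.\<close>

lemma (in cring) add_one_pow:
  assumes "y \<in> carrier R"
  shows "(y \<oplus> \<one>) [^] (k::nat) = (\<Oplus>i\<in>{..k}. [(k choose i)] \<cdot>\<^bsub>R\<^esub> (y [^] i))"
proof (induction k)
  case 0
  show ?case by simp
next
  case (Suc k)
  let ?S = "\<Oplus>i\<in>{..k}. [(k choose i)] \<cdot>\<^bsub>R\<^esub> (y [^] i)"
  have y: "y [^] (i::nat) \<in> carrier R" for i using assms by simp
  have A: "?S \<otimes> y = (\<Oplus>i\<in>{..k}. [(k choose i)] \<cdot>\<^bsub>R\<^esub> (y [^] Suc i))"
  proof -
    have "?S \<otimes> y = (\<Oplus>i\<in>{..k}. [(k choose i)] \<cdot>\<^bsub>R\<^esub> (y [^] i) \<otimes> y)"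
      by (rule finsum_ldistr) (use assms in auto)
    also have "\<dots> = (\<Oplus>i\<in>{..k}. [(k choose i)] \<cdot>\<^bsub>R\<^esub> (y [^] Suc i))"
      by (rule finsum_cong') (use assms in \<open>auto simp: add_pow_ldistr\<close>)
    finally show ?thesis .
  qed
  \<comment> \<open>The constant term is split off after adding the term of index
    \<open>Suc k\<close>, whose coefficient is 0. The remaining sum then has the same range as in
    \<open>A\<close>, ready for Pascal's rule.\<close>
  have B: "?S = (\<Oplus>i\<in>{..k}. [(k choose Suc i)] \<cdot>\<^bsub>R\<^esub> (y [^] Suc i)) \<oplus> \<one>"
  proof -
    have "?S = (\<Oplus>i\<in>{..Suc k}. [(k choose i)] \<cdot>\<^bsub>R\<^esub> (y [^] i))"
      using y by (simp add: finsum_Suc binomial_eq_0 Pi_def)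
    also have "\<dots> = (\<Oplus>i\<in>{..k}. [(k choose Suc i)] \<cdot>\<^bsub>R\<^esub> (y [^] Suc i)) \<oplus> \<one>"
      by (subst finsum_Suc2) (use assms in \<open>auto simp: Pi_def\<close>)
    finally show ?thesis .
  qed
  have "(y \<oplus> \<one>) [^] Suc k = ?S \<otimes> y \<oplus> ?S"
    using Suc y assms by (simp add: r_distr Pi_def)
  also have "\<dots> = (\<Oplus>i\<in>{..k}. [(k choose i)] \<cdot>\<^bsub>R\<^esub> (y [^] Suc i)) \<oplus>
      ((\<Oplus>i\<in>{..k}. [(k choose Suc i)] \<cdot>\<^bsub>R\<^esub> (y [^] Suc i)) \<oplus> \<one>)"
    using A B by simp
  also have "\<dots> = (\<Oplus>i\<in>{..k}. [(k choose i)] \<cdot>\<^bsub>R\<^esub> (y [^] Suc i) \<oplus> [(k choose Suc i)] \<cdot>\<^bsub>R\<^esub> (y [^] Suc i)) \<oplus> \<one>"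
    using assms by (subst finsum_addf) (auto simp: Pi_def a_assoc)
  also have "\<dots> = (\<Oplus>i\<in>{..k}. [(Suc k choose Suc i)] \<cdot>\<^bsub>R\<^esub> (y [^] Suc i)) \<oplus> \<one>"
  proof -
    have "(\<Oplus>i\<in>{..k}. [(k choose i)] \<cdot>\<^bsub>R\<^esub> (y [^] Suc i) \<oplus> [(k choose Suc i)] \<cdot>\<^bsub>R\<^esub> (y [^] Suc i))
        = (\<Oplus>i\<in>{..k}. [(Suc k choose Suc i)] \<cdot>\<^bsub>R\<^esub> (y [^] Suc i))"
    proof (rule finsum_cong')
      fix i assume "i \<in> {..k}"
      show "[(k choose i)] \<cdot>\<^bsub>R\<^esub> (y [^] Suc i) \<oplus> [(k choose Suc i)] \<cdot>\<^bsub>R\<^esub> (y [^] Suc i) = [(Suc k choose Suc i)] \<cdot>\<^bsub>R\<^esub> (y [^] Suc i)"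
        using y[of "Suc i"] by (simp only: binomial_Suc_Suc add.nat_pow_mult)
    qed (use assms in auto)
    then show ?thesis by simp
  qed
  also have "\<dots> = (\<Oplus>i\<in>{..Suc k}. [(Suc k choose i)] \<cdot>\<^bsub>R\<^esub> (y [^] i))"
    by (subst finsum_Suc2) (use assms in \<open>auto simp: Pi_def\<close>)
  finally show ?case .
qed

locale galois_field = prime_power p n M + field F
  for p n M :: nat and F (structure) +
  assumes order: "order F = p ^ n"
begin

lemma finite_carrier: "finite (carrier F)"
  using order prime_gt_0_nat[OF prime] order_gt_0_iff_finite by force

lemma card_carrier: "card (carrier F) = M + 1"
  using order power_n_eq by (simp add: order_def)

lemma add_pow_mult_one: "[(a * b)] \<cdot>\<^bsub>F\<^esub> \<one> = ([a] \<cdot>\<^bsub>F\<^esub> \<one>) \<otimes> ([(b::nat)] \<cdot>\<^bsub>F\<^esub> \<one>)"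
  by (simp add: add_pow_ldistr add.nat_pow_pow mult.commute)

lemma pow_eq_zeroD:
  assumes "x \<in> carrier F" "x [^] (k::nat) = \<zero>"
  shows "x = \<zero>"
  using assms(2) by (induction k) (use assms(1) integral in auto)

text \<open>The order \<open>p ^ n\<close> of the additive group annihilates \<open>\<one>\<close>,
  so the \<open>n\<close>-th power of \<open>[p] \<cdot> \<one>\<close> vanishes; a field has no
  nonzero nilpotent elements.\<close>

lemma add_pow_p_one: "[p] \<cdot>\<^bsub>F\<^esub> \<one> = \<zero>"
proof -
  have "group (add_monoid F)" by (rule a_group)
  then have "\<one> [^]\<^bsub>add_monoid F\<^esub> order (add_monoid F) = \<zero>"
    using group.pow_order_eq_1[of "add_monoid F" \<one>] by simp
  then have "[(p ^ n)] \<cdot>\<^bsub>F\<^esub> \<one> = \<zero>" using order by (simp add: order_def add_pow_def)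
  moreover have "[(p ^ k)] \<cdot>\<^bsub>F\<^esub> \<one> = ([p] \<cdot>\<^bsub>F\<^esub> \<one>) [^] k" for k :: nat
    by (induction k) (simp_all add: add_pow_mult_one m_comm)
  ultimately have "([p] \<cdot>\<^bsub>F\<^esub> \<one>) [^] n = \<zero>" by simp
  then show ?thesis using pow_eq_zeroD by simp
qed

lemma add_pow_one_eq_zero_iff: "[(k::nat)] \<cdot>\<^bsub>F\<^esub> \<one> = \<zero> \<longleftrightarrow> p dvd k"
proof
  assume "p dvd k"
  then obtain j where "k = p * j" by blast
  then show "[k] \<cdot>\<^bsub>F\<^esub> \<one> = \<zero>" by (simp only: add_pow_mult_one add_pow_p_one) simp
next
  assume k: "[k] \<cdot>\<^bsub>F\<^esub> \<one> = \<zero>"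
  show "p dvd k"
  proof (rule ccontr)
    assume "\<not> p dvd k"
    then have "coprime k p" using prime prime_imp_coprime coprime_commute by blast
    then obtain j where "[k * j = 1] (mod p)" using cong_solve_coprime_nat by auto
    then have "(k * j) mod p = 1" using prime_gt_1_nat[OF prime] by (simp add: cong_def)
    then have "k * j = p * (k * j div p) + 1" by (metis mult_div_mod_eq)
    then have "[(k * j)] \<cdot>\<^bsub>F\<^esub> \<one> = [(p * (k * j div p) + 1)] \<cdot>\<^bsub>F\<^esub> \<one>" by (rule arg_cong)
    then have "[(k * j)] \<cdot>\<^bsub>F\<^esub> \<one> = [(p * (k * j div p))] \<cdot>\<^bsub>F\<^esub> \<one> \<oplus> \<one>"
      by (simp del: Suc_eq_plus1 add: Suc_eq_plus1[symmetric])
    also have "\<dots> = \<one>" by (simp only: add_pow_mult_one add_pow_p_one) simp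
    finally have "[k] \<cdot>\<^bsub>F\<^esub> \<one> \<otimes> [j] \<cdot>\<^bsub>F\<^esub> \<one> = \<one>" by (simp only: add_pow_mult_one)
    then show False using k by simp
  qed
qed

lemma add_pow_eq_zero:
  assumes "p dvd k" "x \<in> carrier F"
  shows "[(k::nat)] \<cdot>\<^bsub>F\<^esub> x = \<zero>"
proof -
  have "[k] \<cdot>\<^bsub>F\<^esub> x = [k] \<cdot>\<^bsub>F\<^esub> \<one> \<otimes> x" using assms(2) by (simp add: add_pow_ldistr)
  then show ?thesis using assms(2) iffD2[OF add_pow_one_eq_zero_iff assms(1)] by (simp only: l_null)
qed

lemma frobenius_add_one:
  assumes "y \<in> carrier F"
  shows "(y \<oplus> \<one>) [^] p = y [^] p \<oplus> \<one>"
proof -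
  have "(y \<oplus> \<one>) [^] p = (\<Oplus>i\<in>{..p}. [(p choose i)] \<cdot>\<^bsub>F\<^esub> (y [^] i))"
    by (rule add_one_pow[OF assms])
  also have "\<dots> = (\<Oplus>i\<in>{0, p}. [(p choose i)] \<cdot>\<^bsub>F\<^esub> (y [^] i))"
  proof (rule add.finprod_mono_neutral_cong_right)
    fix i assume "i \<in> {..p} - {0, p}"
    then have "p dvd (p choose i)" using prime by (intro dvd_choose_prime) auto
    then show "[(p choose i)] \<cdot>\<^bsub>F\<^esub> (y [^] i) = \<zero>" using assms by (intro add_pow_eq_zero) auto
  qed (use assms in auto)
  also have "\<dots> = y [^] p \<oplus> \<one>"
    using assms prime_gt_0_nat[OF prime] by (simp add: a_comm)
  finally show ?thesis .
qed

lemma frobenius_add: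
  assumes "x \<in> carrier F" "y \<in> carrier F"
  shows "(x \<oplus> y) [^] (p ^ k) = x [^] (p ^ k) \<oplus> y [^] (p ^ k)"
proof (induction k)
  case 0
  then show ?case using assms by simp
next
  case (Suc k)
  have *: "(a \<oplus> b) [^] p = a [^] p \<oplus> b [^] p" if a: "a \<in> carrier F" and b: "b \<in> carrier F" for a b
  proof (cases "b = \<zero>")
    case True
    then show ?thesis using a prime_gt_0_nat[OF prime] by (simp add: nat_pow_zero)
  next
    case False
    then have b': "b \<in> Units F" using b field_Units by simp
    define c where "c = a \<otimes> inv b"
    have c: "c \<in> carrier F" "a = c \<otimes> b" using a b b' by (auto simp: c_def m_assoc)
    have "a \<oplus> b = (c \<oplus> \<one>) \<otimes> b" using b c by (simp add: l_distr)
    then have "(a \<oplus> b) [^] p = (c [^] p \<oplus> \<one>) \<otimes> b [^] p"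
      using b c frobenius_add_one[OF c(1)] by (simp add: nat_pow_distrib)
    also have "\<dots> = a [^] p \<oplus> b [^] p" using b c by (simp add: l_distr nat_pow_distrib)
    finally show ?thesis .
  qed
  have "(x \<oplus> y) [^] (p ^ Suc k) = ((x \<oplus> y) [^] (p ^ k)) [^] p"
    using assms by (simp add: nat_pow_pow mult.commute)
  also have "\<dots> = x [^] (p ^ Suc k) \<oplus> y [^] (p ^ Suc k)"
    using assms Suc * by (simp add: nat_pow_pow mult.commute)
  finally show ?case .
qed

lemma frobenius_inj:
  assumes "x \<in> carrier F" "y \<in> carrier F" "x [^] (p ^ k) = y [^] (p ^ k)"
  shows "x = y"
proof -
  have "x [^] (p ^ k) = (x \<ominus> y) [^] (p ^ k) \<oplus> y [^] (p ^ k)"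
    using assms frobenius_add[of "x \<ominus> y" y k] by (simp add: minus_eq a_assoc l_neg)
  then have "(x \<ominus> y) [^] (p ^ k) = \<zero>"
    using assms by (simp add: add.r_cancel_one)
  then have "x \<ominus> y = \<zero>" using assms pow_eq_zeroD by simp
  then show ?thesis using assms by simp
qed

text \<open>The polynomial \<open>(Y + 1)^v - Y^v - 1\<close> has degree below \<open>v\<close> and its coefficient at \<open>Y^(v-1)\<close> is
  \<open>v\<close>; it cannot vanish on the whole field.\<close>

lemma additive_at_one_imp_one:
  assumes v: "\<not> p dvd v" "v \<le> M"
    and add: "\<And>y. y \<in> carrier F \<Longrightarrow> (y \<oplus> \<one>) [^] v = y [^] v \<oplus> \<one>"
  shows "v = 1"
proof (rule ccontr)
  assume "v \<noteq> 1"
  moreover have "v \<noteq> 0" using v by (cases v) auto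
  ultimately have v2: "v \<ge> 2" by simp
  interpret UPF: UP_domain F "UP F" by unfold_locales
  \<comment> \<open>The coefficients of \<open>(Y + 1)^v\<close> except those at 0 and
    \<open>v\<close>, which are cancelled by the subtracted terms.\<close>
  define c where "c = (\<lambda>i. if i \<in> {1..<v} then [(v choose i)] \<cdot>\<^bsub>F\<^esub> \<one> else \<zero>)"
  have cc: "c i \<in> carrier F" for i by (simp add: c_def)
  have bnd: "bound \<zero> (v - 1) c" by (rule bound.intro) (auto simp: c_def)
  have up: "c \<in> up F" using cc bnd by (auto simp: up_def)
  have c: "c \<in> carrier (UP F)" using up unfolding UP_def by simp
  have coeff: "up_ring.coeff (UP F) c i = c i" for i using up unfolding UP_def by simp
  have deg: "deg F c \<le> v - 1" by (rule UPF.deg_aboveI[OF _ c]) (simp add: coeff, auto simp: c_def)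
  have "v choose (v - 1) = v" using v2 binomial_symmetric[of 1 v] by simp
  \<comment> \<open>\<open>v \<ge> 2\<close> puts \<open>v - 1\<close> into the range
    \<open>{1..<v}\<close>, and the coefficient \<open>v\<close> is nonzero in \<open>F\<close>
    because \<open>p\<close> does not divide it.\<close>
  then have "c (v - 1) \<noteq> \<zero>" using v v2 add_pow_one_eq_zero_iff by (auto simp: c_def)
  then have "c \<noteq> \<zero>\<^bsub>UP F\<^esub>" using coeff[of "v - 1"] by auto
  then have bound: "card {a \<in> carrier F. UnivPoly.eval F F id a c = \<zero>} \<le> deg F c"
    using UPF.roots_bound[OF c _ finite_carrier] by blast
  have "UnivPoly.eval F F id a c = \<zero>" if a: "a \<in> carrier F" for a
  proof -
    have "UnivPoly.eval F F id a c = (\<Oplus>i\<in>{..deg F c}. c i \<otimes> a [^] i)"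
      using c by (simp add: UnivPoly.eval_def coeff)
    also have "\<dots> = (\<Oplus>i\<in>{1..<v}. [(v choose i)] \<cdot>\<^bsub>F\<^esub> (a [^] i))" (is "_ = ?s")
    proof (rule add.finprod_mono_neutral_cong)
      fix i assume "i \<in> {1..<v} - {..deg F c}"
      then have "c i = \<zero>" using UPF.deg_aboveD[OF _ c, of i] coeff by auto
      then have "c i \<otimes> a [^] i = \<zero>" using a by simp
      then show "[(v choose i)] \<cdot>\<^bsub>F\<^esub> (a [^] i) = \<zero>"
        using a \<open>i \<in> {1..<v} - _\<close> by (simp add: c_def add_pow_ldistr)
    qed (use a in \<open>auto simp: c_def add_pow_ldistr\<close>)
    also have "\<dots> = \<zero>"
    proof -
      have "a [^] v \<oplus> \<one> = (\<Oplus>i\<in>{..v}. [(v choose i)] \<cdot>\<^bsub>F\<^esub> (a [^] i))"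
        using add[OF a] add_one_pow[OF a, of v] by simp
      also have "{..v} = insert v (insert 0 {1..<v})" using v2 by auto
      also have "(\<Oplus>i\<in>insert v (insert 0 {1..<v}). [(v choose i)] \<cdot>\<^bsub>F\<^esub> (a [^] i))
          = a [^] v \<oplus> (\<one> \<oplus> ?s)"
        using a v2 by (simp add: finsum_insert Pi_def)
      also have "\<dots> = ?s \<oplus> (a [^] v \<oplus> \<one>)" using a by (simp add: a_ac finsum_closed Pi_def)
      finally show ?thesis
        using a add.r_cancel_one'[of "a [^] v \<oplus> \<one>" ?s] by (simp add: finsum_closed Pi_def)
    qed
    finally show ?thesis .
  qed
  then have "{a \<in> carrier F. UnivPoly.eval F F id a c = \<zero>} = carrier F" by blast
  then have "M + 1 \<le> v - 1" using bound deg card_carrier by simp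
  then show False using v by simp
qed

text \<open>Write \<open>u = v * p ^ k\<close> with \<open>v\<close> prime to \<open>p\<close>.
  Injectivity of the \<open>p ^ k\<close>-th power map cancels that factor and leaves additivity at
  \<open>\<one>\<close> for the exponent \<open>v\<close>, and \<open>v \<le> u \<le> M\<close> is
  small enough for the root count to force \<open>v = 1\<close>.\<close>

lemma additive_power_map_iff:
  assumes u: "u > 0" "u \<le> M"
  shows "(\<forall>x\<in>carrier F. \<forall>y\<in>carrier F. (x \<oplus> y) [^] u = x [^] u \<oplus> y [^] u) \<longleftrightarrow> (\<exists>k. u = p ^ k)"
proof
  assume L: "\<forall>x\<in>carrier F. \<forall>y\<in>carrier F. (x \<oplus> y) [^] u = x [^] u \<oplus> y [^] u"
  obtain k v where kv: "u = v * p ^ k" "\<not> p dvd v"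
  proof -
    obtain w where "u = p ^ multiplicity p u * w" "\<not> p dvd w"
      using multiplicity_decompose'[of u p] u(1) prime_gt_1_nat[OF prime] by auto
    then show ?thesis using that[of w "multiplicity p u"] by (simp add: mult.commute)
  qed
  have "v = 1"
  proof (rule additive_at_one_imp_one)
    have "v * 1 \<le> u" unfolding kv using prime_gt_0_nat[OF prime] by (intro mult_le_mono2) simp
    then show "v \<le> M" using u by simp
    fix y assume y: "y \<in> carrier F"
    then have "(y \<oplus> \<one>) [^] u = y [^] u \<oplus> \<one>" using L by simp
    then have "((y \<oplus> \<one>) [^] v) [^] (p ^ k) = (y [^] v \<oplus> \<one>) [^] (p ^ k)"
      using y frobenius_add[of "y [^] v" \<one> k] by (simp add: kv nat_pow_pow)
    then show "(y \<oplus> \<one>) [^] v = y [^] v \<oplus> \<one>"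
      by (rule frobenius_inj[rotated 2]) (use y in simp_all)
  qed (rule kv)
  then show "\<exists>k. u = p ^ k" using kv by auto
qed (use frobenius_add in blast)

end

section \<open>Exponents modulo \<open>M\<close> and automorphisms of the multiplicative
  group\<close>

context galois_field
begin

abbreviation mult_F where
  "mult_F \<equiv> Multiplicative_Group.mult_of F"

lemma group_mult_of: "group mult_F"
  by (rule field_mult_group)

lemma order_mult_of_eq: "order mult_F = M"
  using order_mult_of[OF finite_carrier] card_carrier by (simp add: order_def)

lemma pow_M_eq_one:
  assumes "x \<in> carrier F" "x \<noteq> \<zero>"
  shows "x [^] M = \<one>"
  using group.pow_order_eq_1[OF group_mult_of, of x] assms
  by (simp add: order_mult_of_eq Multiplicative_Group.nat_pow_mult_of)

lemma pow_add_mult_M: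
  assumes "x \<in> carrier F" "x \<noteq> \<zero>"
  shows "x [^] (a + M * k) = x [^] a"
proof -
  have "x [^] (a + M * k) = x [^] a \<otimes> (x [^] M) [^] k"
    using assms(1) by (simp add: nat_pow_mult nat_pow_pow)
  then show ?thesis using assms by (simp add: pow_M_eq_one)
qed

text \<open>Positivity of both exponents covers \<open>x = \<zero>\<close>, where the exponent 0
  would give \<open>\<one>\<close> although it is congruent to \<open>M\<close>.\<close>

lemma pow_cong:
  assumes "x \<in> carrier F" "[a = b] (mod M)" "a > 0" "b > 0"
  shows "x [^] a = x [^] b"
proof (cases "x = \<zero>")
  case True
  then show ?thesis using assms by (simp add: nat_pow_zero)
next
  case False
  have "x [^] c = x [^] (c mod M)" for c
    using pow_add_mult_M[OF assms(1) False, of "c mod M" "c div M"] by (simp add: mod_mult_div_eq)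
  then show ?thesis using assms(2) by (metis cong_def)
qed

lemma pow_eq_zero_iff:
  assumes "x \<in> carrier F" "k > 0"
  shows "x [^] (k::nat) = \<zero> \<longleftrightarrow> x = \<zero>"
  using assms pow_eq_zeroD nat_pow_zero by auto

lemma exists_generator:
  obtains g where "g \<in> carrier F" "g \<noteq> \<zero>"
    "\<And>x. x \<in> carrier F \<Longrightarrow> x \<noteq> \<zero> \<Longrightarrow> \<exists>i::nat. x = g [^] i"
    "\<And>a b :: nat. g [^] a = g [^] b \<longleftrightarrow> [a = b] (mod M)"
proof -
  interpret m: group mult_F by (rule group_mult_of)
  obtain g where g: "g \<in> carrier mult_F" "carrier mult_F = {g [^] i | i::nat. i \<in> UNIV}"
    using finite_field_mult_group_has_gen[OF finite_carrier] by blast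
  have fin: "finite (carrier mult_F)" by (rule finite_mult_of[OF finite_carrier])
  have "(g [^] a = g [^] b) = [a = b] (mod M)" if "a \<le> b" for a b :: nat
  proof -
    \<comment> \<open>The powers of \<open>g\<close> exhaust the \<open>M\<close> nonzero elements,
      so its order is at least \<open>M\<close>; the group order bounds it from above.\<close>
    have ord: "m.ord g = M"
    proof -
      have eq: "carrier mult_F = {g [^]\<^bsub>mult_F\<^esub> x | x. x \<in> {0..m.ord g - 1}}"
        using m.ord_elems[OF fin g(1)] g(2) by (simp add: Multiplicative_Group.nat_pow_mult_of)
      have "M = card ((\<lambda>x. g [^]\<^bsub>mult_F\<^esub> x) ` {0..m.ord g - 1})"
        using arg_cong[OF eq, of card] order_mult_of_eq
        unfolding order_def Setcompr_eq_image by simp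
      also have "\<dots> \<le> m.ord g"
        using card_image_le[of "{0..m.ord g - 1}"] m.ord_ge_1[OF fin g(1)] by force
      finally show ?thesis
        using m.ord_le_group_order[OF fin g(1)] order_mult_of_eq by simp
    qed
    have nz: "g [^] a \<noteq> \<zero>" using g(1) pow_eq_zeroD[of g a] by auto
    have "g [^] b = g [^] (b - a) \<otimes> g [^] a" using that g(1) by (simp add: nat_pow_mult)
    then have "g [^] a = g [^] b \<longleftrightarrow> g [^] (b - a) = \<one>"
      using g(1) nz m_rcancel[of "g [^] a" "g [^] (b - a)" \<one>] by auto
    also have "\<dots> \<longleftrightarrow> M dvd (b - a)"
      using m.pow_eq_id[OF g(1), of "b - a"] ord by (simp add: Multiplicative_Group.nat_pow_mult_of)
    also have "\<dots> \<longleftrightarrow> [a = b] (mod M)"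
      using that by (simp add: cong_altdef_nat cong_sym_eq[of a b])
    finally show ?thesis .
  qed
  then have "(g [^] a = g [^] b) = [a = b] (mod M)" for a b :: nat
    by (metis cong_sym_eq nat_le_linear)
  then show thesis using that[of g] g by auto
qed

lemma exists_inverse_exponent:
  assumes "coprime r M"
  obtains s where "s \<in> totatives M" "[r * s = 1] (mod M)"
proof -
  obtain s where s: "[r * s = 1] (mod M)" using assms cong_solve_coprime_nat by auto
  then have "coprime s M"
    by (metis One_nat_def cong_imp_coprime cong_sym coprime_1_left coprime_mult_left_iff)
  then have "residue M s \<in> totatives M" by (rule residue_in_totatives[OF M_pos])
  moreover have "[r * residue M s = 1] (mod M)"
    using s cong_mult[OF cong_refl cong_residue] cong_trans by blast
  ultimately show thesis using that by blast
qed

lemma pow_inverse_exponent: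
  assumes "x \<in> carrier F" "[r * s = 1] (mod M)" "r > 0" "s > 0"
  shows "(x [^] r) [^] s = x" "(x [^] s) [^] r = x"
proof -
  have "x [^] (r * s) = x [^] (1::nat)" by (rule pow_cong) (use assms in auto)
  then have "x [^] (r * s) = x" using assms by simp
  then show "(x [^] r) [^] s = x" "(x [^] s) [^] r = x"
    using assms(1) by (simp_all add: nat_pow_pow mult.commute)
qed

lemma totatives_pos: "r \<in> totatives M \<Longrightarrow> r > 0"
  by (auto simp: totatives_def)

lemma totatives_coprime: "r \<in> totatives M \<Longrightarrow> coprime r M"
  by (auto simp: totatives_def)

lemma power_map_bij:
  assumes "r \<in> totatives M"
  shows "bij_betw (\<lambda>x. x [^] r) (carrier F) (carrier F)"
proof -
  obtain s where s: "s \<in> totatives M" "[r * s = 1] (mod M)"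
    using exists_inverse_exponent[OF totatives_coprime[OF assms]] by blast
  show ?thesis
    by (rule bij_betwI[where g = "\<lambda>x. x [^] s"])
       (use s assms totatives_pos pow_inverse_exponent in auto)
qed

lemma power_map_iso_mult_of:
  assumes "r \<in> totatives M"
  shows "(\<lambda>x. x [^] r) \<in> iso mult_F mult_F"
proof (rule isoI)
  show "(\<lambda>x. x [^] r) \<in> hom mult_F mult_F"
    using assms totatives_pos by (auto simp: hom_def nat_pow_distrib pow_eq_zero_iff integral_iff)
  show "bij_betw (\<lambda>x. x [^] r) (carrier mult_F) (carrier mult_F)"
    using bij_betw_DiffI[OF power_map_bij[OF assms], of "{\<zero>}" "{\<zero>}"] totatives_pos[OF assms]
    by (simp add: nat_pow_zero)
qed

text \<open>The group is cyclic, so the map is determined by the image \<open>g [^] s\<close> of a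
  generator. That \<open>g\<close> itself lies in the image gives \<open>s * j\<close> congruent to
  1 for some \<open>j\<close>, hence \<open>s\<close> is a unit modulo \<open>M\<close>.\<close>

lemma iso_mult_of_is_power_map:
  assumes "\<phi> \<in> iso mult_F mult_F"
  obtains r where "r \<in> totatives M" "\<And>x. x \<in> carrier F \<Longrightarrow> x \<noteq> \<zero> \<Longrightarrow> \<phi> x = x [^] r"
proof -
  obtain g where g: "g \<in> carrier F" "g \<noteq> \<zero>"
    "\<And>x. x \<in> carrier F \<Longrightarrow> x \<noteq> \<zero> \<Longrightarrow> \<exists>i::nat. x = g [^] i"
    "\<And>a b :: nat. g [^] a = g [^] b \<longleftrightarrow> [a = b] (mod M)"
    using exists_generator by blast
  have hom: "\<phi> \<in> hom mult_F mult_F" and bij: "bij_betw \<phi> (carrier mult_F) (carrier mult_F)"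
    using assms by (auto simp: iso_def)
  interpret h: group_hom mult_F mult_F \<phi>
    using hom group_mult_of by (simp add: group_hom_def group_hom_axioms_def)
  have "\<phi> g \<in> carrier F" "\<phi> g \<noteq> \<zero>" using h.hom_closed[of g] g by auto
  then obtain s where s: "\<phi> g = g [^] (s::nat)" using g(3) by blast
  have \<phi>: "\<phi> (g [^] i) = g [^] (s * i)" for i :: nat
    using h.hom_nat_pow[of g i] g s by (simp add: Multiplicative_Group.nat_pow_mult_of nat_pow_pow)
  have "g \<in> \<phi> ` carrier mult_F" using bij g by (simp add: bij_betw_def)
  then obtain x where x: "x \<in> carrier F" "x \<noteq> \<zero>" "g = \<phi> x" by auto
  obtain j where "x = g [^] (j::nat)" using g(3)[OF x(1,2)] by blast
  then have "g = g [^] (s * j)" using \<phi>[of j] x(3) by (simp only:)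
  then have "g [^] (1::nat) = g [^] (s * j)" using g(1) by simp
  then have "[1 = s * j] (mod M)" using g(4) by blast
  then have "coprime s M"
    by (metis One_nat_def cong_imp_coprime coprime_1_left coprime_mult_left_iff)
  then have r: "residue M s \<in> totatives M" by (rule residue_in_totatives[OF M_pos])
  moreover have "\<phi> x = x [^] residue M s" if x: "x \<in> carrier F" "x \<noteq> \<zero>" for x
  proof -
    obtain i where i: "x = g [^] (i::nat)" using g(3) x by blast
    have "[s * i = i * residue M s] (mod M)"
      by (metis cong_mult cong_refl cong_residue cong_sym mult.commute)
    then show ?thesis using i \<phi>[of i] g by (simp add: nat_pow_pow)
  qed
  ultimately show thesis using that by blast
qed

lemma iso_is_power_map:
  assumes "\<psi> \<in> iso F F"
  obtains r where "r \<in> totatives M" "\<And>x. x \<in> carrier F \<Longrightarrow> \<psi> x = x [^] r"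
proof -
  have hom: "\<And>x y. x \<in> carrier F \<Longrightarrow> y \<in> carrier F \<Longrightarrow> \<psi> (x \<otimes> y) = \<psi> x \<otimes> \<psi> y"
    and bij: "bij_betw \<psi> (carrier F) (carrier F)"
    using assms by (auto simp: iso_def hom_def)
  have cl: "\<psi> x \<in> carrier F" if "x \<in> carrier F" for x using bij that bij_betwE by blast
  \<comment> \<open>Zero is fixed because it absorbs: with \<open>\<psi> z = \<zero>\<close>, the
    value at \<open>\<zero> = \<zero> \<otimes> z\<close> is a multiple of
    \<open>\<zero>\<close>.\<close>
  obtain z where z: "z \<in> carrier F" "\<psi> z = \<zero>" using bij zero_closed unfolding bij_betw_def by (metis imageE)
  then have zero: "\<psi> \<zero> = \<zero>" using hom[of \<zero> z] cl[of \<zero>] by simp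
  have "bij_betw \<psi> (carrier F - {\<zero>}) (carrier F - {\<zero>})"
    using bij_betw_DiffI[OF bij, of "{\<zero>}" "{\<zero>}"] zero by simp
  then have "\<psi> \<in> iso mult_F mult_F"
    using hom by (intro isoI) (auto simp: hom_def dest: bij_betwE)
  then obtain r where r: "r \<in> totatives M" "\<And>x. x \<in> carrier F \<Longrightarrow> x \<noteq> \<zero> \<Longrightarrow> \<psi> x = x [^] r"
    using iso_mult_of_is_power_map by blast
  have "\<psi> x = x [^] r" if "x \<in> carrier F" for x
    using that r zero totatives_pos[OF r(1)] by (cases "x = \<zero>") (auto simp: nat_pow_zero)
  then show thesis using that r(1) by blast
qed

lemma power_map_iso:
  assumes "r \<in> totatives M"
  shows "(\<lambda>x. x [^] r) \<in> iso F F"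
  using power_map_bij[OF assms] by (intro isoI) (auto simp: hom_def nat_pow_distrib)

text \<open>Substituting \<open>w\<close>-th powers, with \<open>w\<close> inverse to
  \<open>q\<close> modulo \<open>M\<close>, turns the implication into additivity of the power map
  with exponent \<open>w * q'\<close>, which must then be a power of \<open>p\<close>. The condition
  is phrased by triples of scalars so that it can be tested on vectors of a near-vector
  space.\<close>

lemma power_sums_preserved_iff:
  assumes q: "q \<in> totatives M" and q': "q' \<in> totatives M"
  shows "(\<forall>a\<in>carrier F. \<forall>b\<in>carrier F. \<forall>c\<in>carrier F.
            a [^] q \<oplus> b [^] q = c [^] q \<longrightarrow> a [^] q' \<oplus> b [^] q' = c [^] q')
     \<longleftrightarrow> coset_rep p n q = coset_rep p n q'"
proof
  assume "coset_rep p n q = coset_rep p n q'"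
  then obtain k where "[q' = q * p ^ k] (mod M)"
    using coset_rep_eq_iff q q' totatives_coprime by blast
  then have *: "x [^] q' = (x [^] q) [^] (p ^ k)" if "x \<in> carrier F" for x
    using pow_cong[of x q' "q * p ^ k"] that q q' totatives_pos prime_gt_0_nat[OF prime]
    by (simp add: nat_pow_pow)
  show "\<forall>a\<in>carrier F. \<forall>b\<in>carrier F. \<forall>c\<in>carrier F.
            a [^] q \<oplus> b [^] q = c [^] q \<longrightarrow> a [^] q' \<oplus> b [^] q' = c [^] q'"
    using frobenius_add by (simp add: *) (metis nat_pow_closed)
next
  assume L: "\<forall>a\<in>carrier F. \<forall>b\<in>carrier F. \<forall>c\<in>carrier F.
            a [^] q \<oplus> b [^] q = c [^] q \<longrightarrow> a [^] q' \<oplus> b [^] q' = c [^] q'"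
  obtain w where w: "w \<in> totatives M" "[q * w = 1] (mod M)"
    using exists_inverse_exponent[OF totatives_coprime[OF q]] by blast
  define u where "u = residue M (w * q')"
  have u: "u \<in> totatives M"
    unfolding u_def using w q' totatives_coprime by (intro residue_in_totatives[OF M_pos]) auto
  have upow: "x [^] u = (x [^] w) [^] q'" if "x \<in> carrier F" for x
    using pow_cong[OF that, of u "w * q'"] cong_residue totatives_pos u w q' that
    by (auto simp: nat_pow_pow u_def)
  have inv: "(x [^] w) [^] q = x" if "x \<in> carrier F" for x
    using pow_inverse_exponent(2)[OF that w(2)] q w totatives_pos by simp
  have "(x \<oplus> y) [^] u = x [^] u \<oplus> y [^] u" if "x \<in> carrier F" "y \<in> carrier F" for x y
    using L[rule_format, of "x [^] w" "y [^] w" "(x \<oplus> y) [^] w"] that by (simp add: upow inv)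
  moreover have "u > 0" "u \<le> M" using u by (auto simp: totatives_def)
  ultimately obtain k where "u = p ^ k" using additive_power_map_iff[of u] by auto
  then have "[w * q' = p ^ k] (mod M)" using cong_residue[of M "w * q'"] by (simp add: u_def cong_sym)
  then have "[q * (w * q') = q * p ^ k] (mod M)" by (rule cong_mult[OF cong_refl])
  moreover have "[q * w * q' = 1 * q'] (mod M)" by (rule cong_mult[OF w(2) cong_refl])
  ultimately have "[q' = q * p ^ k] (mod M)"
    by (metis cong_sym cong_trans mult.assoc mult_1)
  then show "coset_rep p n q = coset_rep p n q'"
    using coset_rep_eq_iff q q' totatives_coprime by blast
qed

end

section \<open>The near-vector spaces determined by sequences\<close>

context galois_field
begin

abbreviation V :: "nat \<Rightarrow> (nat \<Rightarrow> 'a) monoid" where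
  "V m \<equiv> power_space F m"

text \<open>For positive exponents the power of \<open>\<zero>\<close> is \<open>\<zero>\<close>, so
  this agrees with the maps in \<open>seq_scalars\<close> without a case distinction at zero.
  Keeping \<open>a\<close> as an argument fixes a parametrization of the scalars.\<close>

definition scal :: "nat list \<Rightarrow> 'a \<Rightarrow> (nat \<Rightarrow> 'a) \<Rightarrow> nat \<Rightarrow> 'a" where
  "scal qs a = (\<lambda>x\<in>carrier (V (length qs)). \<lambda>i\<in>{..<length qs}. x i \<otimes> a [^] (qs ! i))"

text \<open>Nonemptiness provides a nonzero vector, on which different scalars can be told apart.
  Neither order nor minimality of the entries is imposed, since an arbitrary space comes with
  arbitrary exponents.\<close>

definition unit_seq :: "nat list \<Rightarrow> bool" where
  "unit_seq qs \<longleftrightarrow> qs \<noteq> [] \<and> set qs \<subseteq> totatives M"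

lemma unit_seq_nth:
  assumes "unit_seq qs" "i < length qs"
  shows "qs ! i \<in> totatives M" "qs ! i > 0"
proof -
  show "qs ! i \<in> totatives M" using assms nth_mem by (auto simp: unit_seq_def)
  then show "qs ! i > 0" by (rule totatives_pos)
qed

lemma carrier_V: "carrier (V m) = {..<m} \<rightarrow>\<^sub>E carrier F"
  by (simp add: power_space_def)

lemma mult_V: "x \<otimes>\<^bsub>V m\<^esub> y = (\<lambda>i\<in>{..<m}. x i \<oplus> y i)"
  by (simp add: power_space_def)

lemma one_V: "\<one>\<^bsub>V m\<^esub> = (\<lambda>i\<in>{..<m}. \<zero>)"
  by (simp add: power_space_def)

lemma group_V: "group (V m)"
  unfolding power_space_def by (rule product_group) (rule a_group)

lemma inv_V: "x \<in> carrier (V m) \<Longrightarrow> inv\<^bsub>V m\<^esub> x = (\<lambda>i\<in>{..<m}. \<ominus> x i)"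
  unfolding power_space_def a_inv_def by (rule inv_product_group) (simp_all add: a_group)

lemma V_closed: "x \<in> carrier (V m) \<Longrightarrow> i < m \<Longrightarrow> x i \<in> carrier F"
  by (auto simp: carrier_V)

lemma V_eqI:
  assumes "x \<in> carrier (V m)" "y \<in> carrier (V m)" "\<And>i. i < m \<Longrightarrow> x i = y i"
  shows "x = y"
  using assms unfolding carrier_V by (intro PiE_ext[of x "{..<m}" "\<lambda>_. carrier F" y]) auto

lemma scal_apply:
  "x \<in> carrier (V (length qs)) \<Longrightarrow> i < length qs \<Longrightarrow> scal qs a x i = x i \<otimes> a [^] (qs ! i)"
  by (simp add: scal_def)

lemma scal_closed:
  "x \<in> carrier (V (length qs)) \<Longrightarrow> a \<in> carrier F \<Longrightarrow> scal qs a x \<in> carrier (V (length qs))"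
  by (auto simp: scal_def carrier_V)

lemma scal_extensional: "scal qs a \<in> extensional (carrier (V (length qs)))"
  by (simp add: scal_def)

lemma scal_hom:
  assumes "a \<in> carrier F"
  shows "scal qs a \<in> hom (V (length qs)) (V (length qs))"
proof (rule homI)
  fix x y assume x: "x \<in> carrier (V (length qs))" and y: "y \<in> carrier (V (length qs))"
  interpret V: group "V (length qs)" by (rule group_V)
  show "scal qs a (x \<otimes>\<^bsub>V (length qs)\<^esub> y) = scal qs a x \<otimes>\<^bsub>V (length qs)\<^esub> scal qs a y"
  proof (rule V_eqI[of _ "length qs"])
    fix i assume i: "i < length qs"
    then show "scal qs a (x \<otimes>\<^bsub>V (length qs)\<^esub> y) i = (scal qs a x \<otimes>\<^bsub>V (length qs)\<^esub> scal qs a y) i"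
      using x y assms V.m_closed[OF x y] V_closed[OF x i] V_closed[OF y i]
      by (simp add: scal_apply) (simp add: mult_V scal_apply l_distr)
  qed (use assms x y in \<open>simp_all add: scal_closed\<close>)
qed (use assms in \<open>simp add: scal_closed\<close>)

lemma scal_scal:
  assumes "a \<in> carrier F" "b \<in> carrier F" "x \<in> carrier (V (length qs))"
  shows "scal qs a (scal qs b x) = scal qs (a \<otimes> b) x"
proof (rule V_eqI[of _ "length qs"])
  fix i assume "i < length qs"
  then show "scal qs a (scal qs b x) i = scal qs (a \<otimes> b) x i"
    using assms V_closed[OF assms(3)]
    by (simp add: scal_apply scal_closed nat_pow_distrib m_assoc m_comm[of "a [^] (qs ! i)"])
qed (use assms in \<open>auto intro!: scal_closed\<close>)

lemma scal_one: "x \<in> carrier (V (length qs)) \<Longrightarrow> scal qs \<one> x = x"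
  by (rule V_eqI[of _ "length qs"]) (simp_all add: scal_apply scal_closed V_closed)

lemma scal_zero:
  assumes "unit_seq qs"
  shows "scal qs \<zero> = zero_end (V (length qs))"
proof (rule extensionalityI[of _ "carrier (V (length qs))"])
  fix x assume x: "x \<in> carrier (V (length qs))"
  have "scal qs \<zero> x = \<one>\<^bsub>V (length qs)\<^esub>"
  proof (rule V_eqI[of _ "length qs"])
    fix i assume "i < length qs"
    then show "scal qs \<zero> x i = \<one>\<^bsub>V (length qs)\<^esub> i"
      using x unit_seq_nth(2)[OF assms] V_closed[OF x] by (simp add: scal_apply one_V nat_pow_zero)
  qed (use x in \<open>auto intro!: scal_closed group.is_monoid[OF group_V] monoid.one_closed\<close>)
  then show "scal qs \<zero> x = zero_end (V (length qs)) x" using x by (simp add: zero_end_def)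
qed (auto simp: scal_extensional zero_end_def)

text \<open>One nonzero coordinate decides, because the power map on it is injective.\<close>

lemma scal_cancel:
  assumes "unit_seq qs" "x \<in> carrier (V (length qs))" "x \<noteq> \<one>\<^bsub>V (length qs)\<^esub>"
    "a \<in> carrier F" "b \<in> carrier F" "scal qs a x = scal qs b x"
  shows "a = b"
proof -
  have "\<one>\<^bsub>V (length qs)\<^esub> \<in> carrier (V (length qs))" by (simp add: carrier_V one_V)
  then obtain i where i: "i < length qs" "x i \<noteq> \<zero>"
    using assms(2,3) V_eqI[of x "length qs" "\<one>\<^bsub>V (length qs)\<^esub>"] by (auto simp: one_V)
  then have "x i \<otimes> a [^] (qs ! i) = x i \<otimes> b [^] (qs ! i)"
    using arg_cong[OF assms(6), of "\<lambda>f. f i"] assms(2) by (simp add: scal_apply)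
  then have "a [^] (qs ! i) = b [^] (qs ! i)"
    using i assms V_closed[OF assms(2) i(1)] m_lcancel by auto
  then show ?thesis
    using power_map_bij[OF unit_seq_nth(1)[OF assms(1) i(1)]] assms(4,5)
    by (auto simp: bij_betw_def dest: inj_onD)
qed

lemma exists_nonzero_V:
  assumes "m > 0"
  obtains x where "x \<in> carrier (V m)" "x \<noteq> \<one>\<^bsub>V m\<^esub>"
proof
  show "(\<lambda>i\<in>{..<m}. \<one>) \<in> carrier (V m)" by (simp add: carrier_V)
  have "(\<lambda>i\<in>{..<m}. \<one>) 0 \<noteq> \<one>\<^bsub>V m\<^esub> 0" using assms by (simp add: one_V)
  then show "(\<lambda>i\<in>{..<m}. \<one>) \<noteq> \<one>\<^bsub>V m\<^esub>" by metis
qed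

lemma inj_on_scal:
  assumes "unit_seq qs"
  shows "inj_on (scal qs) (carrier F)"
proof (rule inj_onI)
  fix a b assume "a \<in> carrier F" "b \<in> carrier F" "scal qs a = scal qs b"
  moreover obtain x where "x \<in> carrier (V (length qs))" "x \<noteq> \<one>\<^bsub>V (length qs)\<^esub>"
    using exists_nonzero_V assms by (metis length_greater_0_conv unit_seq_def)
  ultimately show "a = b" using scal_cancel[OF assms] by metis
qed

lemma scal_hom_AutoGroup: "scal qs \<in> hom mult_F (AutoGroup (V (length qs)))"
proof -
  let ?V = "V (length qs)"
  have Bij: "scal qs a \<in> Bij (carrier ?V)" if a: "a \<in> carrier F" "a \<noteq> \<zero>" for a
  proof -
    have u: "a \<in> Units F" using a field_Units by simp
    have "bij_betw (scal qs a) (carrier ?V) (carrier ?V)"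
      by (rule bij_betwI[where g = "scal qs (inv a)"])
         (use a u in \<open>auto simp: scal_closed scal_scal scal_one\<close>)
    then show ?thesis by (simp add: Bij_def scal_extensional)
  qed
  show ?thesis
  proof (rule homI)
    fix a assume "a \<in> carrier mult_F"
    then show "scal qs a \<in> carrier (AutoGroup ?V)"
      using Bij scal_hom by (simp add: AutoGroup_def auto_def)
  next
    fix a b assume ab: "a \<in> carrier mult_F" "b \<in> carrier mult_F"
    have "scal qs (a \<otimes> b) = compose (carrier ?V) (scal qs a) (scal qs b)"
      by (rule extensionalityI[of _ "carrier ?V"])
         (use ab in \<open>auto simp: scal_extensional compose_eq scal_scal\<close>)
    then show "scal qs (a \<otimes>\<^bsub>mult_F\<^esub> b) = scal qs a \<otimes>\<^bsub>AutoGroup ?V\<^esub> scal qs b"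
      using ab Bij by (simp add: AutoGroup_def BijGroup_def)
  qed
qed

lemma seq_scalars_eq:
  assumes "unit_seq qs"
  shows "seq_scalars F qs = scal qs ` carrier F"
  unfolding seq_scalars_def scalars_def
proof (rule image_cong)
  fix a assume a: "a \<in> carrier F"
  show "(\<lambda>x\<in>carrier (V (length qs)). \<lambda>i\<in>{..<length qs}.
           x i \<otimes> (if a = \<zero> then \<zero> else a [^] (qs ! i))) = scal qs a"
    unfolding scal_def using unit_seq_nth(2)[OF assms]
    by (intro restrict_ext) (auto simp: nat_pow_zero)
qed simp

lemma seq_scalars_minus_zero:
  assumes "unit_seq qs"
  shows "seq_scalars F qs - {zero_end (V (length qs))} = scal qs ` (carrier F - {\<zero>})"
  using inj_on_scal[OF assms] unfolding seq_scalars_eq[OF assms] scal_zero[OF assms, symmetric]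
  by (auto simp: inj_on_def)

lemma scal_iso_scalar_group:
  assumes "unit_seq qs"
  shows "scal qs \<in> iso mult_F (scalar_group (V (length qs)) (seq_scalars F qs))"
proof (rule isoI)
  show "scal qs \<in> hom mult_F (scalar_group (V (length qs)) (seq_scalars F qs))"
    using scal_hom_AutoGroup[of qs] seq_scalars_minus_zero[OF assms]
    by (auto simp: hom_def scalar_group_def)
  show "bij_betw (scal qs) (carrier mult_F) (carrier (scalar_group (V (length qs)) (seq_scalars F qs)))"
    using inj_on_subset[OF inj_on_scal[OF assms]] seq_scalars_minus_zero[OF assms]
    by (simp add: scalar_group_def bij_betw_def)
qed

text \<open>No parity argument is made: the value is a square root of \<open>\<one>\<close>, and if
  it is \<open>\<one>\<close>, injectivity of the power map gives
  \<open>\<ominus> \<one> = \<one>\<close>. This puts the negative of the identity among the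
  scalars.\<close>

lemma minus_one_pow:
  assumes "q \<in> totatives M"
  shows "(\<ominus> \<one>) [^] q = \<ominus> \<one>"
proof -
  let ?z = "(\<ominus> \<one>) [^] q"
  have z: "?z \<in> carrier F" by simp
  have "?z \<otimes> ?z = (\<ominus> \<one> \<otimes> \<ominus> \<one>) [^] q" by (simp add: nat_pow_distrib)
  then have "?z \<otimes> ?z = \<one>" by (simp add: l_minus r_minus)
  then have "?z = \<one> \<or> ?z = \<ominus> \<one>" using square_eq_one[OF z] by simp
  then show ?thesis
  proof
    assume "?z = \<one>"
    then have "?z = \<one> [^] q" by simp
    then have "\<ominus> \<one> = \<one>"
      by (rule inj_onD[OF bij_betw_imp_inj_on[OF power_map_bij[OF assms]]]) simp_all
    then show ?thesis using \<open>?z = \<one>\<close> by simp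
  qed
qed

definition single :: "nat \<Rightarrow> nat \<Rightarrow> 'a \<Rightarrow> nat \<Rightarrow> 'a" where
  "single m k c = (\<lambda>i\<in>{..<m}. if i = k then c else \<zero>)"

lemma single_closed: "c \<in> carrier F \<Longrightarrow> single m k c \<in> carrier (V m)"
  by (auto simp: single_def carrier_V)

text \<open>On a coordinate axis the requirement is a single equation for
  \<open>d [^] (qs ! k)\<close>, solvable because the power map is onto. The axes then generate the
  whole group.\<close>

lemma single_in_quasi_kernel:
  assumes qs: "unit_seq qs" and k: "k < length qs" and c: "c \<in> carrier F"
  shows "single (length qs) k c \<in> quasi_kernel (V (length qs)) (seq_scalars F qs)"
  unfolding quasi_kernel_def seq_scalars_eq[OF qs]
proof (intro CollectI conjI ballI)
  let ?V = "V (length qs)" and ?x = "single (length qs) k c"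
  interpret V: group ?V by (rule group_V)
  show x: "?x \<in> carrier ?V" by (rule single_closed[OF c])
  fix \<alpha> \<beta> assume "\<alpha> \<in> scal qs ` carrier F" "\<beta> \<in> scal qs ` carrier F"
  then obtain a b where ab: "a \<in> carrier F" "b \<in> carrier F" "\<alpha> = scal qs a" "\<beta> = scal qs b" by blast
  obtain d where d: "d \<in> carrier F" "d [^] (qs ! k) = a [^] (qs ! k) \<oplus> b [^] (qs ! k)"
    using power_map_bij[OF unit_seq_nth(1)[OF qs k]] ab
    by (metis (no_types, lifting) a_closed bij_betw_def imageE nat_pow_closed)
  have "\<alpha> ?x \<otimes>\<^bsub>?V\<^esub> \<beta> ?x = scal qs d ?x"
  proof (rule V_eqI[of _ "length qs"])
    fix i assume "i < length qs"
    then show "(\<alpha> ?x \<otimes>\<^bsub>?V\<^esub> \<beta> ?x) i = scal qs d ?x i"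
      using x ab d c by (auto simp: mult_V scal_apply) (auto simp: single_def r_distr)
  qed (use x ab d in \<open>simp_all add: scal_closed\<close>)
  then show "\<exists>\<gamma>\<in>scal qs ` carrier F. \<alpha> ?x \<otimes>\<^bsub>?V\<^esub> \<beta> ?x = \<gamma> ?x" using d by blast
qed

lemma generate_singles:
  assumes S: "\<And>k c. k < m \<Longrightarrow> c \<in> carrier F \<Longrightarrow> single m k c \<in> S" and "S \<subseteq> carrier (V m)"
  shows "generate (V m) S = carrier (V m)"
proof
  show "generate (V m) S \<subseteq> carrier (V m)" using group.generate_incl[OF group_V] assms by blast
  \<comment> \<open>Induction on an index \<open>k\<close> from which on all coordinates vanish; the
    step splits off coordinate \<open>k\<close>.\<close>
  have "x \<in> generate (V m) S" if "x \<in> carrier (V m)" "\<forall>i<m. k \<le> i \<longrightarrow> x i = \<zero>" "k \<le> m" for k x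
    using that
  proof (induction k arbitrary: x)
    case 0
    then have "x = \<one>\<^bsub>V m\<^esub>"
      by (intro V_eqI[of _ m]) (auto simp: one_V carrier_V)
    then show ?case by (simp add: generate.one)
  next
    case (Suc k)
    define y where "y = (\<lambda>i\<in>{..<m}. if i = k then \<zero> else x i)"
    have y: "y \<in> carrier (V m)" using V_closed[OF Suc.prems(1)] unfolding carrier_V y_def PiE_iff by simp
    have "\<forall>i<m. k \<le> i \<longrightarrow> y i = \<zero>" using Suc.prems(2) by (auto simp: y_def)
    then have yg: "y \<in> generate (V m) S" using Suc.IH[OF y] Suc.prems(3) by simp
    have k: "k < m" using Suc.prems(3) by simp
    have xk: "x k \<in> carrier F" using V_closed[OF Suc.prems(1) k] .
    have "x = y \<otimes>\<^bsub>V m\<^esub> single m k (x k)"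
    proof (rule V_eqI[of _ m])
      show "y \<otimes>\<^bsub>V m\<^esub> single m k (x k) \<in> carrier (V m)"
        using y single_closed[OF xk] by (intro monoid.m_closed group.is_monoid[OF group_V])
      fix i assume i: "i < m"
      then show "x i = (y \<otimes>\<^bsub>V m\<^esub> single m k (x k)) i"
        using V_closed[OF Suc.prems(1) i] xk by (simp add: mult_V y_def single_def)
    qed (rule Suc.prems(1))
    then show ?case using generate.eng[OF yg generate.incl[OF S[OF k xk]]] by simp
  qed
  from this[of _ m] show "carrier (V m) \<subseteq> generate (V m) S" by auto
qed

lemma near_vector_space_seq_scalars:
  assumes qs: "unit_seq qs"
  shows "near_vector_space (V (length qs)) (seq_scalars F qs)"
proof -
  let ?V = "V (length qs)" and ?A = "seq_scalars F qs"
  note A = seq_scalars_eq[OF qs]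
  have "?A \<subseteq> hom ?V ?V \<inter> extensional (carrier ?V)"
    unfolding A using scal_hom scal_extensional by blast
  moreover have "zero_end ?V \<in> ?A" unfolding A scal_zero[OF qs, symmetric] by simp
  moreover have "id_end ?V \<in> ?A"
  proof -
    have "id_end ?V = scal qs \<one>"
      by (rule extensionalityI[of _ "carrier ?V"]) (auto simp: scal_extensional scal_one id_end_def)
    then show ?thesis unfolding A by simp
  qed
  moreover have "neg_id_end ?V \<in> ?A"
  proof -
    have "neg_id_end ?V = scal qs (\<ominus> \<one>)"
    proof (rule extensionalityI[of _ "carrier ?V"])
      fix x assume x: "x \<in> carrier ?V"
      have "inv\<^bsub>?V\<^esub> x = scal qs (\<ominus> \<one>) x"
      proof (rule V_eqI[of _ "length qs"])
        fix i assume "i < length qs"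
        then show "(inv\<^bsub>?V\<^esub> x) i = scal qs (\<ominus> \<one>) x i"
          using x V_closed[OF x] minus_one_pow unit_seq_nth(1)[OF qs]
          by (simp add: inv_V scal_apply r_minus)
      qed (use x in \<open>auto intro!: scal_closed group.inv_closed[OF group_V]\<close>)
      then show "neg_id_end ?V x = scal qs (\<ominus> \<one>) x" using x by (simp add: neg_id_end_def)
    qed (auto simp: scal_extensional neg_id_end_def)
    then show ?thesis unfolding A by simp
  qed
  moreover have "subgroup (?A - {zero_end ?V}) (AutoGroup ?V)"
  proof -
    have "group_hom mult_F (AutoGroup ?V) (scal qs)"
      using scal_hom_AutoGroup group_mult_of group.AutoGroup[OF group_V]
      by (simp add: group_hom_def group_hom_axioms_def)
    from group_hom.img_is_subgroup[OF this] show ?thesis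
      by (simp add: seq_scalars_minus_zero[OF qs])
  qed
  moreover have "\<forall>x\<in>carrier ?V. \<forall>\<alpha>\<in>?A. \<forall>\<beta>\<in>?A. \<alpha> x = \<beta> x \<longrightarrow> x = \<one>\<^bsub>?V\<^esub> \<or> \<alpha> = \<beta>"
    unfolding A using scal_cancel[OF qs] by blast
  moreover have "generate ?V (quasi_kernel ?V ?A) = carrier ?V"
    by (rule generate_singles) (use single_in_quasi_kernel[OF qs] in \<open>auto simp: quasi_kernel_def\<close>)
  ultimately show ?thesis using group_V by (simp add: near_vector_space_def)
qed

lemma nvs_over_eq:
  assumes "m > 0"
  shows "nvs_over F m = seq_scalars F ` {qs. unit_seq qs \<and> length qs = m}"
proof (intro equalityI subsetI)
  fix A assume "A \<in> nvs_over F m"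
  then obtain \<psi> where \<psi>: "\<And>i. i < m \<Longrightarrow> \<psi> i \<in> iso F F" "A = scalars F m \<psi>"
    by (auto simp: nvs_over_def)
  have "\<exists>r. r \<in> totatives M \<and> (\<forall>x\<in>carrier F. \<psi> i x = x [^] r)" if "i < m" for i
    using iso_is_power_map[OF \<psi>(1)[OF that]] by metis
  then obtain r where r: "\<And>i. i < m \<Longrightarrow> r i \<in> totatives M"
    "\<And>i x. i < m \<Longrightarrow> x \<in> carrier F \<Longrightarrow> \<psi> i x = x [^] (r i :: nat)" by metis
  define qs where "qs = map r [0..<m]"
  have qs: "unit_seq qs" "length qs = m" using assms r(1) by (auto simp: qs_def unit_seq_def)
  have "A = scal qs ` carrier F"
    unfolding \<psi>(2) scalars_def
  proof (rule image_cong)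
    fix a assume "a \<in> carrier F"
    then show "(\<lambda>x\<in>carrier (V m). \<lambda>i\<in>{..<m}. x i \<otimes> \<psi> i a) = scal qs a"
      unfolding scal_def qs(2) by (intro restrict_ext) (simp add: r(2) qs_def)
  qed simp
  then show "A \<in> seq_scalars F ` {qs. unit_seq qs \<and> length qs = m}"
    using qs seq_scalars_eq by blast
next
  fix A assume "A \<in> seq_scalars F ` {qs. unit_seq qs \<and> length qs = m}"
  then obtain qs where qs: "unit_seq qs" "length qs = m" "A = seq_scalars F qs" by blast
  have "A = scalars F m (\<lambda>i a. a [^] (qs ! i))"
    unfolding qs(3) seq_scalars_eq[OF qs(1)] by (simp add: scalars_def scal_def qs(2))
  moreover have "\<forall>i<m. (\<lambda>a. a [^] (qs ! i)) \<in> iso F F"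
    using power_map_iso unit_seq_nth(1)[OF qs(1)] qs(2) by simp
  moreover have "near_vector_space (V m) A"
    using near_vector_space_seq_scalars[OF qs(1)] by (simp only: qs(2,3))
  ultimately show "A \<in> nvs_over F m"
    unfolding nvs_over_def mem_Collect_eq
    by (intro conjI exI[of _ "\<lambda>i a. a [^] (qs ! i)"])
qed

text \<open>Through \<open>scal\<close>, both scalar groups are copies of the multiplicative group
  of \<open>F\<close>, so \<open>\<eta>\<close> becomes one of its automorphisms, that is, an
  exponent \<open>r\<close>. The equation extends to \<open>a = \<zero>\<close>, where both sides
  are neutral.\<close>

lemma nvs_isomorphic_seq_scalars_iff:
  assumes qs: "unit_seq qs" and rs: "unit_seq rs" and len: "length qs = length rs"
  shows "nvs_isomorphic (V (length qs)) (seq_scalars F qs) (V (length rs)) (seq_scalars F rs) \<longleftrightarrow>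
    (\<exists>\<theta>\<in>iso (V (length qs)) (V (length rs)). \<exists>r\<in>totatives M.
       \<forall>x\<in>carrier (V (length qs)). \<forall>a\<in>carrier F. \<theta> (scal qs a x) = scal rs (a [^] r) (\<theta> x))"
    (is "?L \<longleftrightarrow> ?R")
proof
  let ?V = "V (length qs)" and ?W = "V (length rs)"
  let ?A = "scalar_group ?V (seq_scalars F qs)" and ?B = "scalar_group ?W (seq_scalars F rs)"
  note sq = scal_iso_scalar_group[OF qs] and sr = scal_iso_scalar_group[OF rs]
  {
    assume ?L
    then obtain \<theta> \<eta> where \<theta>: "\<theta> \<in> iso ?V ?W" and \<eta>: "\<eta> \<in> iso ?A ?B"
      and eq: "\<forall>x\<in>carrier ?V. \<forall>\<alpha>\<in>seq_scalars F qs - {zero_end ?V}. \<theta> (\<alpha> x) = \<eta> \<alpha> (\<theta> x)"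
      unfolding nvs_isomorphic_def by blast
    let ?inv = "inv_into (carrier mult_F) (scal rs)"
    have "?inv \<circ> (\<eta> \<circ> scal qs) \<in> iso mult_F mult_F"
      by (intro iso_set_trans[OF iso_set_trans[OF sq \<eta>]] group.iso_set_sym[OF group_mult_of sr])
    then obtain r where r: "r \<in> totatives M"
      "\<And>a. a \<in> carrier F \<Longrightarrow> a \<noteq> \<zero> \<Longrightarrow> (?inv \<circ> (\<eta> \<circ> scal qs)) a = a [^] r"
      using iso_mult_of_is_power_map by blast
    have \<eta>s: "\<eta> (scal qs a) = scal rs (a [^] r)" if a: "a \<in> carrier F" "a \<noteq> \<zero>" for a
    proof -
      have "\<eta> (scal qs a) \<in> carrier ?B"
        using iso_set_trans[OF sq \<eta>] a by (auto simp: iso_def hom_def)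
      then have "\<eta> (scal qs a) \<in> scal rs ` carrier mult_F" using sr by (simp add: iso_def bij_betw_def)
      then have "scal rs (?inv (\<eta> (scal qs a))) = \<eta> (scal qs a)" by (rule f_inv_into_f)
      then show ?thesis using r(2)[OF a] by simp
    qed
    have "\<theta> (scal qs a x) = scal rs (a [^] r) (\<theta> x)" if x: "x \<in> carrier ?V" and a: "a \<in> carrier F" for x a
    proof (cases "a = \<zero>")
      case True
      have "\<theta> x \<in> carrier ?W" using \<theta> x by (auto simp: iso_def hom_def)
      moreover have "\<theta> \<one>\<^bsub>?V\<^esub> = \<one>\<^bsub>?W\<^esub>"
        using \<theta> hom_one[OF _ group_V group_V] by (auto simp: iso_def)
      ultimately show ?thesis
        using x True totatives_pos[OF r(1)]
        by (simp add: nat_pow_zero scal_zero qs rs zero_end_def)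
    next
      case False
      then have "scal qs a \<in> seq_scalars F qs - {zero_end ?V}"
        using a seq_scalars_minus_zero[OF qs] by auto
      then show ?thesis using eq x \<eta>s[OF a False] by metis
    qed
    then show ?R using \<theta> r(1) by blast
  }
  {
    assume ?R
    then obtain \<theta> r where \<theta>: "\<theta> \<in> iso ?V ?W" and r: "r \<in> totatives M"
      and eq: "\<And>x a. x \<in> carrier ?V \<Longrightarrow> a \<in> carrier F \<Longrightarrow> \<theta> (scal qs a x) = scal rs (a [^] r) (\<theta> x)"
      by blast
    let ?inv = "inv_into (carrier mult_F) (scal qs)"
    define \<eta> where "\<eta> = scal rs \<circ> ((\<lambda>a. a [^] r) \<circ> ?inv)"
    have "\<eta> \<in> iso ?A ?B"
      unfolding \<eta>_def
      by (intro iso_set_trans[OF iso_set_trans[OF _ power_map_iso_mult_of[OF r]] sr]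
          group.iso_set_sym[OF group_mult_of sq])
    moreover have "\<theta> (\<alpha> x) = \<eta> \<alpha> (\<theta> x)"
      if x: "x \<in> carrier ?V" and \<alpha>: "\<alpha> \<in> seq_scalars F qs - {zero_end ?V}" for x \<alpha>
    proof -
      obtain a where a: "a \<in> carrier F" "a \<noteq> \<zero>" "\<alpha> = scal qs a"
        using \<alpha> seq_scalars_minus_zero[OF qs] by auto
      have "inj_on (scal qs) (carrier mult_F)" using sq by (simp add: iso_def bij_betw_def)
      then have "?inv \<alpha> = a" using a by simp
      then show ?thesis using eq[OF x a(1)] a(3) by (simp add: \<eta>_def)
    qed
    ultimately show ?L using \<theta> unfolding nvs_isomorphic_def by blast
  }
qed

end

section \<open>Isomorphism of near-vector spaces and translation of multisets\<close>

context galois_field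
begin

abbreviation G :: "nat monoid" where
  "G \<equiv> coset_group p n"

definition coset_mset :: "nat list \<Rightarrow> nat multiset" where
  "coset_mset qs = mset (map (coset_rep p n) qs)"

text \<open>For \<open>q\<close> in a given coset, this is the sum of the coordinate axes whose exponents lie in that
  coset. Since it is defined by the action alone, isomorphisms respect it, and its cardinality
  recovers the multiplicity of the coset.\<close>

definition isotypic :: "nat list \<Rightarrow> nat \<Rightarrow> (nat \<Rightarrow> 'a) set" where
  "isotypic qs q = {x \<in> carrier (V (length qs)).
     \<forall>a\<in>carrier F. \<forall>b\<in>carrier F. \<forall>c\<in>carrier F. a [^] q \<oplus> b [^] q = c [^] q \<longrightarrow>
       scal qs a x \<otimes>\<^bsub>V (length qs)\<^esub> scal qs b x = scal qs c x}"

text \<open>A relation between scalars acts on coordinate \<open>i\<close> as a relation between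
  \<open>qs ! i\<close>-th powers multiplied by \<open>x i\<close>. If the cosets differ, some
  triple violates it and forces \<open>x i = \<zero>\<close>; if they agree, it holds for every
  \<open>x i\<close>.\<close>

lemma isotypic_eq:
  assumes qs: "unit_seq qs" and q: "q \<in> totatives M"
  shows "isotypic qs q =
    (\<Pi>\<^sub>E i\<in>{..<length qs}. if coset_rep p n (qs ! i) = coset_rep p n q then carrier F else {\<zero>})"
    (is "_ = PiE ?I ?C")
proof (intro equalityI subsetI)
  fix x assume x: "x \<in> isotypic qs q"
  then have xV: "x \<in> carrier (V (length qs))" by (simp add: isotypic_def)
  have "x i \<in> ?C i" if i: "i < length qs" for i
  proof (cases "coset_rep p n (qs ! i) = coset_rep p n q")
    case True
    then show ?thesis using V_closed[OF xV i] by simp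
  next
    case False
    then obtain a b c where abc: "a \<in> carrier F" "b \<in> carrier F" "c \<in> carrier F"
      "a [^] q \<oplus> b [^] q = c [^] q" "a [^] (qs ! i) \<oplus> b [^] (qs ! i) \<noteq> c [^] (qs ! i)"
      using power_sums_preserved_iff[OF q unit_seq_nth(1)[OF qs i]] by metis
    have sum: "scal qs a x \<otimes>\<^bsub>V (length qs)\<^esub> scal qs b x = scal qs c x"
      using x abc(1-4) unfolding isotypic_def by blast
    have "x i \<otimes> a [^] (qs ! i) \<oplus> x i \<otimes> b [^] (qs ! i) = x i \<otimes> c [^] (qs ! i)"
      using fun_cong[OF sum, of i] xV i by (simp add: mult_V scal_apply)
    then have "x i \<otimes> (a [^] (qs ! i) \<oplus> b [^] (qs ! i)) = x i \<otimes> c [^] (qs ! i)"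
      using V_closed[OF xV i] abc by (simp add: r_distr)
    then have "x i = \<zero>"
      using V_closed[OF xV i] abc m_lcancel[of "x i"] by (meson a_closed nat_pow_closed)
    then show ?thesis by simp
  qed
  then show "x \<in> PiE ?I ?C" using xV unfolding carrier_V PiE_iff by blast
next
  fix x assume x: "x \<in> PiE ?I ?C"
  have sub: "?C i \<subseteq> carrier F" for i by simp
  have xV: "x \<in> carrier (V (length qs))" using x sub unfolding carrier_V PiE_iff by blast
  show "x \<in> isotypic qs q"
    unfolding isotypic_def
  proof (intro CollectI conjI ballI impI)
    fix a b c assume abc: "a \<in> carrier F" "b \<in> carrier F" "c \<in> carrier F"
      and eq: "a [^] q \<oplus> b [^] q = c [^] q"
    show "scal qs a x \<otimes>\<^bsub>V (length qs)\<^esub> scal qs b x = scal qs c x"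
    proof (rule V_eqI[of _ "length qs"])
      show "scal qs a x \<otimes>\<^bsub>V (length qs)\<^esub> scal qs b x \<in> carrier (V (length qs))"
        using abc xV by (intro monoid.m_closed group.is_monoid[OF group_V] scal_closed)
      show "scal qs c x \<in> carrier (V (length qs))" using abc xV by (intro scal_closed)
      fix i assume i: "i < length qs"
      have "x i \<otimes> a [^] (qs ! i) \<oplus> x i \<otimes> b [^] (qs ! i) = x i \<otimes> c [^] (qs ! i)"
      proof (cases "coset_rep p n (qs ! i) = coset_rep p n q")
        case True
        then have "a [^] (qs ! i) \<oplus> b [^] (qs ! i) = c [^] (qs ! i)"
          using power_sums_preserved_iff[OF q unit_seq_nth(1)[OF qs i]] abc eq by metis
        then show ?thesis using V_closed[OF xV i] abc by (metis r_distr nat_pow_closed)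
      next
        case False
        then have "x i = \<zero>" using PiE_mem[OF x, of i] i by simp
        then show ?thesis using abc by simp
      qed
      then show "(scal qs a x \<otimes>\<^bsub>V (length qs)\<^esub> scal qs b x) i = scal qs c x i"
        using xV i by (simp add: mult_V scal_apply)
    qed
  qed (rule xV)
qed

lemma card_isotypic:
  assumes qs: "unit_seq qs" and q: "q \<in> totatives M"
  shows "card (isotypic qs q) = (M + 1) ^ count (coset_mset qs) (coset_rep p n q)"
proof -
  let ?I = "{..<length qs}"
  let ?J = "{i \<in> ?I. coset_rep p n (qs ! i) = coset_rep p n q}"
  have "card (isotypic qs q) = (\<Prod>i\<in>?I. if coset_rep p n (qs ! i) = coset_rep p n q then M + 1 else 1)"
    unfolding isotypic_eq[OF qs q]
    by (subst card_PiE) (auto intro!: prod.cong simp: card_carrier)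
  also have "\<dots> = (\<Prod>i\<in>?J. M + 1)" by (rule prod.inter_filter[symmetric]) simp
  also have "\<dots> = (M + 1) ^ card ?J" by simp
  also have "card ?J = count (coset_mset qs) (coset_rep p n q)"
    unfolding coset_mset_def count_mset count_list_eq_length_filter length_filter_conv_card
    by (rule arg_cong[of _ _ card]) auto
  finally show ?thesis .
qed

lemma set_coset_mset:
  assumes "unit_seq qs"
  shows "set_mset (coset_mset qs) \<subseteq> carrier G"
  using assms by (auto simp: coset_mset_def unit_seq_def carrier_coset_group)

lemma coset_mset_in_multisets_of_size:
  assumes "unit_seq qs"
  shows "coset_mset qs \<in> multisets_of_size (carrier G) (length qs)"
  using set_coset_mset[OF assms] by (simp add: multisets_of_size_def coset_mset_def)

text \<open>As \<open>\<theta>\<close> turns the scalar \<open>a\<close> into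
  \<open>a [^] r\<close>, it maps the isotypic part of \<open>qs\<close> for \<open>r * q\<close>
  onto that of \<open>rs\<close> for \<open>q\<close>. Equal cardinalities give equal
  multiplicities.\<close>

lemma isomorphic_imp_translate:
  assumes qs: "unit_seq qs" and rs: "unit_seq rs" and len: "length qs = length rs"
    and \<theta>: "\<theta> \<in> iso (V (length qs)) (V (length rs))" and r: "r \<in> totatives M"
    and eq: "\<And>x a. x \<in> carrier (V (length qs)) \<Longrightarrow> a \<in> carrier F \<Longrightarrow>
               \<theta> (scal qs a x) = scal rs (a [^] r) (\<theta> x)"
  shows "coset_mset qs = translate G (coset_rep p n r) (coset_mset rs)"
proof -
  let ?V = "V (length qs)" and ?W = "V (length rs)"
  interpret Gr: group G by (rule group_coset_group)
  interpret VV: group ?V by (rule group_V)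
  have g: "coset_rep p n r \<in> carrier G" by (rule coset_rep_in_carrier[OF totatives_coprime[OF r]])
  have bij: "bij_betw \<theta> (carrier ?V) (carrier ?W)" and hom: "\<theta> \<in> hom ?V ?W"
    using \<theta> by (auto simp: iso_def)
  have count: "count (coset_mset qs) (coset_rep p n (r * q)) = count (coset_mset rs) (coset_rep p n q)"
    if q: "q \<in> totatives M" for q
  proof -
    define q' where "q' = residue M (r * q)"
    have q': "q' \<in> totatives M"
      unfolding q'_def using r q totatives_coprime by (intro residue_in_totatives[OF M_pos]) auto
    have pow: "a [^] q' = (a [^] r) [^] q" if "a \<in> carrier F" for a
      using pow_cong[OF that, of q' "r * q"] cong_residue totatives_pos r q q' that
      by (auto simp: nat_pow_pow q'_def)
    have iff: "x \<in> isotypic qs q' \<longleftrightarrow> \<theta> x \<in> isotypic rs q" if x: "x \<in> carrier ?V" for x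
    proof -
      have \<theta>x: "\<theta> x \<in> carrier ?W" using bij x bij_betwE by blast
      have step: "scal qs a x \<otimes>\<^bsub>?V\<^esub> scal qs b x = scal qs c x \<longleftrightarrow>
          scal rs (a [^] r) (\<theta> x) \<otimes>\<^bsub>?W\<^esub> scal rs (b [^] r) (\<theta> x) = scal rs (c [^] r) (\<theta> x)"
        if abc: "a \<in> carrier F" "b \<in> carrier F" "c \<in> carrier F" for a b c
      proof -
        have cl: "scal qs a x \<in> carrier ?V" "scal qs b x \<in> carrier ?V" "scal qs c x \<in> carrier ?V"
          using abc x by (auto intro: scal_closed)
        then have "scal qs a x \<otimes>\<^bsub>?V\<^esub> scal qs b x = scal qs c x \<longleftrightarrow>
            \<theta> (scal qs a x \<otimes>\<^bsub>?V\<^esub> scal qs b x) = \<theta> (scal qs c x)"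
          using bij_betw_imp_inj_on[OF bij] VV.m_closed by (metis inj_on_eq_iff)
        then show ?thesis using hom_mult[OF hom cl(1,2)] eq[OF x] abc by simp
      qed
      \<comment> \<open>Every scalar of the second space is an \<open>r\<close>-th power, so
        relations there can be pulled back.\<close>
      have surj: "\<exists>a\<in>carrier F. a' = a [^] r" if "a' \<in> carrier F" for a'
        using power_map_bij[OF r] that unfolding bij_betw_def by blast
      show ?thesis
      proof
        assume L: "x \<in> isotypic qs q'"
        show "\<theta> x \<in> isotypic rs q"
          unfolding isotypic_def
        proof (intro CollectI conjI ballI impI)
          fix a' b' c' assume "a' \<in> carrier F" "b' \<in> carrier F" "c' \<in> carrier F"
            and sum: "a' [^] q \<oplus> b' [^] q = c' [^] q"
          then obtain a b c where abc: "a \<in> carrier F" "b \<in> carrier F" "c \<in> carrier F"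
            "a' = a [^] r" "b' = b [^] r" "c' = c [^] r" using surj by metis
          then have "a [^] q' \<oplus> b [^] q' = c [^] q'" using sum by (simp add: pow)
          then show "scal rs a' (\<theta> x) \<otimes>\<^bsub>?W\<^esub> scal rs b' (\<theta> x) = scal rs c' (\<theta> x)"
            using L abc step[of a b c] unfolding isotypic_def by blast
        qed (rule \<theta>x)
      next
        assume R: "\<theta> x \<in> isotypic rs q"
        show "x \<in> isotypic qs q'"
          unfolding isotypic_def
        proof (intro CollectI conjI ballI impI)
          fix a b c assume abc: "a \<in> carrier F" "b \<in> carrier F" "c \<in> carrier F"
            and sum: "a [^] q' \<oplus> b [^] q' = c [^] q'"
          have "(a [^] r) [^] q \<oplus> (b [^] r) [^] q = (c [^] r) [^] q"
            using sum abc by (simp add: pow)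
          moreover have "a [^] r \<in> carrier F" "b [^] r \<in> carrier F" "c [^] r \<in> carrier F"
            using abc by auto
          ultimately show "scal qs a x \<otimes>\<^bsub>?V\<^esub> scal qs b x = scal qs c x"
            using R step[OF abc] unfolding isotypic_def by blast
        qed (rule x)
      qed
    qed
    have "bij_betw \<theta> (isotypic qs q') (isotypic rs q)"
    proof (rule bij_betw_subset[OF bij])
      show "isotypic qs q' \<subseteq> carrier ?V" by (auto simp: isotypic_def)
      show "\<theta> ` isotypic qs q' = isotypic rs q"
      proof (intro equalityI subsetI)
        fix y assume "y \<in> \<theta> ` isotypic qs q'"
        then obtain x where "x \<in> isotypic qs q'" "y = \<theta> x" by blast
        moreover from this have "x \<in> carrier ?V" by (simp add: isotypic_def)
        ultimately show "y \<in> isotypic rs q" using iff by blast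
      next
        fix y assume y: "y \<in> isotypic rs q"
        then have "y \<in> carrier ?W" by (simp add: isotypic_def)
        then obtain x where "x \<in> carrier ?V" "y = \<theta> x" using bij unfolding bij_betw_def by blast
        then show "y \<in> \<theta> ` isotypic qs q'" using iff y by blast
      qed
    qed
    then have "card (isotypic qs q') = card (isotypic rs q)" by (rule bij_betw_same_card)
    then have "count (coset_mset qs) (coset_rep p n q') = count (coset_mset rs) (coset_rep p n q)"
      \<comment> \<open>The base \<open>M + 1\<close> exceeds 1, so the exponents can be
        compared.\<close>
      using M_pos by (simp add: card_isotypic qs rs q q' power_inject_exp)
    then show ?thesis by (simp only: q'_def coset_rep_residue)
  qed
  show ?thesis
  proof (rule multiset_eqI)
    fix y
    show "count (coset_mset qs) y = count (translate G (coset_rep p n r) (coset_mset rs)) y"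
    proof (cases "y \<in> carrier G")
      case True
      define z where "z = inv\<^bsub>G\<^esub> (coset_rep p n r) \<otimes>\<^bsub>G\<^esub> y"
      have z: "z \<in> carrier G" using g True by (simp add: z_def)
      have "coset_rep p n r \<otimes>\<^bsub>G\<^esub> z = y" using g True by (simp add: z_def flip: Gr.m_assoc)
      moreover have "coset_rep p n r \<otimes>\<^bsub>G\<^esub> z = coset_rep p n (r * z)"
        using mult_coset_group[of r z] totatives_coprime[OF r] carrier_coset_groupD(2)[OF z]
          coset_rep_carrier[OF z] by simp
      moreover have "count (coset_mset qs) (coset_rep p n (r * z)) = count (coset_mset rs) z"
        using count[OF carrier_coset_groupD(1)[OF z]] coset_rep_carrier[OF z] by simp
      ultimately show ?thesis
        using Gr.count_translate[OF set_coset_mset[OF rs] g z] by simp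
    next
      case False
      then have "y \<notin># coset_mset qs" "y \<notin># translate G (coset_rep p n r) (coset_mset rs)"
        using set_coset_mset[OF qs] Gr.translate_carrier[OF set_coset_mset[OF rs] g] by auto
      then show ?thesis by (simp add: not_in_iff)
    qed
  qed
qed

text \<open>A permutation \<open>\<pi>\<close> matches coordinates with the same coset, up to the
  factor \<open>r\<close>. There the exponents still differ by a power \<open>p ^ k j\<close>, and
  the additive map raising to that power repairs this, so \<open>\<theta>\<close> permutes
  coordinates and applies a field automorphism on each.\<close>

lemma translate_imp_isomorphic:
  assumes qs: "unit_seq qs" and rs: "unit_seq rs" and len: "length qs = length rs"
    and r: "r \<in> totatives M"
    and eq: "coset_mset qs = translate G (coset_rep p n r) (coset_mset rs)"
  shows "\<exists>\<theta>\<in>iso (V (length qs)) (V (length rs)).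
    \<forall>x\<in>carrier (V (length qs)). \<forall>a\<in>carrier F. \<theta> (scal qs a x) = scal rs (a [^] r) (\<theta> x)"
proof -
  let ?m = "length qs"
  have "translate G (coset_rep p n r) (coset_mset rs) = mset (map (\<lambda>q. coset_rep p n (r * q)) rs)"
    unfolding translate_def coset_mset_def mset_map multiset.map_comp
    by (rule image_mset_cong)
       (use rs r totatives_coprime mult_coset_group in \<open>auto simp: unit_seq_def\<close>)
  then have "mset (map (\<lambda>q. coset_rep p n (r * q)) rs) = mset (map (coset_rep p n) qs)"
    using eq by (simp add: coset_mset_def)
  then obtain \<pi> where \<pi>: "\<pi> permutes {..<length (map (coset_rep p n) qs)}"
    "permute_list \<pi> (map (coset_rep p n) qs) = map (\<lambda>q. coset_rep p n (r * q)) rs"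
    by (rule mset_eq_permutation)
  have \<pi>m: "\<pi> permutes {..<?m}" using \<pi>(1) by simp
  have \<pi>_less: "\<pi> j < ?m" if "j < ?m" for j using permutes_in_image[OF \<pi>m] that by blast
  have "\<exists>k. [r * rs ! j = qs ! \<pi> j * p ^ k] (mod M)" if j: "j < ?m" for j
  proof -
    have "coset_rep p n (qs ! \<pi> j) = permute_list \<pi> (map (coset_rep p n) qs) ! j"
      using permute_list_nth[OF \<pi>(1), of j] j \<pi>_less[OF j] by simp
    also have "\<dots> = coset_rep p n (r * rs ! j)" using \<pi>(2) j len by simp
    finally show ?thesis
      using coset_rep_eq_iff[of "qs ! \<pi> j" "r * rs ! j"] totatives_coprime r
        unit_seq_nth(1)[OF qs \<pi>_less[OF j]] unit_seq_nth(1)[OF rs, of j] j len by auto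
  qed
  then obtain k where k: "\<And>j. j < ?m \<Longrightarrow> [r * rs ! j = qs ! \<pi> j * p ^ k j] (mod M)" by metis
  define \<theta> where "\<theta> = (\<lambda>x. \<lambda>j\<in>{..<?m}. x (\<pi> j) [^] (p ^ k j))"
  have cl: "\<theta> x \<in> carrier (V ?m)" if x: "x \<in> carrier (V ?m)" for x
    unfolding \<theta>_def carrier_V PiE_iff using V_closed[OF x \<pi>_less] by simp
  interpret VV: group "V ?m" by (rule group_V)
  have hom: "\<theta> \<in> hom (V ?m) (V ?m)"
  proof (rule homI[OF cl])
    fix x y assume x: "x \<in> carrier (V ?m)" and y: "y \<in> carrier (V ?m)"
    show "\<theta> (x \<otimes>\<^bsub>V ?m\<^esub> y) = \<theta> x \<otimes>\<^bsub>V ?m\<^esub> \<theta> y"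
    proof (rule V_eqI[of _ ?m])
      fix j assume "j < ?m"
      then show "\<theta> (x \<otimes>\<^bsub>V ?m\<^esub> y) j = (\<theta> x \<otimes>\<^bsub>V ?m\<^esub> \<theta> y) j"
        using \<pi>_less V_closed[OF x \<pi>_less] V_closed[OF y \<pi>_less]
        by (simp add: \<theta>_def mult_V frobenius_add)
    qed (use x y in \<open>auto intro!: cl\<close>)
  qed
  have "inj_on \<theta> (carrier (V ?m))"
  proof (rule inj_onI)
    fix x y assume x: "x \<in> carrier (V ?m)" and y: "y \<in> carrier (V ?m)" and xy: "\<theta> x = \<theta> y"
    show "x = y"
    proof (rule V_eqI[OF x y])
      fix i assume "i < ?m"
      then obtain j where j: "j < ?m" "i = \<pi> j" using permutes_image[OF \<pi>m] by blast
      then have "x i [^] (p ^ k j) = y i [^] (p ^ k j)"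
        using fun_cong[OF xy, of j] by (simp add: \<theta>_def)
      then show "x i = y i" by (rule frobenius_inj[rotated 2]) (use V_closed x y \<open>i < ?m\<close> in auto)
    qed
  qed
  moreover have "finite (carrier (V ?m))" by (simp add: carrier_V finite_PiE finite_carrier)
  ultimately have "bij_betw \<theta> (carrier (V ?m)) (carrier (V ?m))"
    using cl endo_inj_surj[of "carrier (V ?m)" \<theta>] by (auto simp: bij_betw_def)
  then have "\<theta> \<in> iso (V ?m) (V ?m)" using hom by (rule isoI[rotated])
  moreover have "\<theta> (scal qs a x) = scal rs (a [^] r) (\<theta> x)"
    if x: "x \<in> carrier (V ?m)" and a: "a \<in> carrier F" for x a
  proof (rule V_eqI[of _ ?m])
    show "\<theta> (scal qs a x) \<in> carrier (V ?m)" using x a by (intro cl scal_closed)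
    show "scal rs (a [^] r) (\<theta> x) \<in> carrier (V ?m)"
      using x a cl[OF x] scal_closed[of "\<theta> x" rs "a [^] r"] len by simp
    fix j assume j: "j < ?m"
    let ?q = "qs ! \<pi> j" and ?P = "p ^ k j"
    have c: "x (\<pi> j) \<in> carrier F" using V_closed[OF x \<pi>_less[OF j]] .
    have "a [^] (?q * ?P) = a [^] (r * rs ! j)"
      by (rule pow_cong[OF a cong_sym[OF k[OF j]]])
         (use j len \<pi>_less[OF j] unit_seq_nth(2)[OF qs] unit_seq_nth(2)[OF rs] totatives_pos[OF r]
            prime_gt_0_nat[OF prime] in auto)
    then have "(x (\<pi> j) \<otimes> a [^] ?q) [^] ?P = x (\<pi> j) [^] ?P \<otimes> (a [^] r) [^] (rs ! j)"
      using c a by (simp add: nat_pow_distrib nat_pow_pow)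
    then show "\<theta> (scal qs a x) j = scal rs (a [^] r) (\<theta> x) j"
      using j \<pi>_less[OF j] x cl[OF x] len scal_apply[of "\<theta> x" rs j "a [^] r"]
      by (simp add: \<theta>_def scal_apply)
  qed
  ultimately show ?thesis using len by auto
qed

theorem nvs_isomorphic_iff_translate:
  assumes qs: "unit_seq qs" and rs: "unit_seq rs" and m: "length qs = m" "length rs = m"
  shows "nvs_isomorphic (V m) (seq_scalars F qs) (V m) (seq_scalars F rs) \<longleftrightarrow>
    (coset_mset qs, coset_mset rs) \<in> translate_rel G (multisets_of_size (carrier G) m)"
proof -
  let ?MS = "multisets_of_size (carrier G) m"
  interpret Gr: group G by (rule group_coset_group)
  have len: "length qs = length rs" using m by simp
  have mem: "coset_mset qs \<in> ?MS" "coset_mset rs \<in> ?MS"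
    using coset_mset_in_multisets_of_size[OF qs] coset_mset_in_multisets_of_size[OF rs] m by auto
  have "equiv ?MS (translate_rel G ?MS)"
    by (rule Gr.equiv_translate_rel) (simp add: multisets_of_size_def)
  \<comment> \<open>The isomorphism expresses \<open>qs\<close> as a translate of \<open>rs\<close>;
    symmetry restores the order of the statement.\<close>
  then have sym: "(coset_mset qs, coset_mset rs) \<in> translate_rel G ?MS
      \<longleftrightarrow> (coset_mset rs, coset_mset qs) \<in> translate_rel G ?MS"
    by (meson equivE symE)
  have "nvs_isomorphic (V m) (seq_scalars F qs) (V m) (seq_scalars F rs) \<longleftrightarrow>
    (\<exists>r\<in>totatives M. coset_mset qs = translate G (coset_rep p n r) (coset_mset rs))"
    unfolding nvs_isomorphic_seq_scalars_iff[OF qs rs len, unfolded m]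
  proof
    assume "\<exists>\<theta>\<in>iso (V m) (V m). \<exists>r\<in>totatives M.
      \<forall>x\<in>carrier (V m). \<forall>a\<in>carrier F. \<theta> (scal qs a x) = scal rs (a [^] r) (\<theta> x)"
    then obtain \<theta> r where \<theta>: "\<theta> \<in> iso (V m) (V m)" and r: "r \<in> totatives M"
      and "\<forall>x\<in>carrier (V m). \<forall>a\<in>carrier F. \<theta> (scal qs a x) = scal rs (a [^] r) (\<theta> x)" by blast
    then have "coset_mset qs = translate G (coset_rep p n r) (coset_mset rs)"
      by (intro isomorphic_imp_translate[OF qs rs len, unfolded m, of \<theta>]) simp_all
    then show "\<exists>r\<in>totatives M. coset_mset qs = translate G (coset_rep p n r) (coset_mset rs)"
      using r by blast
  next
    assume "\<exists>r\<in>totatives M. coset_mset qs = translate G (coset_rep p n r) (coset_mset rs)"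
    then show "\<exists>\<theta>\<in>iso (V m) (V m). \<exists>r\<in>totatives M.
      \<forall>x\<in>carrier (V m). \<forall>a\<in>carrier F. \<theta> (scal qs a x) = scal rs (a [^] r) (\<theta> x)"
      using translate_imp_isomorphic[OF qs rs len, unfolded m] by blast
  qed
  also have "\<dots> \<longleftrightarrow> (coset_mset rs, coset_mset qs) \<in> translate_rel G ?MS"
    using mem by (auto simp: translate_rel_def carrier_coset_group)
  finally show ?thesis using sym by simp
qed

end

section \<open>Pulled-back equivalences and numbering of a finite set\<close>

lemma equiv_vimageI:
  assumes S: "equiv B S" and f: "\<And>x. x \<in> A \<Longrightarrow> f x \<in> B"
    and R: "\<And>x y. (x, y) \<in> R \<longleftrightarrow> x \<in> A \<and> y \<in> A \<and> (f x, f y) \<in> S"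
  shows "equiv A R"
proof (rule equivI)
  show "R \<subseteq> A \<times> A" using R by auto
  show "refl_on A R" using S f R by (auto simp: refl_on_def dest: equivE intro: equiv_class_self)
  show "sym R" using S R by (auto simp: sym_def elim: equivE)
  show "trans R" using S R unfolding trans_def by (meson equivE transE)
qed

text \<open>The shift \<open>i - 1\<close> reconciles the numbering of the divisors from 1 with list
  positions from 0.\<close>

lemma bij_betw_sorted_list_of_set_nth:
  assumes "finite (D :: nat set)"
  shows "bij_betw (\<lambda>i. sorted_list_of_set D ! (i - 1)) {1..card D} D"
proof -
  have "bij_betw (\<lambda>i. i - 1) {1..card D} {..<card D}"
    by (rule bij_betwI[where g = Suc]) auto
  moreover have "bij_betw (nth (sorted_list_of_set D)) {..<card D} D"
    by (rule bij_betw_nth) (use assms in auto)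
  ultimately show ?thesis using bij_betw_trans by (fastforce simp: comp_def)
qed

text \<open>The enumeration is strictly increasing, so later indices are exactly larger elements.
  This translates sums over larger divisors into the index sums of the recursion.\<close>

lemma sum_sorted_list_of_set_greater:
  fixes f :: "nat \<Rightarrow> 'b::comm_monoid_add"
  assumes fin: "finite D" and i: "i \<in> {1..card D}"
  shows "(\<Sum>s = i + 1..card D. f (sorted_list_of_set D ! (s - 1)))
       = (\<Sum>e | e \<in> D \<and> sorted_list_of_set D ! (i - 1) < e. f e)"
proof -
  let ?d = "\<lambda>s. sorted_list_of_set D ! (s - 1)"
  have mono: "?d s < ?d t" if "1 \<le> s" "s < t" "t \<le> card D" for s t
    using sorted_wrt_nth_less[OF strict_sorted_list_of_set[of D], of "s - 1" "t - 1"] that fin by simp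
  have bij: "bij_betw ?d {1..card D} D" by (rule bij_betw_sorted_list_of_set_nth[OF fin])
  have "bij_betw ?d {i + 1..card D} {e \<in> D. ?d i < e}"
  proof (rule bij_betw_subset[OF bij])
    show "{i + 1..card D} \<subseteq> {1..card D}" by auto
    show "?d ` {i + 1..card D} = {e \<in> D. ?d i < e}"
    proof (intro equalityI subsetI)
      fix e assume "e \<in> ?d ` {i + 1..card D}"
      then obtain s where "s \<in> {i + 1..card D}" "e = ?d s" by blast
      then show "e \<in> {e \<in> D. ?d i < e}" using bij_betwE[OF bij] mono[of i s] i by auto
    next
      fix e assume e: "e \<in> {e \<in> D. ?d i < e}"
      then obtain s where s: "s \<in> {1..card D}" "e = ?d s"
        using bij unfolding bij_betw_def by blast
      have "\<not> s \<le> i"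
      proof
        assume "s \<le> i"
        then have "?d s \<le> ?d i" using mono[of s i] s i by (cases "s = i") auto
        then show False using e s by simp
      qed
      then show "e \<in> ?d ` {i + 1..card D}" using s by auto
    qed
  qed
  then show ?thesis by (rule sum.reindex_bij_betw)
qed

section \<open>Suitable sequences as sorted multisets\<close>

context galois_field
begin

lemma coset_mset_sorted_list_of_multiset:
  assumes "m > 0" "U \<in> multisets_of_size (carrier G) m"
  shows "unit_seq (sorted_list_of_multiset U)" "length (sorted_list_of_multiset U) = m"
    "coset_mset (sorted_list_of_multiset U) = U"
proof -
  have U: "set_mset U \<subseteq> carrier G" "size U = m" using assms(2) by (auto simp: multisets_of_size_def)
  show len: "length (sorted_list_of_multiset U) = m"
    using U(2) by (metis mset_sorted_list_of_multiset size_mset)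
  then show "unit_seq (sorted_list_of_multiset U)"
    using U assms(1) carrier_coset_groupD(1) by (auto simp: unit_seq_def)
  have "image_mset (coset_rep p n) U = image_mset (\<lambda>q. q) U"
    by (rule image_mset_cong) (use U coset_rep_carrier in auto)
  then show "coset_mset (sorted_list_of_multiset U) = U" by (simp add: coset_mset_def)
qed

lemma suitable_sorted_list_of_multiset_iff:
  "suitable p n m qs \<longleftrightarrow> (\<exists>U\<in>multisets_of_size (carrier G) m. qs = sorted_list_of_multiset U)"
proof
  assume "suitable p n m qs"
  then have "mset qs \<in> multisets_of_size (carrier G) m" "qs = sorted_list_of_multiset (mset qs)"
    by (auto simp: suitable_iff multisets_of_size_def sorted_sort_id)
  then show "\<exists>U\<in>multisets_of_size (carrier G) m. qs = sorted_list_of_multiset U" by blast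
next
  assume "\<exists>U\<in>multisets_of_size (carrier G) m. qs = sorted_list_of_multiset U"
  then show "suitable p n m qs"
    by (auto simp: suitable_iff multisets_of_size_def simp flip: size_mset)
qed

lemma inj_sorted_list_of_multiset: "inj sorted_list_of_multiset"
  by (rule inj_on_inverseI[where g = mset]) simp

lemma hd_sorted_list_of_multiset_eq_one_iff:
  assumes "m > 0" "U \<in> multisets_of_size (carrier G) m"
  shows "hd (sorted_list_of_multiset U) = 1 \<longleftrightarrow> 1 \<in># U"
proof
  let ?qs = "sorted_list_of_multiset U"
  have ne: "?qs \<noteq> []" using coset_mset_sorted_list_of_multiset(2)[OF assms] assms(1) by auto
  have pos: "q \<ge> 1" if "q \<in> set ?qs" for q
    using that assms(2) carrier_coset_groupD(1) totatives_pos
    by (fastforce simp: multisets_of_size_def Suc_le_eq)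
  show "1 \<in># U" if "hd ?qs = 1"
    using hd_in_set[OF ne] that by simp
  show "hd ?qs = 1" if "1 \<in># U"
  proof -
    have "hd ?qs \<le> 1"
    proof -
      have "1 \<in> set ?qs" using that by simp
      then show ?thesis using sorted_sorted_list_of_multiset[of U]
        by (cases ?qs) (auto simp del: set_sorted_list_of_multiset)
    qed
    then show ?thesis using pos[OF hd_in_set[OF ne]] by simp
  qed
qed

lemma St1_eq:
  assumes "m > 0"
  shows "St1 p n m N = sorted_list_of_multiset ` pointed_multisets G m N"
  unfolding St1_def suitable_sorted_list_of_multiset_iff pointed_multisets_def
  using hd_sorted_list_of_multiset_eq_one_iff[OF assms] by (auto simp: one_coset_group)

lemma pointed_multisetsD:
  "U \<in> pointed_multisets G m N \<Longrightarrow> U \<in> multisets_of_size (carrier G) m"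
  "U \<in> pointed_multisets G m N \<Longrightarrow> set_mset U \<subseteq> carrier G"
  by (auto simp: pointed_multisets_def multisets_of_size_def)

lemma seq_rel_iff:
  assumes "m > 0" "U \<in> pointed_multisets G m N" "W \<in> pointed_multisets G m N"
  shows "(sorted_list_of_multiset U, sorted_list_of_multiset W) \<in> seq_rel F p n m N
     \<longleftrightarrow> (U, W) \<in> translate_rel G (pointed_multisets G m N)"
proof -
  note cU = coset_mset_sorted_list_of_multiset[OF assms(1) pointed_multisetsD(1)[OF assms(2)]]
  note cW = coset_mset_sorted_list_of_multiset[OF assms(1) pointed_multisetsD(1)[OF assms(3)]]
  have "(U, W) \<in> translate_rel G (multisets_of_size (carrier G) m)
      \<longleftrightarrow> (U, W) \<in> translate_rel G (pointed_multisets G m N)"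
    using assms pointed_multisetsD(1) by (auto simp: translate_rel_def)
  then show ?thesis
    using nvs_isomorphic_iff_translate[OF cU(1) cW(1) cU(2) cW(2)] cU(3) cW(3) assms
    by (auto simp: seq_rel_def St1_eq)
qed

lemma equiv_pointed_multisets:
  "equiv (pointed_multisets G m N) (translate_rel G (pointed_multisets G m N))"
  by (rule group.equiv_translate_rel[OF group_coset_group]) (rule pointed_multisetsD)

lemma equiv_seq_rel:
  assumes "m > 0"
  shows "equiv (St1 p n m N) (seq_rel F p n m N)"
proof (rule equiv_vimageI[OF equiv_pointed_multisets, where f = mset])
  show "mset qs \<in> pointed_multisets G m N" if "qs \<in> St1 p n m N" for qs
    using that by (auto simp: St1_eq[OF assms])
  show "(qs, rs) \<in> seq_rel F p n m N \<longleftrightarrow> qs \<in> St1 p n m N \<and> rs \<in> St1 p n m N \<and>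
      (mset qs, mset rs) \<in> translate_rel G (pointed_multisets G m N)" for qs rs
  proof (cases "qs \<in> St1 p n m N \<and> rs \<in> St1 p n m N")
    case True
    then obtain U W where "U \<in> pointed_multisets G m N" "W \<in> pointed_multisets G m N"
      "qs = sorted_list_of_multiset U" "rs = sorted_list_of_multiset W"
      by (auto simp: St1_eq[OF assms])
    then show ?thesis using seq_rel_iff[OF assms] True by simp
  qed (auto simp: seq_rel_def)
qed

lemma T_eq:
  assumes "m > 0"
  shows "T F p n m N = card (pointed_multisets G m N // translate_rel G (pointed_multisets G m N))"
  unfolding T_def
proof (rule card_quotient_eqI[OF equiv_seq_rel[OF assms] equiv_pointed_multisets,
      where f = sorted_list_of_multiset])
  fix qs assume qs: "qs \<in> St1 p n m N"
  then obtain U where "U \<in> pointed_multisets G m N" "qs = sorted_list_of_multiset U"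
    by (auto simp: St1_eq[OF assms])
  moreover have "(qs, qs) \<in> seq_rel F p n m N"
    using equiv_class_self[OF equiv_seq_rel[OF assms] qs] by simp
  ultimately show "\<exists>U\<in>pointed_multisets G m N. (sorted_list_of_multiset U, qs) \<in> seq_rel F p n m N"
    by blast
qed (use seq_rel_iff[OF assms] in \<open>auto simp: St1_eq[OF assms]\<close>)

text \<open>Translation preserves size and support size, so membership of the neutral element is the
  only constraint left on a translate.\<close>

lemma translate_rel_class:
  assumes "U \<in> pointed_multisets G m N"
  shows "translate_rel G (pointed_multisets G m N) `` {U}
       = {Y. \<one>\<^bsub>G\<^esub> \<in># Y \<and> (\<exists>g\<in>carrier G. Y = translate G g U)}"
  using assms group.translate_carrier[OF group_coset_group] group.size_translate[OF group_coset_group]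
    group.card_set_mset_translate[OF group_coset_group]
  unfolding translate_rel_def pointed_multisets_def multisets_of_size_def by auto

lemma card_translate_rel_class:
  assumes "U \<in> pointed_multisets G m N"
  shows "card (translate_rel G (pointed_multisets G m N) `` {U}) * card (stabilizer_mset G U) = N"
  using group.card_translates_containing_one[OF group_coset_group pointed_multisetsD(2)[OF assms]]
    translate_rel_class[OF assms] assms by (simp add: pointed_multisets_def)

lemma N_mult_T:
  assumes "m > 0"
  shows "N * T F p n m N = (\<Sum>U\<in>pointed_multisets G m N. card (stabilizer_mset G U))"
  unfolding T_eq[OF assms]
  by (rule card_quotient_weighted[OF equiv_pointed_multisets])
     (use card_translate_rel_class group.finite_pointed_multisets[OF group_coset_group finite_carrier_coset_group] in auto)

lemma card_seq_rel_class:
  assumes "m > 0" "U \<in> pointed_multisets G m N"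
  shows "card (seq_rel F p n m N `` {sorted_list_of_multiset U})
       = card (translate_rel G (pointed_multisets G m N) `` {U})"
proof -
  have "seq_rel F p n m N `` {sorted_list_of_multiset U}
      = sorted_list_of_multiset ` (translate_rel G (pointed_multisets G m N) `` {U})"
  proof (intro equalityI subsetI)
    fix rs assume rs: "rs \<in> seq_rel F p n m N `` {sorted_list_of_multiset U}"
    then have "rs \<in> St1 p n m N" by (auto simp: seq_rel_def)
    then obtain W where "W \<in> pointed_multisets G m N" "rs = sorted_list_of_multiset W"
      by (auto simp: St1_eq[OF assms(1)])
    then show "rs \<in> sorted_list_of_multiset ` (translate_rel G (pointed_multisets G m N) `` {U})"
      using rs seq_rel_iff[OF assms] by auto
  next
    fix rs assume "rs \<in> sorted_list_of_multiset ` (translate_rel G (pointed_multisets G m N) `` {U})"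
    then obtain W where W: "(U, W) \<in> translate_rel G (pointed_multisets G m N)" "rs = sorted_list_of_multiset W"
      by blast
    then have "W \<in> pointed_multisets G m N" by (auto simp: translate_rel_def)
    then show "rs \<in> seq_rel F p n m N `` {sorted_list_of_multiset U}"
      using W seq_rel_iff[OF assms] by auto
  qed
  then show ?thesis
    using card_image[OF inj_on_subset[OF inj_sorted_list_of_multiset subset_UNIV]] by metis
qed

text \<open>Together the conditions of \<open>StH\<close> say that multiplicities are constant on
  the cosets of \<open>H\<close>: a coset in the union has equal positive multiplicities, and any
  other coset is disjoint from the support. \<open>H \<subseteq> S\<close> supplies the entry
  1.\<close>

lemma StH_eq:
  assumes m: "m > 0" and H: "subgroup H G"
  shows "StH p n H m N =
    sorted_list_of_multiset ` {U \<in> pointed_multisets G m N. H \<subseteq> stabilizer_mset G U}"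
proof (intro equalityI subsetI)
  interpret Gr: group G by (rule group_coset_group)
  note disj = Gr.rcos_disjoint[OF H]
  fix qs assume qs: "qs \<in> StH p n H m N"
  then obtain U where U: "U \<in> multisets_of_size (carrier G) m" "qs = sorted_list_of_multiset U"
    unfolding StH_def suitable_sorted_list_of_multiset_iff by blast
  have c: "set_mset U \<subseteq> carrier G" using U by (simp add: multisets_of_size_def)
  have card: "card (set_mset U) = N" and HU: "H \<subseteq> set_mset U"
    using qs by (auto simp: StH_def U(2))
  obtain \<C> where \<C>: "\<C> \<subseteq> rcosets\<^bsub>G\<^esub> H" "set_mset U = \<Union>\<C>"
    using qs by (auto simp: StH_def U(2))
  have cnt: "count U a = count U b"
    if "C \<in> rcosets\<^bsub>G\<^esub> H" "a \<in> set_mset U \<inter> C" "b \<in> set_mset U \<inter> C" for C a b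
  proof -
    have "\<forall>C\<in>rcosets\<^bsub>G\<^esub> H. \<forall>a\<in>set qs \<inter> C. \<forall>b\<in>set qs \<inter> C. count_list qs a = count_list qs b"
      using qs unfolding StH_def by blast
    moreover have "a \<in> set qs \<inter> C" "b \<in> set qs \<inter> C" using that U(2) by simp_all
    ultimately have "count_list qs a = count_list qs b" using that(1) by blast
    then show ?thesis unfolding count_mset[symmetric] U(2) by simp
  qed
  have "\<forall>C\<in>rcosets\<^bsub>G\<^esub> H. \<forall>a\<in>C. \<forall>b\<in>C. count U a = count U b"
  proof (intro ballI)
    fix C a b assume C: "C \<in> rcosets\<^bsub>G\<^esub> H" and ab: "a \<in> C" "b \<in> C"
    show "count U a = count U b"
    proof (cases "C \<in> \<C>")
      case True
      then have "a \<in># U" "b \<in># U" using ab \<C>(2) by auto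
      then show ?thesis using cnt[OF C] ab by blast
    next
      case False
      have "x \<notin># U" if "x \<in> C" for x
      proof
        assume "x \<in># U"
        then obtain D where "D \<in> \<C>" "x \<in> D" using \<C>(2) by blast
        moreover from this have "C \<noteq> D" "D \<in> rcosets\<^bsub>G\<^esub> H" using False \<C>(1) by auto
        ultimately show False using C disj \<open>x \<in> C\<close> unfolding pairwise_def disjnt_def by blast
      qed
      then show ?thesis using ab by (simp add: not_in_iff)
    qed
  qed
  then have "H \<subseteq> stabilizer_mset G U" using Gr.subset_stabilizer_mset_iff[OF c H] by blast
  moreover have "U \<in> pointed_multisets G m N"
    using U(1) card HU subgroup.one_closed[OF H] by (auto simp: pointed_multisets_def)
  ultimately show "qs \<in> sorted_list_of_multiset ` {U \<in> pointed_multisets G m N. H \<subseteq> stabilizer_mset G U}"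
    using U(2) by blast
next
  interpret Gr: group G by (rule group_coset_group)
  note disj = Gr.rcos_disjoint[OF H]
  fix qs assume "qs \<in> sorted_list_of_multiset ` {U \<in> pointed_multisets G m N. H \<subseteq> stabilizer_mset G U}"
  then obtain U where U: "U \<in> pointed_multisets G m N" "H \<subseteq> stabilizer_mset G U"
    "qs = sorted_list_of_multiset U" by blast
  have c: "set_mset U \<subseteq> carrier G" by (rule pointed_multisetsD(2)[OF U(1)])
  have cnt: "count U a = count U b" if "C \<in> rcosets\<^bsub>G\<^esub> H" "a \<in> C" "b \<in> C" for C a b
    using Gr.subset_stabilizer_mset_iff[OF c H] U(2) that by blast
  have full: "C \<subseteq> set_mset U" if "C \<in> rcosets\<^bsub>G\<^esub> H" "a \<in> C" "a \<in># U" for C a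
  proof
    fix b assume "b \<in> C"
    then have "count U b = count U a" using cnt that by blast
    then show "b \<in># U" using that(3) by (metis count_eq_zero_iff)
  qed
  have "H \<in> rcosets\<^bsub>G\<^esub> H" by (rule subgroup.subgroup_in_rcosets[OF H group_coset_group])
  then have "H \<subseteq> set_mset U"
    using full[of H "\<one>\<^bsub>G\<^esub>"] U(1) subgroup.one_closed[OF H] by (auto simp: pointed_multisets_def)
  moreover have "\<exists>\<C> \<subseteq> rcosets\<^bsub>G\<^esub> H. disjoint \<C> \<and> set_mset U = \<Union>\<C>"
  proof (intro exI conjI)
    \<comment> \<open>By \<open>full\<close>, a coset that meets the support lies inside it, so
      these cosets cover the support.\<close>
    let ?\<C> = "{C \<in> rcosets\<^bsub>G\<^esub> H. C \<subseteq> set_mset U}"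
    show "?\<C> \<subseteq> rcosets\<^bsub>G\<^esub> H" by blast
    then show "disjoint ?\<C>" using disj pairwise_subset by blast
    show "set_mset U = \<Union>?\<C>"
    proof (intro equalityI subsetI)
      fix a assume a: "a \<in># U"
      then have "a \<in> \<Union>(rcosets\<^bsub>G\<^esub> H)" using c Gr.rcosets_part_G[OF H] by blast
      then show "a \<in> \<Union>?\<C>" using full a by blast
    qed blast
  qed
  moreover have "suitable p n m qs"
    using U pointed_multisetsD(1) unfolding suitable_sorted_list_of_multiset_iff by blast
  moreover have "card (set_mset U) = N" using U(1) by (simp add: pointed_multisets_def)
  moreover have "\<forall>C\<in>rcosets\<^bsub>G\<^esub> H. \<forall>a\<in>set_mset U \<inter> C. \<forall>b\<in>set_mset U \<inter> C. count_list qs a = count_list qs b"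
    unfolding count_mset[symmetric] U(3) mset_sorted_list_of_multiset using cnt by blast
  moreover have set: "set qs = set_mset U" by (simp add: U(3))
  ultimately show "qs \<in> StH p n H m N" unfolding StH_def mem_Collect_eq set by (intro conjI)
qed

text \<open>Class size times stabilizer order is \<open>N\<close>, so class size
  \<open>N div d\<close> means that the stabilizer has order \<open>d\<close>. As it contains
  \<open>H\<close>, which has the same order, it equals \<open>H\<close>.\<close>

lemma card_Sbar:
  assumes m: "m > 0" and N: "N > 0" and H: "H \<in> subgroups_of_order G d" and d: "d dvd N"
  shows "card (Sbar F p n m N H) = card {U \<in> pointed_multisets G m N. stabilizer_mset G U = H}"
proof -
  have sub: "subgroup H G" and dH: "card H = d" using H by (auto simp: subgroups_of_order_def)
  have iff: "card (seq_rel F p n m N `` {sorted_list_of_multiset U}) = N div d \<longleftrightarrow> stabilizer_mset G U = H"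
    if U: "U \<in> pointed_multisets G m N" and HU: "H \<subseteq> stabilizer_mset G U" for U
  proof -
    let ?c = "card (translate_rel G (pointed_multisets G m N) `` {U})"
    let ?s = "card (stabilizer_mset G U)"
    have prod: "?c * ?s = N" by (rule card_translate_rel_class[OF U])
    have d0: "d > 0" using d N by (auto intro: Nat.gr0I)
    obtain e where e: "N = d * e" using d by blast
    have "?c = N div d \<longleftrightarrow> ?s = d"
    proof
      assume "?c = N div d"
      then have "e * ?s = e * d" "e > 0" using prod e d0 N by auto
      then show "?s = d" by simp
    next
      assume "?s = d"
      then show "?c = N div d" using prod d0 by (metis div_mult_self_is_m)
    qed
    moreover have "?s = d \<longleftrightarrow> stabilizer_mset G U = H"
    proof -
      have "?s > 0" using prod N by (auto intro: Nat.gr0I)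
      then have "finite (stabilizer_mset G U)" by (rule card_ge_0_finite)
      then show ?thesis using card_subset_eq[OF _ HU] dH by metis
    qed
    ultimately show ?thesis using card_seq_rel_class[OF m U] by simp
  qed
  have "Sbar F p n m N H = sorted_list_of_multiset ` {U \<in> pointed_multisets G m N. stabilizer_mset G U = H}"
    unfolding Sbar_def StH_eq[OF m sub] dH using iff by auto
  then show ?thesis
    using card_image[OF inj_on_subset[OF inj_sorted_list_of_multiset subset_UNIV]] by metis
qed

end

section \<open>Counting all near-vector spaces by support size\<close>

context galois_field
begin

text \<open>One set of scalars arises from several sequences, for instance after multiplying all
  exponents by a common unit modulo \<open>M\<close>; \<open>c\<close> fixes a choice.\<close>

lemma nvs_over_rel_iff:
  assumes m: "m > 0"
    and c: "\<And>A. A \<in> nvs_over F m \<Longrightarrow> unit_seq (c A) \<and> length (c A) = m \<and> A = seq_scalars F (c A)"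
  shows "(A, B) \<in> nvs_over_rel F m \<longleftrightarrow> A \<in> nvs_over F m \<and> B \<in> nvs_over F m \<and>
    (coset_mset (c A), coset_mset (c B)) \<in> translate_rel G (multisets_of_size (carrier G) m)"
proof (cases "A \<in> nvs_over F m \<and> B \<in> nvs_over F m")
  case True
  then show ?thesis
    using nvs_isomorphic_iff_translate[of "c A" "c B" m] c[of A] c[of B]
    unfolding nvs_over_rel_def by auto
qed (auto simp: nvs_over_rel_def)

lemma equiv_multisets_of_size:
  "equiv (multisets_of_size (carrier G) m) (translate_rel G (multisets_of_size (carrier G) m))"
  by (rule group.equiv_translate_rel[OF group_coset_group]) (simp add: multisets_of_size_def)

lemma card_nvs_over_quotient:
  assumes m: "m > 0"
  defines "P \<equiv> {U \<in> multisets_of_size (carrier G) m. \<one>\<^bsub>G\<^esub> \<in># U}"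
  shows "card (nvs_over F m // nvs_over_rel F m) = card (P // translate_rel G P)"
proof -
  interpret Gr: group G by (rule group_coset_group)
  let ?MS = "multisets_of_size (carrier G) m"
  have "\<exists>qs. unit_seq qs \<and> length qs = m \<and> A = seq_scalars F qs" if "A \<in> nvs_over F m" for A
    using that nvs_over_eq[OF m] by auto
  then obtain c where c: "\<And>A. A \<in> nvs_over F m \<Longrightarrow> unit_seq (c A) \<and> length (c A) = m \<and> A = seq_scalars F (c A)"
    by metis
  have mem: "coset_mset (c A) \<in> ?MS" if "A \<in> nvs_over F m" for A
    using coset_mset_in_multisets_of_size[of "c A"] c[OF that] by simp
  define f where "f = (\<lambda>U. seq_scalars F (sorted_list_of_multiset U))"
  note sl = coset_mset_sorted_list_of_multiset[OF m]
  have P: "U \<in> ?MS" if "U \<in> P" for U using that by (simp add: P_def)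
  have iso: "nvs_isomorphic (V m) (f U) (V m) (seq_scalars F qs) \<longleftrightarrow>
      (U, coset_mset qs) \<in> translate_rel G ?MS" if "U \<in> P" "unit_seq qs" "length qs = m" for U qs
    using nvs_isomorphic_iff_translate[OF sl(1) that(2) sl(2) that(3)] sl(3) P[OF that(1)]
    by (simp add: f_def)
  have fP: "f U \<in> nvs_over F m" if "U \<in> P" for U
    unfolding nvs_over_eq[OF m] f_def using sl(1,2)[OF P[OF that]] by blast
  show ?thesis
  proof (rule card_quotient_eqI[where f = f])
    show "equiv (nvs_over F m) (nvs_over_rel F m)"
      by (rule equiv_vimageI[OF equiv_multisets_of_size mem nvs_over_rel_iff[OF m c]])
    show "equiv P (translate_rel G P)"
      by (rule Gr.equiv_translate_rel) (auto simp: P_def multisets_of_size_def)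
    show "f U \<in> nvs_over F m" if "U \<in> P" for U using fP[OF that] .
    show "(U, W) \<in> translate_rel G P \<longleftrightarrow> (f U, f W) \<in> nvs_over_rel F m" if UW: "U \<in> P" "W \<in> P" for U W
    proof -
      have "(f U, f W) \<in> nvs_over_rel F m \<longleftrightarrow> nvs_isomorphic (V m) (f U) (V m) (f W)"
        using fP UW by (simp add: nvs_over_rel_def)
      also have "\<dots> \<longleftrightarrow> (U, W) \<in> translate_rel G ?MS"
        using iso[OF UW(1) sl(1,2)[OF P[OF UW(2)]]] sl(3)[OF P[OF UW(2)]] by (simp add: f_def)
      finally show ?thesis using UW P by (auto simp: translate_rel_def)
    qed
    show "\<exists>U\<in>P. (f U, A) \<in> nvs_over_rel F m" if A: "A \<in> nvs_over F m" for A
    proof -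
      let ?W = "coset_mset (c A)"
      have W: "?W \<in> ?MS" by (rule mem[OF A])
      then have sub: "set_mset ?W \<subseteq> carrier G" and "size ?W = m" by (auto simp: multisets_of_size_def)
      then obtain w where w: "w \<in># ?W" using m by (metis multiset_nonemptyE not_less_zero size_empty)
      then have wG: "w \<in> carrier G" using sub by blast
      \<comment> \<open>Translating by the inverse of a point of the support brings the neutral
        element into the support.\<close>
      define U where "U = translate G (inv\<^bsub>G\<^esub> w) ?W"
      have "inv\<^bsub>G\<^esub> w \<otimes>\<^bsub>G\<^esub> w \<in># U" using w by (auto simp: U_def translate_def)
      moreover have UM: "U \<in> ?MS"
        using W Gr.translate_carrier[OF sub, of "inv\<^bsub>G\<^esub> w"] wG by (simp add: multisets_of_size_def U_def)
      ultimately have UP: "U \<in> P" using wG by (simp add: P_def)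
      have "?W = translate G w U" using Gr.translate_inv_eq[OF sub _ U_def] wG by simp
      then have "(U, ?W) \<in> translate_rel G ?MS" using UM W wG by (auto simp: translate_rel_def)
      then have "nvs_isomorphic (V m) (f U) (V m) A" using iso[OF UP, of "c A"] c[OF A] by simp
      then have "(f U, A) \<in> nvs_over_rel F m" using fP[OF UP] A by (simp add: nvs_over_rel_def)
      then show ?thesis using UP by blast
    qed
  qed
qed

text \<open>The support size \<open>N\<close> is constant on classes, so the quotient is a disjoint
  union over \<open>N\<close>. The range reflects a nonempty support that has at most
  \<open>m\<close> points, all in \<open>G\<close>.\<close>

lemma card_quotient_by_support:
  assumes m: "m > 0"
  defines "P \<equiv> {U \<in> multisets_of_size (carrier G) m. \<one>\<^bsub>G\<^esub> \<in># U}"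
  shows "card (P // translate_rel G P)
    = (\<Sum>N = 1..min m (order G). card (pointed_multisets G m N // translate_rel G (pointed_multisets G m N)))"
proof -
  interpret Gr: group G by (rule group_coset_group)
  let ?P = "\<lambda>N. pointed_multisets G m N"
  let ?Q = "\<lambda>N. ?P N // translate_rel G (?P N)"
  let ?I = "{1..min m (order G)}"
  have cls: "translate_rel G P `` {U} = translate_rel G (?P N) `` {U}" if "U \<in> ?P N" for U and N :: nat
    using that Gr.card_set_mset_translate by (auto simp: translate_rel_def P_def pointed_multisets_def multisets_of_size_def)
  have PN: "U \<in> P \<longleftrightarrow> (\<exists>N\<in>?I. U \<in> ?P N)" for U
  proof
    assume U: "U \<in> P"
    then have "set_mset U \<subseteq> carrier G" "size U = m" "set_mset U \<noteq> {}"
      by (auto simp: P_def multisets_of_size_def)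
    then have "card (set_mset U) \<in> ?I"
      using card_set_mset_le_size[of U] card_mono[OF finite_carrier_coset_group] 
      by (auto simp: order_def Suc_le_eq card_gt_0_iff)
    then show "\<exists>N\<in>?I. U \<in> ?P N" using U by (auto simp: P_def pointed_multisets_def)
  qed (auto simp: P_def pointed_multisets_def)
  have "P // translate_rel G P = (\<Union>N\<in>?I. ?Q N)"
  proof (intro equalityI subsetI)
    fix C assume "C \<in> P // translate_rel G P"
    then obtain U where U: "U \<in> P" "C = translate_rel G P `` {U}" by (rule quotientE)
    then obtain N where "N \<in> ?I" "U \<in> ?P N" using PN by blast
    then show "C \<in> (\<Union>N\<in>?I. ?Q N)" using U cls by (auto intro: quotientI)
  next
    fix C assume "C \<in> (\<Union>N\<in>?I. ?Q N)"
    then obtain N U where "N \<in> ?I" "U \<in> ?P N" "C = translate_rel G (?P N) `` {U}"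
      by (auto elim: quotientE)
    then show "C \<in> P // translate_rel G P" using PN cls by (metis quotientI)
  qed
  also have "card \<dots> = (\<Sum>N\<in>?I. card (?Q N))"
  proof (rule card_UN_disjoint)
    show "\<forall>N\<in>?I. finite (?Q N)"
      using Gr.finite_pointed_multisets[OF finite_carrier_coset_group]
      by (auto intro!: finite_quotient simp: translate_rel_def)
    show "\<forall>N\<in>?I. \<forall>N'\<in>?I. N \<noteq> N' \<longrightarrow> ?Q N \<inter> ?Q N' = {}"
    proof (intro ballI impI)
      fix N N' :: nat assume "N \<noteq> N'"
      then have disj: "?P N \<inter> ?P N' = {}" by (auto simp: pointed_multisets_def)
      show "?Q N \<inter> ?Q N' = {}"
      proof (rule ccontr)
        assume "?Q N \<inter> ?Q N' \<noteq> {}"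
        then obtain C where C: "C \<in> ?Q N" "C \<in> ?Q N'" by blast
        then have "C \<noteq> {}" by (metis equiv_pointed_multisets in_quotient_imp_non_empty)
        moreover have "C \<subseteq> ?P N" "C \<subseteq> ?P N'"
          using C in_quotient_imp_subset[OF equiv_pointed_multisets] by blast+
        ultimately show False using disj by blast
      qed
    qed
  qed simp
  finally show ?thesis .
qed

lemma card_nvs_over_eq_sum_T:
  assumes "m > 0"
  shows "card (nvs_over F m // nvs_over_rel F m) = (\<Sum>N = 1..min m (order G). T F p n m N)"
  using card_nvs_over_quotient[OF assms] card_quotient_by_support[OF assms] T_eq[OF assms] by simp

section \<open>Formula and recursion for a fixed support size\<close>

context
  fixes m N :: nat
  assumes m: "m > 0" and N: "N > 0"
begin

definition common_divisor_set :: "nat set" where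
  "common_divisor_set = {d. 1 < d \<and> d dvd gcd m (gcd N (order G))}"

lemma finite_common_divisor_set: "finite common_divisor_set"
  using m unfolding common_divisor_set_def by (intro finite_subset[OF _ finite_atMost[of m]]) (auto dest: dvd_imp_le)

lemma common_divisors_eq: "common_divisors p n m N = sorted_list_of_set common_divisor_set"
  by (simp add: common_divisors_def common_divisor_set_def)

lemma divisor_in_common_divisor_set:
  assumes "i \<in> {1..card common_divisor_set}"
  shows "divisor p n m N i \<in> common_divisor_set"
  using bij_betwE[OF bij_betw_sorted_list_of_set_nth[OF finite_common_divisor_set]] assms
  by (simp add: divisor_def common_divisors_eq)

lemma card_Sbar_eq:
  assumes "d \<in> common_divisor_set" "H \<in> subgroups_of_order G d"
  shows "card (Sbar F p n m N H) = card {U \<in> pointed_multisets G m N. stabilizer_mset G U = H}"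
  using assms by (intro card_Sbar[OF m N]) (auto simp: common_divisor_set_def)

lemma T_formula:
  "real (T F p n m N) = real (t_init p n m N) / real N +
     1 / real N * (\<Sum>i = 1..card common_divisor_set. (real (divisor p n m N i) - 1) *
       (\<Sum>H\<in>subgroups_of_order G (divisor p n m N i). real (card (Sbar F p n m N H))))"
proof -
  interpret Gr: group G by (rule group_coset_group)
  let ?g = "\<lambda>d. (d - 1) * (\<Sum>H\<in>subgroups_of_order G d. card (Sbar F p n m N H))"
  have init: "card (pointed_multisets G m N) = t_init p n m N"
    unfolding pointed_multisets_def t_init_def order_def
    by (rule card_multisets_of_size_support_card[OF finite_carrier_coset_group Gr.one_closed N m])
  have "N * T F p n m N = t_init p n m N + (\<Sum>d\<in>common_divisor_set. ?g d)"
    unfolding N_mult_T[OF m] Gr.sum_card_stabilizer_mset[OF finite_carrier_coset_group m] init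
      common_divisor_set_def[symmetric] by (simp add: card_Sbar_eq)
  also have "(\<Sum>d\<in>common_divisor_set. ?g d) = (\<Sum>i = 1..card common_divisor_set. ?g (divisor p n m N i))"
    unfolding divisor_def common_divisors_eq
    by (rule sum.reindex_bij_betw[OF bij_betw_sorted_list_of_set_nth[OF finite_common_divisor_set], symmetric])
  finally have "real (N * T F p n m N) = real (t_init p n m N + (\<Sum>i = 1..card common_divisor_set. ?g (divisor p n m N i)))"
    by (rule arg_cong)
  moreover have "real (\<Sum>i = 1..card common_divisor_set. ?g (divisor p n m N i)) =
      (\<Sum>i = 1..card common_divisor_set. (real (divisor p n m N i) - 1) *
       (\<Sum>H\<in>subgroups_of_order G (divisor p n m N i). real (card (Sbar F p n m N H))))"
  proof -
    have "real (?g (divisor p n m N i)) = (real (divisor p n m N i) - 1) *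
       (\<Sum>H\<in>subgroups_of_order G (divisor p n m N i). real (card (Sbar F p n m N H)))"
      if "i \<in> {1..card common_divisor_set}" for i
      using divisor_in_common_divisor_set[OF that] by (simp add: common_divisor_set_def of_nat_diff)
    then show ?thesis unfolding of_nat_sum by (intro sum.cong refl)
  qed
  ultimately have "real N * real (T F p n m N) = real (t_init p n m N) +
      (\<Sum>i = 1..card common_divisor_set. (real (divisor p n m N i) - 1) *
       (\<Sum>H\<in>subgroups_of_order G (divisor p n m N i). real (card (Sbar F p n m N H))))"
    by (simp only: of_nat_mult of_nat_add)
  then show ?thesis using N by (simp add: field_simps)
qed

text \<open>The recursion before it is solved for the term of \<open>H\<close>. The additive form
  stays in the natural numbers without truncated subtraction.\<close>

lemma t_div_eq_sum:
  assumes i: "i \<in> {1..card common_divisor_set}" and H: "H \<in> subgroups_of_order G (divisor p n m N i)"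
  shows "t_div p n m N (divisor p n m N i) = card (Sbar F p n m N H) +
    (\<Sum>s = i + 1..card common_divisor_set. \<Sum>K\<in>overgroups p n (divisor p n m N s) H. card (Sbar F p n m N K))"
proof -
  interpret Gr: group G by (rule group_coset_group)
  let ?d = "divisor p n m N i"
  let ?f = "\<lambda>e. \<Sum>K\<in>overgroups p n e H. card (Sbar F p n m N K)"
  have d: "?d \<in> common_divisor_set" by (rule divisor_in_common_divisor_set[OF i])
  then have d0: "?d > 0" by (simp add: common_divisor_set_def)
  have sub: "subgroup H G" and card: "card H = ?d" using H by (auto simp: subgroups_of_order_def)
  have above: "{e. ?d < e \<and> e dvd gcd m (gcd N (order G))} = {e \<in> common_divisor_set. ?d < e}"
    using d by (auto simp: common_divisor_set_def)
  have "t_div p n m N ?d = card {U \<in> pointed_multisets G m N. H \<subseteq> stabilizer_mset G U}"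
    using Gr.card_stable_pointed_multisets[OF finite_carrier_coset_group sub _ _ m N] d card
    by (simp add: t_div_def common_divisor_set_def)
  also have "\<dots> = card (Sbar F p n m N H) + (\<Sum>e | e \<in> common_divisor_set \<and> ?d < e. ?f e)"
  proof -
    have "(\<Sum>K\<in>{K \<in> subgroups_of_order G e. H \<subseteq> K}.
        card {U \<in> pointed_multisets G m N. stabilizer_mset G U = K}) = ?f e" if "e \<in> common_divisor_set" for e
      unfolding overgroups_def by (rule sum.cong) (simp_all add: card_Sbar_eq[OF that])
    then show ?thesis
      unfolding Gr.card_stable_eq_sum[OF finite_carrier_coset_group H d0 m, of N] above
        card_Sbar_eq[OF d H] by simp
  qed
  also have "(\<Sum>e | e \<in> common_divisor_set \<and> ?d < e. ?f e) = (\<Sum>s = i + 1..card common_divisor_set. ?f (divisor p n m N s))"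
    using sum_sorted_list_of_set_greater[OF finite_common_divisor_set i, of ?f]
    by (simp add: divisor_def common_divisors_eq)
  finally show ?thesis .
qed

end

end

theorem theorem4p6:
  fixes F :: "('a, 'b) ring_scheme" and p n m :: nat
  assumes "Factorial_Ring.prime p" and "n \<ge> 1" and "m \<ge> 1"
    and "field F" and "order F = p ^ n"
  shows "card (nvs_over F m // nvs_over_rel F m) =
           (\<Sum>N = 1..min m (order (coset_group p n)). T F p n m N) \<and>
         (\<forall>N\<in>{1..min m (order (coset_group p n))}.
           let l = length (common_divisors p n m N);
               d = divisor p n m N;
               \<H> = (\<lambda>i. subgroups_of_order (coset_group p n) (d i));
               S = (\<lambda>H. card (Sbar F p n m N H));
               t = t_div p n m N;
               C = (\<lambda>s. overgroups p n (d s))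
           in
             real (T F p n m N) =
               real (t_init p n m N) / real N +
               1 / real N * (\<Sum>i = 1..l. (real (d i) - 1) * (\<Sum>H\<in>\<H> i. real (S H))) \<and>
             (1 \<le> l \<longrightarrow> (\<forall>H\<in>\<H> l. S H = t (d l))) \<and>
             (2 \<le> l \<longrightarrow> (\<forall>H\<in>\<H> (l - 1).
               int (S H) = int (t (d (l - 1))) - int (card (C l H)) * int (t (d l)))) \<and>
             (\<forall>v. 2 \<le> v \<and> v < l \<longrightarrow> (\<forall>H\<in>\<H> (l - v).
               int (S H) = int (t (d (l - v)))
                 - (\<Sum>s = l - v + 1..l - 1. \<Sum>K\<in>C s H. int (S K))
                 - int (card (C l H)) * int (t (d l)))))"
proof -
  interpret galois_field p n "p ^ n - 1" F
    using assms by (simp add: galois_field_def prime_power_def galois_field_axioms_def)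
  have m: "m > 0" using assms by simp
  show ?thesis
  proof (intro conjI ballI, goal_cases)
    case 1
    show ?case by (rule card_nvs_over_eq_sum_T[OF m])
  next
    case (2 N)
    then have N: "N > 0" by simp
    define l where "l = length (common_divisors p n m N)"
    define d where "d = divisor p n m N"
    define S where "S = (\<lambda>H. card (Sbar F p n m N H))"
    define \<H> where "\<H> = (\<lambda>i. subgroups_of_order (coset_group p n) (d i))"
    define C where "C = (\<lambda>s. overgroups p n (d s))"
    note defs = l_def d_def S_def \<H>_def C_def
    have l: "l = card (common_divisor_set m N)"
      by (simp add: l_def common_divisors_eq[OF m N])
    have split: "int (t_div p n m N (d i)) = int (S H) + (\<Sum>s = i + 1..l. \<Sum>K\<in>C s H. int (S K))"
      if "i \<in> {1..l}" "H \<in> \<H> i" for i H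
      using t_div_eq_sum[OF m N, of i H] that unfolding l defs(2-) by simp
    \<comment> \<open>Beyond the last divisor the sum is empty.\<close>
    have top: "S H = t_div p n m N (d l)" if "1 \<le> l" "H \<in> \<H> l" for H
      using split[of l H] that by simp
    \<comment> \<open>All subgroups of order \<open>d l\<close> have the same count, so the sum over
      those containing \<open>H\<close> is their number times that count.\<close>
    have last: "(\<Sum>K\<in>C l H. int (S K)) = int (card (C l H)) * int (t_div p n m N (d l))" if "1 \<le> l" for H
    proof -
      have "int (S K) = int (t_div p n m N (d l))" if "K \<in> C l H" for K
        using top[OF \<open>1 \<le> l\<close>, of K] that by (simp add: C_def \<H>_def overgroups_def)
      then show ?thesis by simp
    qed
    have T_sum: "real (T F p n m N) = real (t_init p n m N) / real N +
        1 / real N * (\<Sum>i = 1..l. (real (d i) - 1) * (\<Sum>H\<in>\<H> i. real (S H)))"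
      unfolding l defs(2-) by (rule T_formula[OF m N])
    have below_top: "int (S H) = int (t_div p n m N (d (l - 1))) - int (card (C l H)) * int (t_div p n m N (d l))"
      if "2 \<le> l" "H \<in> \<H> (l - 1)" for H
    proof -
      have "{l - 1 + 1..l} = {l}" using that(1) by auto
      then show ?thesis using split[of "l - 1" H] last[of H] that by simp
    qed
    have lower: "int (S H) = int (t_div p n m N (d (l - v)))
        - (\<Sum>s = l - v + 1..l - 1. \<Sum>K\<in>C s H. int (S K))
        - int (card (C l H)) * int (t_div p n m N (d l))"
      if v: "2 \<le> v \<and> v < l" and H: "H \<in> \<H> (l - v)" for v H
    proof -
      \<comment> \<open>The index \<open>l\<close> is split off because its contribution is known in
        closed form.\<close>
      have "{l - v + 1..l} = insert l {l - v + 1..l - 1}" "l \<notin> {l - v + 1..l - 1}" using v by auto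
      then have "(\<Sum>s = l - v + 1..l. \<Sum>K\<in>C s H. int (S K))
          = (\<Sum>K\<in>C l H. int (S K)) + (\<Sum>s = l - v + 1..l - 1. \<Sum>K\<in>C s H. int (S K))"
        by simp
      moreover have "l - v \<in> {1..l}" using v by auto
      ultimately show ?thesis using split[OF _ H] last[of H] v by simp
    qed
    show ?case
      unfolding Let_def
      by (intro conjI impI ballI allI;
          rule T_sum[unfolded defs] top[unfolded defs] below_top[unfolded defs] lower[unfolded defs];
          assumption)
  qed
qed

end
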